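(* Let $\Lambda$ be a hereditary artin algebra and $P$ a basic rigid $\Lambda$-module. Let $(P,X\oplus M)$ be a basic twin rigid module with $X$ indecomposable. If a minimal left $\mathsf{add}\,M$-approximation $f\colon X\to M'$ is a monomorphism, then the following hold. (1) $(P,\operatorname{Coker} f\oplus M)$ is a twin rigid module. (2) There is an arrow $(P,X\oplus M)\to(P,\operatorname{Coker} f\oplus M)$ in the quiver $\mathcal{K}_P$.
   Context: $\mathsf{mod}\,\Lambda$ is the category of finitely generated right $\Lambda$-modules. $\mathsf{add}\,M$ is the full subcategory of direct summands of finite direct sums of $M$. $M$ is rigid if $\operatorname{Ext}^1_\Lambda(M,M)=0$. A pair $(P,I)$ of modules in $\mathsf{mod}\,\Lambda$ is a twin rigid module if $P$ and $I$ are rigid and there are short exact sequences $0\to P\to I^0\to I^1\to 0$ and $0\to P_1\to P_0\to I\to 0$ with $I^0,I^1\in\mathsf{add}\,I$ and $P_0,P_1\in\mathsf{add}\,P$. It is basic if both $P$ and $I$ are basic. $(P,I)$ and $(P',I')$ are isomorphic if $P\cong P'$ and $I\cong I'$. A left $\mathsf{add}\,M$-approximation of $X$ is a map $f\colon X\to M'$ with $M'\in\mathsf{add}\,M$ through which every map from $X$ to an object of $\mathsf{add}\,M$ factors; it is minimal if every endomorphism $h$ of $M'$ with $hf=f$ is an automorphism. The quiver $\mathcal{K}_P$: its vertices are the isomorphism classes of basic twin rigid modules $(P,I)$ (with $P$ fixed). There is an arrow $(P,I_1)\to(P,I_2)$ if there are decompositions $I_1=X\oplus M$ and $I_2=Y\oplus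 M$ with $X$ and $Y$ indecomposable and a short exact sequence $0\to X\to M'\to Y\to 0$ with $M'\in\mathsf{add}\,M$. *)

theory Defs
  imports "Graph_Theory.Pair_Digraph" "HOL-Algebra.Elementary_Groups" "HOL-Algebra.Ideal" "HOL-Algebra.Module"
begin

section \<open>Right modules\<close>

text \<open>
  The record of HOL-Algebra's (left) modules is reused for right modules:
  \<open>a \<odot>\<^bsub>M\<^esub> x\<close> stands for \<open>x \<cdot> a\<close>, whence the order of the factors in \<open>smult_assoc\<close>.
  The fields \<open>mult\<close> and \<open>one\<close> which this record inherits from rings are never used.
\<close>

locale right_module = R?: ring R + M?: abelian_group M
  for R :: "'r ring" (structure) and M :: "('r, 'm) module" (structure) +
  assumes smult_closed:
      "\<lbrakk>a \<in> carrier R; x \<in> carrier M\<rbrakk> \<Longrightarrow> a \<odot>\<^bsub>M\<^esub> x \<in> carrier M"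
    and smult_l_distr:
      "\<lbrakk>a \<in> carrier R; b \<in> carrier R; x \<in> carrier M\<rbrakk> \<Longrightarrow>
       (a \<oplus>\<^bsub>R\<^esub> b) \<odot>\<^bsub>M\<^esub> x = a \<odot>\<^bsub>M\<^esub> x \<oplus>\<^bsub>M\<^esub> b \<odot>\<^bsub>M\<^esub> x"
    and smult_r_distr:
      "\<lbrakk>a \<in> carrier R; x \<in> carrier M; y \<in> carrier M\<rbrakk> \<Longrightarrow>
       a \<odot>\<^bsub>M\<^esub> (x \<oplus>\<^bsub>M\<^esub> y) = a \<odot>\<^bsub>M\<^esub> x \<oplus>\<^bsub>M\<^esub> a \<odot>\<^bsub>M\<^esub> y"
    and smult_assoc:
      "\<lbrakk>a \<in> carrier R; b \<in> carrier R; x \<in> carrier M\<rbrakk> \<Longrightarrow>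
       (a \<otimes>\<^bsub>R\<^esub> b) \<odot>\<^bsub>M\<^esub> x = b \<odot>\<^bsub>M\<^esub> (a \<odot>\<^bsub>M\<^esub> x)"
    and smult_one: "x \<in> carrier M \<Longrightarrow> \<one>\<^bsub>R\<^esub> \<odot>\<^bsub>M\<^esub> x = x"

definition fin_gen :: "'r ring \<Rightarrow> ('r, 'm) module \<Rightarrow> bool" where
  "fin_gen R M \<longleftrightarrow> (\<exists>S. finite S \<and> S \<subseteq> carrier M \<and>
     (\<forall>x\<in>carrier M. \<exists>c\<in>S \<rightarrow> carrier R. x = (\<Oplus>\<^bsub>M\<^esub>s\<in>S. c s \<odot>\<^bsub>M\<^esub> s)))"

definition fg_mod :: "'r ring \<Rightarrow> ('r, 'm) module \<Rightarrow> bool" where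
  "fg_mod R M \<longleftrightarrow> right_module R M \<and> fin_gen R M"

definition rhom :: "'r ring \<Rightarrow> ('r, 'm) module \<Rightarrow> ('r, 'n) module \<Rightarrow> ('m \<Rightarrow> 'n) set" where
  "rhom R M N = {h \<in> carrier M \<rightarrow> carrier N.
     (\<forall>x\<in>carrier M. \<forall>y\<in>carrier M. h (x \<oplus>\<^bsub>M\<^esub> y) = h x \<oplus>\<^bsub>N\<^esub> h y) \<and>
     (\<forall>a\<in>carrier R. \<forall>x\<in>carrier M. h (a \<odot>\<^bsub>M\<^esub> x) = a \<odot>\<^bsub>N\<^esub> h x)}"

definition mod_iso :: "'r ring \<Rightarrow> ('r, 'm) module \<Rightarrow> ('r, 'n) module \<Rightarrow> bool" where
  "mod_iso R M N \<longleftrightarrow> (\<exists>h\<in>rhom R M N. bij_betw h (carrier M) (carrier N))"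

definition short_exact ::
  "'r ring \<Rightarrow> ('r, 'l) module \<Rightarrow> ('l \<Rightarrow> 'm) \<Rightarrow> ('r, 'm) module \<Rightarrow> ('m \<Rightarrow> 'n) \<Rightarrow> ('r, 'n) module \<Rightarrow> bool"
where
  "short_exact R L f M g N \<longleftrightarrow>
     f \<in> rhom R L M \<and> g \<in> rhom R M N \<and>
     inj_on f (carrier L) \<and> f ` carrier L = a_kernel M N g \<and> g ` carrier M = carrier N"

text \<open>
  HOL cannot quantify over carrier types inside a formula.  Therefore objects of
  \<open>mod \<Lambda>\<close> that are quantified inside a definition are taken with carriers in the fixed
  type \<open>'r list\<close>, where \<open>'r\<close> is the carrier type of \<open>\<Lambda>\<close>.  This loses nothing: an element of a
  finitely generated module can be encoded by a list of coefficients, so every finitely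
  generated module is isomorphic to one of this form, as lemma \<open>fg_mod_representative\<close> shows.
\<close>

type_synonym 'r umod = "('r, 'r list) module"

lemma fg_mod_transport:
  fixes R :: "'r ring" and M :: "('r, 'm) module" and e :: "'m \<Rightarrow> 'n"
  assumes M: "fg_mod R M" and inj: "inj_on e (carrier M)"
  shows "\<exists>N :: ('r, 'n) module. fg_mod R N \<and> mod_iso R M N"
proof -
  interpret right_module R M using M by (simp add: fg_mod_def)
  define d where "d = inv_into (carrier M) e"
  have de [simp]: "d (e x) = x" if "x \<in> carrier M" for x
    using that inj by (simp add: d_def)
  define N :: "('r, 'n) module" where "N = \<lparr>carrier = e ` carrier M, mult = undefined,
    one = undefined, zero = e \<zero>\<^bsub>M\<^esub>, add = (\<lambda>x y. e (d x \<oplus>\<^bsub>M\<^esub> d y)),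
    smult = (\<lambda>a x. e (a \<odot>\<^bsub>M\<^esub> d x))\<rparr>"
  have N_simps: "carrier N = e ` carrier M" "\<zero>\<^bsub>N\<^esub> = e \<zero>\<^bsub>M\<^esub>"
    "\<And>x y. x \<oplus>\<^bsub>N\<^esub> y = e (d x \<oplus>\<^bsub>M\<^esub> d y)" "\<And>a x. a \<odot>\<^bsub>N\<^esub> x = e (a \<odot>\<^bsub>M\<^esub> d x)"
    by (simp_all add: N_def)
  have abN: "abelian_group N"
  proof (rule abelian_groupI)
    fix x assume "x \<in> carrier N"
    then obtain y where y: "y \<in> carrier M" "x = e y" by (auto simp: N_simps)
    show "\<exists>z\<in>carrier N. z \<oplus>\<^bsub>N\<^esub> x = \<zero>\<^bsub>N\<^esub>"
      using y by (intro bexI[of _ "e (\<ominus>\<^bsub>M\<^esub> y)"]) (auto simp: N_simps M.l_neg)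
  qed (auto simp: N_simps M.a_ac)
  have rmN: "right_module R N"
    by (intro right_module.intro R.ring_axioms abN right_module_axioms.intro)
      (auto simp: N_simps smult_closed smult_l_distr smult_r_distr smult_assoc smult_one)
  interpret N: abelian_group N by (rule abN)
  have sum_e: "e (\<Oplus>\<^bsub>M\<^esub>s\<in>S. g s) = (\<Oplus>\<^bsub>N\<^esub>s\<in>S. e (g s))"
    if "finite S" "g \<in> S \<rightarrow> carrier M" for S and g :: "'m \<Rightarrow> 'm"
    using that
  proof (induction S rule: finite_induct)
    case empty
    then show ?case by (simp add: N_simps)
  next
    case (insert s S)
    have "(\<Oplus>\<^bsub>N\<^esub>s\<in>insert s S. e (g s)) = e (g s) \<oplus>\<^bsub>N\<^esub> (\<Oplus>\<^bsub>N\<^esub>s\<in>S. e (g s))"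
      using insert by (intro N.finsum_insert) (auto simp: N_simps)
    also have "\<dots> = e (g s) \<oplus>\<^bsub>N\<^esub> e (\<Oplus>\<^bsub>M\<^esub>s\<in>S. g s)" using insert by simp
    also have "\<dots> = e (g s \<oplus>\<^bsub>M\<^esub> (\<Oplus>\<^bsub>M\<^esub>s\<in>S. g s))"
      using insert.prems by (simp add: N_simps(3) Pi_def M.finsum_closed)
    also have "\<dots> = e (\<Oplus>\<^bsub>M\<^esub>s\<in>insert s S. g s)"
      using insert by (simp add: Pi_def)
    finally show ?case by simp
  qed
  obtain S where S: "finite S" "S \<subseteq> carrier M"
    "\<And>x. x \<in> carrier M \<Longrightarrow> \<exists>c\<in>S \<rightarrow> carrier R. x = (\<Oplus>\<^bsub>M\<^esub>s\<in>S. c s \<odot>\<^bsub>M\<^esub> s)"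
    using M unfolding fg_mod_def fin_gen_def by blast
  have "\<exists>c\<in>e ` S \<rightarrow> carrier R. e x = (\<Oplus>\<^bsub>N\<^esub>s\<in>e ` S. c s \<odot>\<^bsub>N\<^esub> s)"
    if x: "x \<in> carrier M" for x
  proof -
    obtain c where c: "c \<in> S \<rightarrow> carrier R" "x = (\<Oplus>\<^bsub>M\<^esub>s\<in>S. c s \<odot>\<^bsub>M\<^esub> s)"
      using S(3)[OF x] by blast
    have dS: "d (e s) = s" if "s \<in> S" for s using that S(2) by auto
    have injS: "inj_on e S" using inj S(2) by (rule inj_on_subset)
    have cm: "c s \<odot>\<^bsub>M\<^esub> s \<in> carrier M" if "s \<in> S" for s
      using that c(1) S(2) by (auto intro!: smult_closed)
    have "(\<Oplus>\<^bsub>N\<^esub>s\<in>e ` S. c (d s) \<odot>\<^bsub>N\<^esub> s) = (\<Oplus>\<^bsub>N\<^esub>s\<in>S. c (d (e s)) \<odot>\<^bsub>N\<^esub> e s)"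
      using injS cm dS by (intro N.finsum_reindex) (auto simp: N_simps)
    also have "\<dots> = (\<Oplus>\<^bsub>N\<^esub>s\<in>S. e (c s \<odot>\<^bsub>M\<^esub> s))"
      using cm dS by (intro N.finsum_cong') (auto simp: N_simps)
    also have "\<dots> = e x" using sum_e[OF S(1)] cm c(2) by auto
    finally show ?thesis using c(1) dS by (intro bexI[of _ "c \<circ> d"]) (auto simp: Pi_iff)
  qed
  then have "fin_gen R N"
    unfolding fin_gen_def using S(1,2) by (intro exI[of _ "e ` S"]) (auto simp: N_simps)
  moreover have "e \<in> rhom R M N" by (auto simp: rhom_def N_simps)
  moreover have "bij_betw e (carrier M) (carrier N)" using inj by (simp add: bij_betw_def N_simps)
  ultimately show ?thesis using rmN by (auto simp: fg_mod_def mod_iso_def)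
qed

lemma fg_mod_representative:
  assumes M: "fg_mod R (M :: ('r, 'm) module)"
  shows "\<exists>N :: 'r umod. fg_mod R N \<and> mod_iso R M N"
proof -
  interpret right_module R M using M by (simp add: fg_mod_def)
  obtain S where S: "finite S" "S \<subseteq> carrier M"
    "\<And>x. x \<in> carrier M \<Longrightarrow> \<exists>c\<in>S \<rightarrow> carrier R. x = (\<Oplus>\<^bsub>M\<^esub>s\<in>S. c s \<odot>\<^bsub>M\<^esub> s)"
    using M unfolding fg_mod_def fin_gen_def by blast
  obtain c where c: "\<And>x. x \<in> carrier M \<Longrightarrow> c x \<in> S \<rightarrow> carrier R"
    "\<And>x. x \<in> carrier M \<Longrightarrow> x = (\<Oplus>\<^bsub>M\<^esub>s\<in>S. c x s \<odot>\<^bsub>M\<^esub> s)"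
    using S(3) by metis
  obtain xs where xs: "set xs = S" using S(1) finite_list by blast
  have "inj_on (\<lambda>x. map (c x) xs) (carrier M)"
  proof (rule inj_onI)
    fix x y assume xy: "x \<in> carrier M" "y \<in> carrier M" "map (c x) xs = map (c y) xs"
    have "(\<Oplus>\<^bsub>M\<^esub>s\<in>S. c x s \<odot>\<^bsub>M\<^esub> s) = (\<Oplus>\<^bsub>M\<^esub>s\<in>S. c y s \<odot>\<^bsub>M\<^esub> s)"
      using xy xs S(2) c(1)[OF xy(2)] by (intro M.finsum_cong') (auto intro!: smult_closed)
    then show "x = y" using c(2) xy(1,2) by metis
  qed
  then show ?thesis by (rule fg_mod_transport[OF M])
qed

definition mod_sum :: "('r, 'm) module \<Rightarrow> ('r, 'n) module \<Rightarrow> ('r, 'm \<times> 'n) module" where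
  "mod_sum M N = \<lparr>
     carrier = carrier M \<times> carrier N,
     mult = undefined, one = undefined,
     zero = (\<zero>\<^bsub>M\<^esub>, \<zero>\<^bsub>N\<^esub>),
     add = (\<lambda>(x, y) (x', y'). (x \<oplus>\<^bsub>M\<^esub> x', y \<oplus>\<^bsub>N\<^esub> y')),
     smult = (\<lambda>a (x, y). (a \<odot>\<^bsub>M\<^esub> x, a \<odot>\<^bsub>N\<^esub> y)) \<rparr>"

definition finite_mod_sum :: "nat \<Rightarrow> (nat \<Rightarrow> ('r, 'm) module) \<Rightarrow> ('r, nat \<Rightarrow> 'm) module" where
  "finite_mod_sum n N = \<lparr>
     carrier = (\<Pi>\<^sub>E i\<in>{..<n}. carrier (N i)),
     mult = undefined, one = undefined,
     zero = (\<lambda>i\<in>{..<n}. \<zero>\<^bsub>N i\<^esub>),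
     add = (\<lambda>u v. \<lambda>i\<in>{..<n}. u i \<oplus>\<^bsub>N i\<^esub> v i),
     smult = (\<lambda>a u. \<lambda>i\<in>{..<n}. a \<odot>\<^bsub>N i\<^esub> u i) \<rparr>"

definition quot_mod :: "('r, 'm) module \<Rightarrow> 'm set \<Rightarrow> ('r, 'm set) module" where
  "quot_mod M H = \<lparr>
     carrier = a_rcosets\<^bsub>M\<^esub> H,
     mult = undefined, one = undefined,
     zero = H,
     add = (\<lambda>C D. C <+>\<^bsub>M\<^esub> D),
     smult = (\<lambda>a C. \<Union>x\<in>C. H +>\<^bsub>M\<^esub> (a \<odot>\<^bsub>M\<^esub> x)) \<rparr>"

definition coker_mod :: "('r, 'm) module \<Rightarrow> ('m \<Rightarrow> 'n) \<Rightarrow> ('r, 'n) module \<Rightarrow> ('r, 'n set) module" where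
  "coker_mod M f N = quot_mod N (f ` carrier M)"

definition regular_mod :: "'r ring \<Rightarrow> ('r, 'r) module" where
  "regular_mod R = \<lparr>
     carrier = carrier R,
     mult = undefined, one = undefined,
     zero = \<zero>\<^bsub>R\<^esub>,
     add = (\<lambda>x y. x \<oplus>\<^bsub>R\<^esub> y),
     smult = (\<lambda>a x. x \<otimes>\<^bsub>R\<^esub> a) \<rparr>"


section \<open>Hereditary artin algebras\<close>

definition artinian_cring :: "'k ring \<Rightarrow> bool" where
  "artinian_cring K \<longleftrightarrow> cring K \<and> wf {(I, J). ideal I K \<and> ideal J K \<and> I \<subset> J}"

definition artin_algebra :: "'k ring \<Rightarrow> ('k \<Rightarrow> 'r) \<Rightarrow> 'r ring \<Rightarrow> bool" where
  "artin_algebra K \<phi> R \<longleftrightarrow>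
     artinian_cring K \<and> ring R \<and> \<phi> \<in> ring_hom K R \<and>
     (\<forall>c\<in>carrier K. \<forall>x\<in>carrier R. \<phi> c \<otimes>\<^bsub>R\<^esub> x = x \<otimes>\<^bsub>R\<^esub> \<phi> c) \<and>
     (\<exists>S. finite S \<and> S \<subseteq> carrier R \<and>
       (\<forall>x\<in>carrier R. \<exists>c\<in>S \<rightarrow> carrier K. x = (\<Oplus>\<^bsub>R\<^esub>s\<in>S. \<phi> (c s) \<otimes>\<^bsub>R\<^esub> s)))"

definition projective_mod :: "'r ring \<Rightarrow> ('r, 'm) module \<Rightarrow> bool" where
  "projective_mod R Q \<longleftrightarrow> right_module R Q \<and>
     (\<forall>(A :: 'r umod) (B :: 'r umod) g h.
        fg_mod R A \<and> fg_mod R B \<and> g \<in> rhom R A B \<and> g ` carrier A = carrier B \<and> h \<in> rhom R Q B \<longrightarrow>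
        (\<exists>l\<in>rhom R Q A. \<forall>x\<in>carrier Q. g (l x) = h x))"

text \<open>
  All right ideals are projective.  Artin algebras are noetherian on both sides, so right
  ideals are finitely generated (and lifting against finitely generated modules is enough),
  and right hereditary is the same as left hereditary.
\<close>

definition hereditary :: "'r ring \<Rightarrow> bool" where
  "hereditary R \<longleftrightarrow> (\<forall>J. submodule J R (regular_mod R) \<longrightarrow>
     projective_mod R ((regular_mod R)\<lparr>carrier := J\<rparr>))"


section \<open>The first extension group\<close>

text \<open>
  \<open>Ext\<^sup>1(M, N)\<close> is computed from the canonical presentation
  \<open>0 \<rightarrow> K \<rightarrow> F \<rightarrow> M \<rightarrow> 0\<close>, where \<open>F\<close> is free on the set of elements of \<open>M\<close>:
  it is the cokernel of the restriction map \<open>Hom(F, N) \<rightarrow> Hom(K, N)\<close>.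
\<close>

definition free_mod :: "'r ring \<Rightarrow> 's set \<Rightarrow> ('r, 's \<Rightarrow> 'r) module" where
  "free_mod R S = \<lparr>
     carrier = {u. (\<forall>s\<in>S. u s \<in> carrier R) \<and> (\<forall>s. s \<notin> S \<longrightarrow> u s = \<zero>\<^bsub>R\<^esub>) \<and> finite {s. u s \<noteq> \<zero>\<^bsub>R\<^esub>}},
     mult = undefined, one = undefined,
     zero = (\<lambda>_. \<zero>\<^bsub>R\<^esub>),
     add = (\<lambda>u v s. u s \<oplus>\<^bsub>R\<^esub> v s),
     smult = (\<lambda>a u s. u s \<otimes>\<^bsub>R\<^esub> a) \<rparr>"

definition free_cover :: "'r ring \<Rightarrow> ('r, 'm) module \<Rightarrow> ('m \<Rightarrow> 'r) \<Rightarrow> 'm" where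
  "free_cover R M u = (\<Oplus>\<^bsub>M\<^esub>x\<in>{x. u x \<noteq> \<zero>\<^bsub>R\<^esub>}. u x \<odot>\<^bsub>M\<^esub> x)"

definition syzygy :: "'r ring \<Rightarrow> ('r, 'm) module \<Rightarrow> ('r, 'm \<Rightarrow> 'r) module" where
  "syzygy R M = (free_mod R (carrier M))
     \<lparr>carrier := a_kernel (free_mod R (carrier M)) M (free_cover R M)\<rparr>"

definition Hom_group :: "'r ring \<Rightarrow> ('r, 'm) module \<Rightarrow> ('r, 'n) module \<Rightarrow> ('m \<Rightarrow> 'n) monoid" where
  "Hom_group R M N = \<lparr>
     carrier = rhom R M N \<inter> extensional (carrier M),
     mult = (\<lambda>g h. \<lambda>x\<in>carrier M. g x \<oplus>\<^bsub>N\<^esub> h x),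
     one = (\<lambda>x\<in>carrier M. \<zero>\<^bsub>N\<^esub>) \<rparr>"

definition Ext1 :: "'r ring \<Rightarrow> ('r, 'm) module \<Rightarrow> ('r, 'n) module \<Rightarrow> (('m \<Rightarrow> 'r) \<Rightarrow> 'n) set monoid" where
  "Ext1 R M N = Hom_group R (syzygy R M) N Mod
     (\<lambda>h. restrict h (carrier (syzygy R M))) ` carrier (Hom_group R (free_mod R (carrier M)) N)"

definition rigid :: "'r ring \<Rightarrow> ('r, 'm) module \<Rightarrow> bool" where
  "rigid R M \<longleftrightarrow> fg_mod R M \<and> trivial_group (Ext1 R M M)"


section \<open>Summands and approximations\<close>

definition zero_mod :: "('r, 'm) module \<Rightarrow> bool" where
  "zero_mod M \<longleftrightarrow> carrier M = {\<zero>\<^bsub>M\<^esub>}"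

definition indecomposable :: "'r ring \<Rightarrow> ('r, 'm) module \<Rightarrow> bool" where
  "indecomposable R M \<longleftrightarrow> fg_mod R M \<and> \<not> zero_mod M \<and>
     (\<forall>(A :: 'r umod) (B :: 'r umod).
        fg_mod R A \<and> fg_mod R B \<and> mod_iso R M (mod_sum A B) \<longrightarrow> zero_mod A \<or> zero_mod B)"

definition basic_mod :: "'r ring \<Rightarrow> ('r, 'm) module \<Rightarrow> bool" where
  "basic_mod R M \<longleftrightarrow> fg_mod R M \<and>
     (\<exists>n (N :: nat \<Rightarrow> 'r umod).
        (\<forall>i<n. indecomposable R (N i)) \<and>
        (\<forall>i<n. \<forall>j<n. i \<noteq> j \<longrightarrow> \<not> mod_iso R (N i) (N j)) \<and>
        mod_iso R M (finite_mod_sum n N))"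

definition in_add :: "'r ring \<Rightarrow> ('r, 'm) module \<Rightarrow> ('r, 'n) module \<Rightarrow> bool" where
  "in_add R M N \<longleftrightarrow> fg_mod R N \<and>
     (\<exists>n (N' :: 'r umod). fg_mod R N' \<and> mod_iso R (mod_sum N N') (finite_mod_sum n (\<lambda>_. M)))"

definition left_add_approx ::
  "'r ring \<Rightarrow> ('r, 'm) module \<Rightarrow> ('r, 'x) module \<Rightarrow> ('x \<Rightarrow> 'n) \<Rightarrow> ('r, 'n) module \<Rightarrow> bool"
where
  "left_add_approx R M X f M' \<longleftrightarrow> in_add R M M' \<and> f \<in> rhom R X M' \<and>
     (\<forall>(N :: 'r umod) g. in_add R M N \<and> g \<in> rhom R X N \<longrightarrow>
        (\<exists>h\<in>rhom R M' N. \<forall>x\<in>carrier X. h (f x) = g x))"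

definition minimal_left_add_approx ::
  "'r ring \<Rightarrow> ('r, 'm) module \<Rightarrow> ('r, 'x) module \<Rightarrow> ('x \<Rightarrow> 'n) \<Rightarrow> ('r, 'n) module \<Rightarrow> bool"
where
  "minimal_left_add_approx R M X f M' \<longleftrightarrow> left_add_approx R M X f M' \<and>
     (\<forall>h\<in>rhom R M' M'. (\<forall>x\<in>carrier X. h (f x) = f x) \<longrightarrow> bij_betw h (carrier M') (carrier M'))"


section \<open>Twin rigid modules and the quiver\<close>

definition twin_rigid :: "'r ring \<Rightarrow> ('r, 'p) module \<Rightarrow> ('r, 'i) module \<Rightarrow> bool" where
  "twin_rigid R P I \<longleftrightarrow> rigid R P \<and> rigid R I \<and>
     (\<exists>(I\<^sub>0 :: 'r umod) (I\<^sub>1 :: 'r umod) f g.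
        in_add R I I\<^sub>0 \<and> in_add R I I\<^sub>1 \<and> short_exact R P f I\<^sub>0 g I\<^sub>1) \<and>
     (\<exists>(P\<^sub>0 :: 'r umod) (P\<^sub>1 :: 'r umod) f g.
        in_add R P P\<^sub>0 \<and> in_add R P P\<^sub>1 \<and> short_exact R P\<^sub>1 f P\<^sub>0 g I)"

definition basic_twin_rigid :: "'r ring \<Rightarrow> ('r, 'p) module \<Rightarrow> ('r, 'i) module \<Rightarrow> bool" where
  "basic_twin_rigid R P I \<longleftrightarrow> twin_rigid R P I \<and> basic_mod R P \<and> basic_mod R I"

text \<open>The isomorphism class of the pair \<open>(P, I)\<close>, cut down to carriers in \<open>'r list\<close>.\<close>

definition pair_class ::
  "'r ring \<Rightarrow> ('r, 'p) module \<Rightarrow> ('r, 'i) module \<Rightarrow> ('r umod \<times> 'r umod) set"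
where
  "pair_class R P I = {(P', I'). fg_mod R P' \<and> fg_mod R I' \<and> mod_iso R P P' \<and> mod_iso R I I'}"

definition twin_quiver ::
  "'r ring \<Rightarrow> ('r, 'p) module \<Rightarrow> ('r umod \<times> 'r umod) set pair_pre_digraph"
where
  "twin_quiver R P = \<lparr>
     pverts = {pair_class R P I | I :: 'r umod. basic_twin_rigid R P I},
     parcs = {(pair_class R P I\<^sub>1, pair_class R P I\<^sub>2) | (I\<^sub>1 :: 'r umod) (I\<^sub>2 :: 'r umod).
       basic_twin_rigid R P I\<^sub>1 \<and> basic_twin_rigid R P I\<^sub>2 \<and>
       (\<exists>(X :: 'r umod) (Y :: 'r umod) (M :: 'r umod) (M' :: 'r umod) f g.
          fg_mod R M \<and> indecomposable R X \<and> indecomposable R Y \<and>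
          mod_iso R I\<^sub>1 (mod_sum X M) \<and> mod_iso R I\<^sub>2 (mod_sum Y M) \<and>
          in_add R M M' \<and> short_exact R X f M' g Y)} \<rparr>"

end

theory Submission
  imports Defs
begin

text \<open>
  Put \<open>Y = Coker f\<close>, \<open>I = X \<oplus> M\<close> and \<open>T = Y \<oplus> M\<close>, so that \<open>0 \<rightarrow> X \<rightarrow> M' \<rightarrow> Y \<rightarrow> 0\<close> is exact with
  \<open>M' \<in> add M\<close>.

  \<^emph>\<open>Rigidity.\<close>  Over a hereditary algebra \<open>Ext\<^sup>1\<close> is right exact in both arguments.  As \<open>Y\<close> is a
  quotient of \<open>M'\<close>, this gives \<open>Ext\<^sup>1(M, Y) = 0\<close>; the approximation property gives
  \<open>Ext\<^sup>1(Y, M) = 0\<close>, and right exactness then \<open>Ext\<^sup>1(Y, Y) = 0\<close>.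

  \<^emph>\<open>The two sequences.\<close>  The coresolution of \<open>P\<close> by \<open>add I\<close> is turned into one by \<open>add T\<close> along
  \<open>0 \<rightarrow> I \<rightarrow> M' \<oplus> M \<rightarrow> Y \<rightarrow> 0\<close> (lemma \<open>coresolution_exchange\<close>), and the resolution of \<open>I\<close> by \<open>add P\<close>
  yields one of \<open>T\<close> along \<open>0 \<rightarrow> X \<rightarrow> M' \<oplus> M \<rightarrow> T \<rightarrow> 0\<close> (lemma \<open>resolution_exchange\<close>).  In both, the
  point is that a module constructed on the way belongs to an additive closure.  Instead of
  counting summands, the identity map of that module is written as a sum of two maps that
  factor through the closure; the factorizations come from vanishing extension groups alone.

  \<^emph>\<open>The arrow.\<close>  \<open>X\<close> is not in \<open>add M\<close>, because \<open>X \<oplus> M\<close> is basic.  Suppose \<open>e\<close> is an idempotent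
  of \<open>Y\<close>.  It lifts to \<open>M'\<close> since \<open>Ext\<^sup>1(M', X) = 0\<close>, and so induces an endomorphism \<open>d\<close> of \<open>X\<close>.  Since
  \<open>d(1 - d)\<close> factors through \<open>M'\<close>, it is not invertible, so \<open>d\<close> or \<open>1 - d\<close> is nilpotent by Fitting's
  lemma; minimality of \<open>f\<close> then forces \<open>e = 0\<close> or \<open>e = 1\<close>.  Hence \<open>Y\<close> is indecomposable.  It is not
  in \<open>add M\<close>, since otherwise \<open>Ext\<^sup>1(Y, X) = 0\<close>, the sequence would split and \<open>X\<close> would be in \<open>add M\<close>.
  So \<open>Y\<close> may replace \<open>X\<close> in the decomposition of \<open>X \<oplus> M\<close> into pairwise nonisomorphic
  indecomposables, and \<open>T\<close> is basic.

  \<^emph>\<open>Foundations.\<close>  Finitely generated modules over an artin algebra satisfy both chain conditions,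
  which gives Fitting's lemma and makes submodules of finitely generated modules finitely
  generated.  The latter is what lets the lifting property of right ideals be passed on to
  submodules of free modules of finite rank, and this is the form in which heredity enters the
  right exactness of \<open>Ext\<^sup>1\<close>.
\<close>

section \<open>Module homomorphisms, submodules and exact sequences\<close>

lemma (in abelian_group) diff_eq_iff:
  assumes "x \<in> carrier G" "y \<in> carrier G" "z \<in> carrier G"
  shows "x \<ominus> y = z \<longleftrightarrow> x = z \<oplus> y"
  using assms by (metis add.inv_solve_right minus_eq)

lemma (in abelian_group) add_diff_cancel:
  assumes "x \<in> carrier G" "y \<in> carrier G"
  shows "x \<oplus> (y \<ominus> x) = y" "x \<ominus> y \<oplus> y = x" "x \<oplus> y \<ominus> y = x" "x \<oplus> y \<ominus> x = y"
proof -
  show 2: "x \<ominus> y \<oplus> y = x" using diff_eq_iff[of x y "x \<ominus> y"] assms by simp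
  have "y \<ominus> x \<oplus> x = y" using diff_eq_iff[of y x "y \<ominus> x"] assms by simp
  then show "x \<oplus> (y \<ominus> x) = y" using assms a_comm[of x "y \<ominus> x"] by simp
  show "x \<oplus> y \<ominus> y = x" using diff_eq_iff[of "x \<oplus> y" y x] assms by simp
  show "x \<oplus> y \<ominus> x = y" using diff_eq_iff[of "x \<oplus> y" x y] assms a_comm[of x y] by simp
qed

lemma (in abelian_group) minus_zero_right [simp]:
  "x \<in> carrier G \<Longrightarrow> x \<ominus> \<zero> = x"
  by (simp add: diff_eq_iff)

lemma right_moduleD:
  assumes "right_module R M"
  shows "abelian_group M" "ring R"
  using assms by (auto simp: right_module_def)

context right_module
begin

lemma smult_zero_right [simp]:
  assumes "a \<in> carrier R" shows "a \<odot>\<^bsub>M\<^esub> \<zero>\<^bsub>M\<^esub> = \<zero>\<^bsub>M\<^esub>"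
proof -
  have "a \<odot>\<^bsub>M\<^esub> \<zero>\<^bsub>M\<^esub> \<oplus>\<^bsub>M\<^esub> a \<odot>\<^bsub>M\<^esub> \<zero>\<^bsub>M\<^esub> = a \<odot>\<^bsub>M\<^esub> \<zero>\<^bsub>M\<^esub> \<oplus>\<^bsub>M\<^esub> \<zero>\<^bsub>M\<^esub>"
    using assms by (simp flip: smult_r_distr add: smult_closed)
  then show ?thesis using assms by (simp add: smult_closed)
qed

lemma smult_zero_left [simp]:
  assumes "x \<in> carrier M" shows "\<zero> \<odot>\<^bsub>M\<^esub> x = \<zero>\<^bsub>M\<^esub>"
proof -
  have "\<zero> \<odot>\<^bsub>M\<^esub> x \<oplus>\<^bsub>M\<^esub> \<zero> \<odot>\<^bsub>M\<^esub> x = \<zero> \<odot>\<^bsub>M\<^esub> x \<oplus>\<^bsub>M\<^esub> \<zero>\<^bsub>M\<^esub>"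
    using assms by (simp flip: smult_l_distr add: smult_closed)
  then show ?thesis using assms by (simp add: smult_closed)
qed

lemma smult_neg_right:
  assumes "a \<in> carrier R" "x \<in> carrier M"
  shows "a \<odot>\<^bsub>M\<^esub> (\<ominus>\<^bsub>M\<^esub> x) = \<ominus>\<^bsub>M\<^esub> (a \<odot>\<^bsub>M\<^esub> x)"
proof -
  have "a \<odot>\<^bsub>M\<^esub> (\<ominus>\<^bsub>M\<^esub> x) \<oplus>\<^bsub>M\<^esub> a \<odot>\<^bsub>M\<^esub> x = \<zero>\<^bsub>M\<^esub>"
    using assms by (simp flip: smult_r_distr add: M.l_neg)
  then show ?thesis using assms by (simp add: M.minus_equality smult_closed)
qed

lemma smult_neg_left:
  assumes "a \<in> carrier R" "x \<in> carrier M"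
  shows "(\<ominus> a) \<odot>\<^bsub>M\<^esub> x = \<ominus>\<^bsub>M\<^esub> (a \<odot>\<^bsub>M\<^esub> x)"
proof -
  have "(\<ominus> a) \<odot>\<^bsub>M\<^esub> x \<oplus>\<^bsub>M\<^esub> a \<odot>\<^bsub>M\<^esub> x = \<zero>\<^bsub>M\<^esub>"
    using assms by (simp flip: smult_l_distr add: R.l_neg)
  then show ?thesis using assms by (simp add: M.minus_equality smult_closed)
qed

lemma submodI:
  assumes "H \<subseteq> carrier M" "\<zero>\<^bsub>M\<^esub> \<in> H"
    and "\<And>x y. x \<in> H \<Longrightarrow> y \<in> H \<Longrightarrow> x \<oplus>\<^bsub>M\<^esub> y \<in> H"
    and "\<And>a x. a \<in> carrier R \<Longrightarrow> x \<in> H \<Longrightarrow> a \<odot>\<^bsub>M\<^esub> x \<in> H"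
  shows "submodule H R M"
proof -
  have "\<ominus>\<^bsub>M\<^esub> x \<in> H" if "x \<in> H" for x
    using that assms(1) assms(4)[of "\<ominus> \<one>" x] by (auto simp: smult_neg_left smult_one)
  then have "subgroup H (add_monoid M)"
    using assms(1-3) by (intro M.add.subgroupI) (auto simp: a_inv_def)
  then show ?thesis
    using assms(4) by (intro submodule.intro submodule_axioms.intro) auto
qed

lemma submodD:
  assumes "submodule H R M"
  shows "H \<subseteq> carrier M" "\<zero>\<^bsub>M\<^esub> \<in> H"
    and "\<And>x y. x \<in> H \<Longrightarrow> y \<in> H \<Longrightarrow> x \<oplus>\<^bsub>M\<^esub> y \<in> H"
    and "\<And>a x. a \<in> carrier R \<Longrightarrow> x \<in> H \<Longrightarrow> a \<odot>\<^bsub>M\<^esub> x \<in> H"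
    and "\<And>x. x \<in> H \<Longrightarrow> \<ominus>\<^bsub>M\<^esub> x \<in> H"
    and "\<And>x y. x \<in> H \<Longrightarrow> y \<in> H \<Longrightarrow> x \<ominus>\<^bsub>M\<^esub> y \<in> H"
proof -
  have sg: "subgroup H (add_monoid M)" using assms by (rule submodule.axioms)
  show "H \<subseteq> carrier M" "\<zero>\<^bsub>M\<^esub> \<in> H" using subgroup.subset[OF sg] subgroup.one_closed[OF sg] by auto
  show *: "x \<oplus>\<^bsub>M\<^esub> y \<in> H" if "x \<in> H" "y \<in> H" for x y using subgroup.m_closed[OF sg that] by simp
  show "a \<odot>\<^bsub>M\<^esub> x \<in> H" if "a \<in> carrier R" "x \<in> H" for a x
    using submodule.smult_closed[OF assms that] .
  show **: "\<ominus>\<^bsub>M\<^esub> x \<in> H" if "x \<in> H" for x using subgroup.m_inv_closed[OF sg that] by (simp add: a_inv_def)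
  show "x \<ominus>\<^bsub>M\<^esub> y \<in> H" if "x \<in> H" "y \<in> H" for x y
    using *[OF that(1) **[OF that(2)]] by (simp add: M.minus_eq)
qed

lemma submodule_carrier: "submodule (carrier M) R M"
  by (rule submodI) (auto intro: smult_closed)

lemma submodule_zero: "submodule {\<zero>\<^bsub>M\<^esub>} R M"
  by (rule submodI) auto

end

lemma right_module_sub:
  assumes M: "right_module R M" and H: "submodule H R M"
  shows "right_module R (M\<lparr>carrier := H\<rparr>)"
proof -
  interpret right_module R M by fact
  note D = submodD[OF H]
  have ab: "abelian_group (M\<lparr>carrier := H\<rparr>)"
  proof (rule abelian_groupI)
    fix x assume "x \<in> carrier (M\<lparr>carrier := H\<rparr>)"
    then show "\<exists>y\<in>carrier (M\<lparr>carrier := H\<rparr>). y \<oplus>\<^bsub>M\<lparr>carrier := H\<rparr>\<^esub> x = \<zero>\<^bsub>M\<lparr>carrier := H\<rparr>\<^esub>"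
      using D by (intro bexI[of _ "\<ominus>\<^bsub>M\<^esub> x"]) (auto simp: M.l_neg subset_iff)
  qed (use D in \<open>auto simp: M.a_ac subset_iff\<close>)
  show ?thesis
    by (intro right_module.intro R.ring_axioms ab right_module_axioms.intro)
      (use D in \<open>auto simp: smult_closed smult_l_distr smult_r_distr smult_assoc smult_one subset_iff\<close>)
qed

lemma rhomI:
  assumes "\<And>x. x \<in> carrier M \<Longrightarrow> h x \<in> carrier N"
    and "\<And>x y. x \<in> carrier M \<Longrightarrow> y \<in> carrier M \<Longrightarrow> h (x \<oplus>\<^bsub>M\<^esub> y) = h x \<oplus>\<^bsub>N\<^esub> h y"
    and "\<And>a x. a \<in> carrier R \<Longrightarrow> x \<in> carrier M \<Longrightarrow> h (a \<odot>\<^bsub>M\<^esub> x) = a \<odot>\<^bsub>N\<^esub> h x"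
  shows "h \<in> rhom R M N"
  using assms by (auto simp: rhom_def)

lemma rhom_closed: "h \<in> rhom R M N \<Longrightarrow> x \<in> carrier M \<Longrightarrow> h x \<in> carrier N"
  and rhom_add: "h \<in> rhom R M N \<Longrightarrow> x \<in> carrier M \<Longrightarrow> y \<in> carrier M \<Longrightarrow> h (x \<oplus>\<^bsub>M\<^esub> y) = h x \<oplus>\<^bsub>N\<^esub> h y"
  and rhom_smult: "h \<in> rhom R M N \<Longrightarrow> a \<in> carrier R \<Longrightarrow> x \<in> carrier M \<Longrightarrow> h (a \<odot>\<^bsub>M\<^esub> x) = a \<odot>\<^bsub>N\<^esub> h x"
  by (auto simp: rhom_def)

lemma rhom_zero:
  assumes "h \<in> rhom R M N" and M: "right_module R M" and N: "right_module R N"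
  shows "h \<zero>\<^bsub>M\<^esub> = \<zero>\<^bsub>N\<^esub>"
proof -
  interpret M: right_module R M by fact
  interpret N: right_module R N by fact
  have "h (\<zero>\<^bsub>R\<^esub> \<odot>\<^bsub>M\<^esub> \<zero>\<^bsub>M\<^esub>) = \<zero>\<^bsub>R\<^esub> \<odot>\<^bsub>N\<^esub> h \<zero>\<^bsub>M\<^esub>" using assms(1) by (intro rhom_smult) auto
  then show ?thesis using rhom_closed[OF assms(1), of "\<zero>\<^bsub>M\<^esub>"] by simp
qed

lemma rhom_neg:
  assumes "h \<in> rhom R M N" and M: "right_module R M" and N: "right_module R N" and "x \<in> carrier M"
  shows "h (\<ominus>\<^bsub>M\<^esub> x) = \<ominus>\<^bsub>N\<^esub> h x"
proof -
  interpret M: right_module R M by fact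
  interpret N: right_module R N by fact
  have "h (\<ominus>\<^bsub>M\<^esub> x) \<oplus>\<^bsub>N\<^esub> h x = \<zero>\<^bsub>N\<^esub>"
    using assms(4) rhom_zero[OF assms(1-3)] by (simp flip: rhom_add[OF assms(1)] add: M.l_neg)
  then show ?thesis using assms(4) rhom_closed[OF assms(1)] by (simp add: N.minus_equality)
qed

lemma rhom_diff:
  assumes "h \<in> rhom R M N" and M: "right_module R M" and N: "right_module R N"
    and "x \<in> carrier M" "y \<in> carrier M"
  shows "h (x \<ominus>\<^bsub>M\<^esub> y) = h x \<ominus>\<^bsub>N\<^esub> h y"
proof -
  interpret M: right_module R M by fact
  interpret N: right_module R N by fact
  show ?thesis using assms by (simp add: M.minus_eq N.minus_eq rhom_add[OF assms(1)] rhom_neg[OF assms(1-3)])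
qed

lemmas rhom_simps = rhom_closed rhom_add rhom_smult rhom_zero rhom_neg rhom_diff

lemma rhom_id [simp]: "(\<lambda>x. x) \<in> rhom R M M"
  by (auto simp: rhom_def)

lemma rhom_comp:
  assumes "g \<in> rhom R L M" "h \<in> rhom R M N"
  shows "(\<lambda>x. h (g x)) \<in> rhom R L N"
  using assms by (auto simp: rhom_def Pi_iff)

lemma rhom_zero_map: 
  assumes "right_module R N" shows "(\<lambda>x. \<zero>\<^bsub>N\<^esub>) \<in> rhom R M N"
proof -
  interpret right_module R N by fact
  show ?thesis by (auto simp: rhom_def)
qed

lemma rhom_plus:
  assumes N: "right_module R N" and g: "g \<in> rhom R M N" and h: "h \<in> rhom R M N"
  shows "(\<lambda>x. g x \<oplus>\<^bsub>N\<^esub> h x) \<in> rhom R M N"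
proof -
  interpret N: right_module R N by fact
  show ?thesis
    by (rule rhomI) (auto simp: rhom_simps(1-3)[OF g] rhom_simps(1-3)[OF h] N.smult_r_distr N.a_ac)
qed

lemma rhom_uminus:
  assumes N: "right_module R N" and g: "g \<in> rhom R M N"
  shows "(\<lambda>x. \<ominus>\<^bsub>N\<^esub> g x) \<in> rhom R M N"
proof -
  interpret N: right_module R N by fact
  show ?thesis
    by (rule rhomI) (auto simp: rhom_simps(1-3)[OF g] N.smult_neg_right N.minus_add)
qed

lemma rhom_minus:
  assumes N: "right_module R N" and g: "g \<in> rhom R M N" and h: "h \<in> rhom R M N"
  shows "(\<lambda>x. g x \<ominus>\<^bsub>N\<^esub> h x) \<in> rhom R M N"
  using rhom_plus[OF N g rhom_uminus[OF N h]] by (simp add: a_minus_def)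

lemma rhom_from_sub:
  "H \<subseteq> carrier M \<Longrightarrow> h \<in> rhom R M N \<Longrightarrow> h \<in> rhom R (M\<lparr>carrier := H\<rparr>) N"
  by (auto simp: rhom_def Pi_iff subset_iff)

lemma rhom_into_sub:
  "h \<in> rhom R L M \<Longrightarrow> (\<And>x. x \<in> carrier L \<Longrightarrow> h x \<in> H) \<Longrightarrow> h \<in> rhom R L (M\<lparr>carrier := H\<rparr>)"
  by (auto simp: rhom_def Pi_iff)

lemma rhom_cong:
  assumes "h \<in> rhom R M N" "right_module R M" "\<And>x. x \<in> carrier M \<Longrightarrow> g x = h x"
  shows "g \<in> rhom R M N"
proof -
  interpret right_module R M by fact
  show ?thesis using assms(1,3) by (auto simp: rhom_def Pi_iff smult_closed)
qed

lemma submodule_vimage: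
  assumes M: "right_module R M" and N: "right_module R N" and h: "h \<in> rhom R M N" and H: "submodule H R N"
  shows "submodule {x \<in> carrier M. h x \<in> H} R M"
proof -
  interpret M: right_module R M by fact
  interpret N: right_module R N by fact
  show ?thesis
    by (rule M.submodI) (use N.submodD[OF H] in \<open>auto simp: rhom_simps[OF h] rhom_zero[OF h M N] M.smult_closed\<close>)
qed

lemma submodule_kernel:
  assumes M: "right_module R M" and N: "right_module R N" and h: "h \<in> rhom R M N"
  shows "submodule {x \<in> carrier M. h x = \<zero>\<^bsub>N\<^esub>} R M"
  using submodule_vimage[OF assms right_module.submodule_zero[OF N]] by simp

lemma submodule_image:
  assumes M: "right_module R M" and N: "right_module R N" and h: "h \<in> rhom R M N" and H: "submodule H R M"
  shows "submodule (h ` H) R N"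
proof -
  interpret M: right_module R M by fact
  interpret N: right_module R N by fact
  note D = M.submodD[OF H]
  have H': "x \<in> carrier M" if "x \<in> H" for x using D(1) that by auto
  show ?thesis
  proof (rule N.submodI)
    show "h ` H \<subseteq> carrier N" using H' by (auto simp: rhom_closed[OF h])
    show "\<zero>\<^bsub>N\<^esub> \<in> h ` H" using D(2) rhom_zero[OF h M N] by (metis image_eqI)
    show "x \<oplus>\<^bsub>N\<^esub> y \<in> h ` H" if "x \<in> h ` H" "y \<in> h ` H" for x y
      using that D(3) H' by (auto simp flip: rhom_add[OF h])
    show "a \<odot>\<^bsub>N\<^esub> x \<in> h ` H" if "a \<in> carrier R" "x \<in> h ` H" for a x
      using that D(4) H' by (auto simp flip: rhom_smult[OF h])
  qed
qed

text \<open>A surjective homomorphism is the cokernel of its kernel, an injective one the kernel of its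
  cokernel.\<close>

lemma factor_through_surj:
  assumes B: "right_module R B" and C: "right_module R C" and N: "right_module R N"
    and p: "p \<in> rhom R B C" "p ` carrier B = carrier C" and h: "h \<in> rhom R B N"
    and ker: "\<And>b. b \<in> carrier B \<Longrightarrow> p b = \<zero>\<^bsub>C\<^esub> \<Longrightarrow> h b = \<zero>\<^bsub>N\<^esub>"
  shows "\<exists>g\<in>rhom R C N. \<forall>b\<in>carrier B. g (p b) = h b"
proof -
  interpret B: right_module R B by fact
  interpret C: right_module R C by fact
  interpret N: right_module R N by fact
  note [simp] = rhom_closed[OF p(1)] rhom_closed[OF h]
  define s where "s = inv_into (carrier B) p"
  have s: "s c \<in> carrier B" "p (s c) = c" if "c \<in> carrier C" for c
    using that p(2) by (auto simp: s_def inv_into_into f_inv_into_f)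
  have eq: "h b = h b'" if "b \<in> carrier B" "b' \<in> carrier B" "p b = p b'" for b b'
  proof -
    have "h (b \<ominus>\<^bsub>B\<^esub> b') = \<zero>\<^bsub>N\<^esub>"
      using that by (intro ker) (auto simp: rhom_diff[OF p(1) B C] C.r_neg C.minus_eq)
    then show ?thesis using that by (simp add: rhom_diff[OF h B N] N.diff_eq_iff)
  qed
  have sp: "h (s (p b)) = h b" if "b \<in> carrier B" for b
    using that s[of "p b"] by (intro eq) auto
  have "(\<lambda>c. h (s c)) \<in> rhom R C N"
  proof (rule rhomI)
    fix x y assume xy: "x \<in> carrier C" "y \<in> carrier C"
    have "h (s (x \<oplus>\<^bsub>C\<^esub> y)) = h (s x \<oplus>\<^bsub>B\<^esub> s y)"
      using xy by (intro eq) (auto simp: s rhom_add[OF p(1)])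
    then show "h (s (x \<oplus>\<^bsub>C\<^esub> y)) = h (s x) \<oplus>\<^bsub>N\<^esub> h (s y)" using xy by (simp add: s rhom_add[OF h])
  next
    fix a x assume ax: "a \<in> carrier R" "x \<in> carrier C"
    have "h (s (a \<odot>\<^bsub>C\<^esub> x)) = h (a \<odot>\<^bsub>B\<^esub> s x)"
      using ax by (intro eq) (auto simp: s rhom_smult[OF p(1)] B.smult_closed C.smult_closed)
    then show "h (s (a \<odot>\<^bsub>C\<^esub> x)) = a \<odot>\<^bsub>N\<^esub> h (s x)" using ax by (simp add: s rhom_smult[OF h])
  qed (auto simp: s)
  then show ?thesis using sp by (intro bexI[of _ "\<lambda>c. h (s c)"]) auto
qed

lemma factor_through_inj:
  assumes A: "right_module R A" and Q: "right_module R Q"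
    and i: "i \<in> rhom R A B" "inj_on i (carrier A)" and h: "h \<in> rhom R Q B"
    and im: "\<And>q. q \<in> carrier Q \<Longrightarrow> h q \<in> i ` carrier A"
  shows "\<exists>g\<in>rhom R Q A. \<forall>q\<in>carrier Q. i (g q) = h q"
proof -
  interpret A: right_module R A by fact
  interpret Q: right_module R Q by fact
  define g where "g q = inv_into (carrier A) i (h q)" for q
  have g: "g q \<in> carrier A" "i (g q) = h q" if "q \<in> carrier Q" for q
    using im[OF that] by (auto simp: g_def inv_into_into f_inv_into_f)
  have "g \<in> rhom R Q A"
    by (rule rhomI)
      (auto intro!: inj_onD[OF i(2)] simp: g rhom_simps(1-3)[OF i(1)] rhom_simps(1-3)[OF h]
        A.smult_closed Q.smult_closed)
  then show ?thesis using g by blast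
qed

lemma short_exactI:
  assumes "f \<in> rhom R L M" "g \<in> rhom R M N" "inj_on f (carrier L)"
    and "\<And>x. x \<in> carrier L \<Longrightarrow> g (f x) = \<zero>\<^bsub>N\<^esub>"
    and "\<And>y. y \<in> carrier M \<Longrightarrow> g y = \<zero>\<^bsub>N\<^esub> \<Longrightarrow> \<exists>x\<in>carrier L. f x = y"
    and "\<And>z. z \<in> carrier N \<Longrightarrow> \<exists>y\<in>carrier M. g y = z"
  shows "short_exact R L f M g N"
proof -
  have "f ` carrier L = {y \<in> carrier M. g y = \<zero>\<^bsub>N\<^esub>}"
    using assms(4) rhom_closed[OF assms(1)] by (auto dest!: assms(5))
  moreover have "g ` carrier M = carrier N"
    using rhom_closed[OF assms(2)] by (auto dest!: assms(6))
  ultimately show ?thesis using assms(1-3) by (simp add: short_exact_def a_kernel_def')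
qed

lemma short_exactD:
  assumes "short_exact R L f M g N"
  shows "f \<in> rhom R L M" "g \<in> rhom R M N" "inj_on f (carrier L)" "g ` carrier M = carrier N"
    and "\<And>x. x \<in> carrier L \<Longrightarrow> g (f x) = \<zero>\<^bsub>N\<^esub>"
    and "\<And>y. y \<in> carrier M \<Longrightarrow> g y = \<zero>\<^bsub>N\<^esub> \<Longrightarrow> \<exists>x\<in>carrier L. f x = y"
    and "\<And>z. z \<in> carrier N \<Longrightarrow> \<exists>y\<in>carrier M. g y = z"
proof -
  note s = assms[unfolded short_exact_def a_kernel_def']
  show "f \<in> rhom R L M" "g \<in> rhom R M N" "inj_on f (carrier L)" "g ` carrier M = carrier N"
    using s by auto
  have eq: "f ` carrier L = {x \<in> carrier M. g x = \<zero>\<^bsub>N\<^esub>}" using s by blast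
  show "g (f x) = \<zero>\<^bsub>N\<^esub>" if "x \<in> carrier L" for x using eq that by blast
  show "\<exists>x\<in>carrier L. f x = y" if "y \<in> carrier M" "g y = \<zero>\<^bsub>N\<^esub>" for y 
  proof -
    have "y \<in> f ` carrier L" unfolding eq using that by simp
    then show ?thesis by blast
  qed
  show "\<exists>y\<in>carrier M. g y = z" if "z \<in> carrier N" for z
  proof -
    have "z \<in> g ` carrier M" using s that by simp
    then show ?thesis by blast
  qed
qed

lemma rhom_inj_iff:
  assumes M: "right_module R M" and N: "right_module R N" and h: "h \<in> rhom R M N"
  shows "inj_on h (carrier M) \<longleftrightarrow> (\<forall>x\<in>carrier M. h x = \<zero>\<^bsub>N\<^esub> \<longrightarrow> x = \<zero>\<^bsub>M\<^esub>)"
proof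
  interpret M: right_module R M by fact
  interpret N: right_module R N by fact
  show "\<forall>x\<in>carrier M. h x = \<zero>\<^bsub>N\<^esub> \<longrightarrow> x = \<zero>\<^bsub>M\<^esub>" if "inj_on h (carrier M)"
    using that rhom_zero[OF h M N] by (metis M.zero_closed inj_onD)
  assume *: "\<forall>x\<in>carrier M. h x = \<zero>\<^bsub>N\<^esub> \<longrightarrow> x = \<zero>\<^bsub>M\<^esub>"
  show "inj_on h (carrier M)"
  proof (rule inj_onI)
    fix x y assume xy: "x \<in> carrier M" "y \<in> carrier M" "h x = h y"
    then have "h (x \<ominus>\<^bsub>M\<^esub> y) = \<zero>\<^bsub>N\<^esub>"
      by (simp add: rhom_diff[OF h M N] N.minus_eq N.r_neg rhom_closed[OF h])
    then have "x \<ominus>\<^bsub>M\<^esub> y = \<zero>\<^bsub>M\<^esub>" using * xy by simp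
    then show "x = y" using xy by (simp add: M.diff_eq_iff)
  qed
qed

lemma short_exact_kernel:
  assumes B: "right_module R B" and C: "right_module R C"
    and p: "p \<in> rhom R B C" "p ` carrier B = carrier C"
  shows "short_exact R (B\<lparr>carrier := {x \<in> carrier B. p x = \<zero>\<^bsub>C\<^esub>}\<rparr>) (\<lambda>x. x) B p C"
proof (rule short_exactI)
  show "\<exists>y\<in>carrier B. p y = z" if "z \<in> carrier C" for z
    using imageE[of z p "carrier B"] p(2) that by metis
qed (use p(1) in \<open>auto intro: rhom_from_sub\<close>)

lemma rhom_inv_into:
  assumes M: "right_module R M" and h: "h \<in> rhom R M N" and bij: "bij_betw h (carrier M) (carrier N)"
  shows "inv_into (carrier M) h \<in> rhom R N M"
proof -
  interpret M: right_module R M by fact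
  let ?g = "inv_into (carrier M) h"
  have g: "?g x \<in> carrier M" "h (?g x) = x" if "x \<in> carrier N" for x
    using bij that by (auto simp: bij_betw_def inv_into_into f_inv_into_f)
  have e: "?g x = y" if "y \<in> carrier M" "x = h y" for x y
    using bij that by (auto simp: bij_betw_def)
  show ?thesis
    by (rule rhomI) (auto simp: g intro!: e simp: rhom_simps(2-3)[OF h] M.smult_closed)
qed

lemma mod_iso_iff:
  assumes M: "right_module R M"
  shows "mod_iso R M N \<longleftrightarrow> (\<exists>h g. h \<in> rhom R M N \<and> g \<in> rhom R N M \<and>
     (\<forall>x\<in>carrier M. g (h x) = x) \<and> (\<forall>y\<in>carrier N. h (g y) = y))" (is "?l \<longleftrightarrow> ?r")
proof
  assume ?l
  then obtain h where h: "h \<in> rhom R M N" "bij_betw h (carrier M) (carrier N)" by (auto simp: mod_iso_def)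
  then show ?r using rhom_inv_into[OF M h]
    by (intro exI[of _ h] exI[of _ "inv_into (carrier M) h"]) (auto simp: bij_betw_def f_inv_into_f)
next
  assume ?r
  then obtain h g where "h \<in> rhom R M N" "g \<in> rhom R N M"
     "\<forall>x\<in>carrier M. g (h x) = x" "\<forall>y\<in>carrier N. h (g y) = y" by blast
  then show ?l unfolding mod_iso_def
    by (intro bexI[of _ h] bij_betw_byWitness[where f'=g]) (auto simp: rhom_def)
qed

lemma mod_isoE:
  assumes "mod_iso R M N" "right_module R M"
  obtains h g where "h \<in> rhom R M N" "g \<in> rhom R N M"
     "\<And>x. x \<in> carrier M \<Longrightarrow> g (h x) = x" "\<And>y. y \<in> carrier N \<Longrightarrow> h (g y) = y"
proof -
  obtain h g where "h \<in> rhom R M N" "g \<in> rhom R N M"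
    "\<forall>x\<in>carrier M. g (h x) = x" "\<forall>y\<in>carrier N. h (g y) = y"
    using assms(1) unfolding mod_iso_iff[OF assms(2)] by blast
  then show thesis by (intro that[of h g]) auto
qed

lemma mod_isoI:
  assumes "h \<in> rhom R M N" "g \<in> rhom R N M"
    "\<And>x. x \<in> carrier M \<Longrightarrow> g (h x) = x" "\<And>y. y \<in> carrier N \<Longrightarrow> h (g y) = y"
  shows "mod_iso R M N"
  unfolding mod_iso_def
  by (intro bexI[of _ h] bij_betw_byWitness[where f'=g]) (use assms in \<open>auto simp: rhom_def\<close>)

lemma mod_iso_refl: "mod_iso R M M"
  by (rule mod_isoI[where h = "\<lambda>x. x" and g = "\<lambda>x. x"]) auto

lemma mod_iso_sym: 
  assumes "mod_iso R M N" "right_module R M" shows "mod_iso R N M"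
  by (rule mod_isoE[OF assms]) (rule mod_isoI)

lemma mod_iso_trans: 
  assumes "mod_iso R L M" "mod_iso R M N" shows "mod_iso R L N"
proof -
  obtain g h where g: "g \<in> rhom R L M" "bij_betw g (carrier L) (carrier M)"
    and h: "h \<in> rhom R M N" "bij_betw h (carrier M) (carrier N)"
    using assms by (auto simp: mod_iso_def)
  have "bij_betw (\<lambda>x. h (g x)) (carrier L) (carrier N)"
    using bij_betw_trans[OF g(2) h(2)] by (simp add: comp_def)
  then show ?thesis using rhom_comp[OF g(1) h(1)] by (auto simp: mod_iso_def)
qed

section \<open>Direct sums and quotients\<close>

lemma mod_sum_simps [simp]:
  "carrier (mod_sum M N) = carrier M \<times> carrier N"
  "\<zero>\<^bsub>mod_sum M N\<^esub> = (\<zero>\<^bsub>M\<^esub>, \<zero>\<^bsub>N\<^esub>)"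
  "(x, y) \<oplus>\<^bsub>mod_sum M N\<^esub> (x', y') = (x \<oplus>\<^bsub>M\<^esub> x', y \<oplus>\<^bsub>N\<^esub> y')"
  "a \<odot>\<^bsub>mod_sum M N\<^esub> (x, y) = (a \<odot>\<^bsub>M\<^esub> x, a \<odot>\<^bsub>N\<^esub> y)"
  by (simp_all add: mod_sum_def)

lemma right_module_mod_sum:
  assumes M: "right_module R M" and N: "right_module R N"
  shows "right_module R (mod_sum M N)"
proof -
  interpret M: right_module R M by fact
  interpret N: right_module R N by fact
  have ab: "abelian_group (mod_sum M N)"
  proof (rule abelian_groupI)
    fix x assume "x \<in> carrier (mod_sum M N)"
    then show "\<exists>y\<in>carrier (mod_sum M N). y \<oplus>\<^bsub>mod_sum M N\<^esub> x = \<zero>\<^bsub>mod_sum M N\<^esub>"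
      by (intro bexI[of _ "(\<ominus>\<^bsub>M\<^esub> fst x, \<ominus>\<^bsub>N\<^esub> snd x)"]) (auto simp: M.l_neg N.l_neg)
  qed (auto simp: M.a_ac N.a_ac)
  show ?thesis
    by (intro right_module.intro M.R.ring_axioms ab right_module_axioms.intro)
      (auto simp: M.smult_closed M.smult_l_distr M.smult_r_distr M.smult_assoc M.smult_one
          N.smult_closed N.smult_l_distr N.smult_r_distr N.smult_assoc N.smult_one)
qed

lemma rhom_fst: "fst \<in> rhom R (mod_sum M N) M"
  and rhom_snd: "snd \<in> rhom R (mod_sum M N) N"
  by (auto simp: rhom_def)

lemma rhom_pair:
  assumes "g \<in> rhom R L M" "h \<in> rhom R L N"
  shows "(\<lambda>x. (g x, h x)) \<in> rhom R L (mod_sum M N)"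
  using assms by (auto simp: rhom_def Pi_iff)

lemma rhom_inl: 
  assumes "right_module R N" shows "(\<lambda>x. (x, \<zero>\<^bsub>N\<^esub>)) \<in> rhom R M (mod_sum M N)"
  by (intro rhom_pair rhom_id rhom_zero_map assms)

lemma rhom_inr:
  assumes "right_module R M" shows "(\<lambda>x. (\<zero>\<^bsub>M\<^esub>, x)) \<in> rhom R N (mod_sum M N)"
  by (intro rhom_pair rhom_id rhom_zero_map assms)

lemma rhom_copair:
  assumes "right_module R L" "g \<in> rhom R M L" "h \<in> rhom R N L"
  shows "(\<lambda>z. g (fst z) \<oplus>\<^bsub>L\<^esub> h (snd z)) \<in> rhom R (mod_sum M N) L"
  by (intro rhom_plus assms rhom_comp[OF rhom_fst] rhom_comp[OF rhom_snd])

lemma mod_sum_iso: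
  assumes "mod_iso R A A'" "mod_iso R B B'" and rA: "right_module R A" and rB: "right_module R B"
  shows "mod_iso R (mod_sum A B) (mod_sum A' B')"
proof -
  obtain a a' where a: "a \<in> rhom R A A'" "a' \<in> rhom R A' A" "\<And>x. x \<in> carrier A \<Longrightarrow> a' (a x) = x"
    "\<And>x. x \<in> carrier A' \<Longrightarrow> a (a' x) = x"
    by (rule mod_isoE[OF assms(1) rA]) (rule that)
  obtain b b' where b: "b \<in> rhom R B B'" "b' \<in> rhom R B' B" "\<And>x. x \<in> carrier B \<Longrightarrow> b' (b x) = x"
    "\<And>x. x \<in> carrier B' \<Longrightarrow> b (b' x) = x"
    by (rule mod_isoE[OF assms(2) rB]) (rule that)
  show ?thesis
  proof (rule mod_isoI)
    show "(\<lambda>z. (a (fst z), b (snd z))) \<in> rhom R (mod_sum A B) (mod_sum A' B')"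
      by (rule rhom_pair[OF rhom_comp[OF rhom_fst a(1)] rhom_comp[OF rhom_snd b(1)]])
    show "(\<lambda>z. (a' (fst z), b' (snd z))) \<in> rhom R (mod_sum A' B') (mod_sum A B)"
      by (rule rhom_pair[OF rhom_comp[OF rhom_fst a(2)] rhom_comp[OF rhom_snd b(2)]])
  qed (auto simp: a b)
qed

lemma finite_mod_sum_simps [simp]:
  "carrier (finite_mod_sum n N) = (\<Pi>\<^sub>E i\<in>{..<n}. carrier (N i))"
  "\<zero>\<^bsub>finite_mod_sum n N\<^esub> = (\<lambda>i\<in>{..<n}. \<zero>\<^bsub>N i\<^esub>)"
  "u \<oplus>\<^bsub>finite_mod_sum n N\<^esub> v = (\<lambda>i\<in>{..<n}. u i \<oplus>\<^bsub>N i\<^esub> v i)"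
  "a \<odot>\<^bsub>finite_mod_sum n N\<^esub> u = (\<lambda>i\<in>{..<n}. a \<odot>\<^bsub>N i\<^esub> u i)"
  by (simp_all add: finite_mod_sum_def)

lemma finite_mod_sum_ext:
  assumes "u \<in> carrier (finite_mod_sum n N)" "v \<in> carrier (finite_mod_sum n N)"
    and "\<And>i. i < n \<Longrightarrow> u i = v i"
  shows "u = v"
  using assms by (intro PiE_ext[of u _ _ v]) auto

lemma finite_mod_sum_mem:
  "u \<in> carrier (finite_mod_sum n N) \<Longrightarrow> i < n \<Longrightarrow> u i \<in> carrier (N i)"
  by auto

lemma right_module_finite_mod_sum:
  assumes "ring R" and N: "\<And>i. i < n \<Longrightarrow> right_module R (N i)"
  shows "right_module R (finite_mod_sum n N)"
proof -
  interpret R: ring R by fact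
  have ag: "abelian_group (N i)" if "i < n" for i using N[OF that] by (rule right_moduleD)
  note agr = abelian_group.axioms(1)[OF ag]
  note ag_simps = abelian_monoid.a_closed[OF agr] abelian_monoid.zero_closed[OF agr]
    abelian_monoid.a_assoc[OF agr] abelian_monoid.a_comm[OF agr]
    abelian_monoid.l_zero[OF agr] abelian_monoid.r_zero[OF agr] abelian_group.a_inv_closed[OF ag] abelian_group.l_neg[OF ag]
  note m_simps = right_module.smult_closed[OF N] right_module.smult_l_distr[OF N]
    right_module.smult_r_distr[OF N] right_module.smult_assoc[OF N] right_module.smult_one[OF N]
  let ?F = "finite_mod_sum n N"
  have ab: "abelian_group ?F"
  proof (rule abelian_groupI)
    fix u assume u: "u \<in> carrier ?F"
    note ui = finite_mod_sum_mem[OF u]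
    show "\<exists>v\<in>carrier ?F. v \<oplus>\<^bsub>?F\<^esub> u = \<zero>\<^bsub>?F\<^esub>"
      by (rule bexI[of _ "\<lambda>i\<in>{..<n}. \<ominus>\<^bsub>N i\<^esub> u i"])
        (auto simp: abelian_group.l_neg[OF ag] abelian_group.a_inv_closed[OF ag] ui intro!: restrict_ext)
    show "\<zero>\<^bsub>?F\<^esub> \<oplus>\<^bsub>?F\<^esub> u = u"
      by (rule finite_mod_sum_ext[OF _ u]) (simp_all add: ag_simps ui)
    fix v assume v: "v \<in> carrier ?F"
    note vi = finite_mod_sum_mem[OF v]
    show "u \<oplus>\<^bsub>?F\<^esub> v \<in> carrier ?F" by (simp add: ag_simps ui vi)
    show "u \<oplus>\<^bsub>?F\<^esub> v = v \<oplus>\<^bsub>?F\<^esub> u" by (auto simp: ui vi intro!: restrict_ext abelian_monoid.a_comm[OF agr])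
    fix w assume w: "w \<in> carrier ?F"
    note wi = finite_mod_sum_mem[OF w]
    show "u \<oplus>\<^bsub>?F\<^esub> v \<oplus>\<^bsub>?F\<^esub> w = u \<oplus>\<^bsub>?F\<^esub> (v \<oplus>\<^bsub>?F\<^esub> w)"
      by (auto simp: ui vi wi intro!: restrict_ext abelian_monoid.a_assoc[OF agr])
  qed (simp add: ag_simps)
  show ?thesis
  proof (intro right_module.intro R.ring_axioms ab right_module_axioms.intro)
    fix u assume u: "u \<in> carrier ?F"
    note ui = finite_mod_sum_mem[OF u]
    show "\<one>\<^bsub>R\<^esub> \<odot>\<^bsub>?F\<^esub> u = u"
      by (rule finite_mod_sum_ext[OF _ u]) (simp_all add: m_simps ui)
    fix a assume a: "a \<in> carrier R"
    show "a \<odot>\<^bsub>?F\<^esub> u \<in> carrier ?F" using a by (simp add: m_simps ui)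
    show "a \<odot>\<^bsub>?F\<^esub> (u \<oplus>\<^bsub>?F\<^esub> v) = a \<odot>\<^bsub>?F\<^esub> u \<oplus>\<^bsub>?F\<^esub> a \<odot>\<^bsub>?F\<^esub> v" if v: "v \<in> carrier ?F" for v
      using a by (auto simp: m_simps ui finite_mod_sum_mem[OF v] intro!: restrict_ext)
    fix b assume b: "b \<in> carrier R"
    show "(a \<oplus>\<^bsub>R\<^esub> b) \<odot>\<^bsub>?F\<^esub> u = a \<odot>\<^bsub>?F\<^esub> u \<oplus>\<^bsub>?F\<^esub> b \<odot>\<^bsub>?F\<^esub> u"
      using a b by (auto simp: m_simps ui intro!: restrict_ext)
    show "(a \<otimes>\<^bsub>R\<^esub> b) \<odot>\<^bsub>?F\<^esub> u = b \<odot>\<^bsub>?F\<^esub> (a \<odot>\<^bsub>?F\<^esub> u)"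
      using a b by (auto simp: m_simps ui intro!: restrict_ext)
  qed
qed

lemma rhom_proj:
  assumes "i < n" shows "(\<lambda>u. u i) \<in> rhom R (finite_mod_sum n N) (N i)"
  using assms by (auto simp: rhom_def)

lemma rhom_tuple:
  assumes "\<And>i. i < n \<Longrightarrow> a i \<in> rhom R L (N i)"
  shows "(\<lambda>x. \<lambda>i\<in>{..<n}. a i x) \<in> rhom R L (finite_mod_sum n N)"
  by (rule rhomI) (auto simp: rhom_simps(1-3)[OF assms] intro!: restrict_ext)

lemma rhom_inj_summand:
  assumes "i < n" "\<And>j. j < n \<Longrightarrow> right_module R (N j)"
  shows "(\<lambda>x. \<lambda>j\<in>{..<n}. if j = i then x else \<zero>\<^bsub>N j\<^esub>) \<in> rhom R (N i) (finite_mod_sum n N)"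
proof (rule rhom_tuple)
  fix j assume j: "j < n"
  show "(\<lambda>x. if j = i then x else \<zero>\<^bsub>N j\<^esub>) \<in> rhom R (N i) (N j)"
    using rhom_zero_map[OF assms(2)[OF j]] by (cases "j = i") auto
qed

lemma rhom_pow_map:
  assumes "f \<in> rhom R M N"
  shows "(\<lambda>u. \<lambda>i\<in>{..<n}. f (u i)) \<in> rhom R (finite_mod_sum n (\<lambda>_. M)) (finite_mod_sum n (\<lambda>_. N))"
  by (rule rhom_tuple) (rule rhom_comp[OF rhom_proj assms])

lemma short_exact_pow:
  assumes "short_exact R A f B g C"
  shows "short_exact R (finite_mod_sum n (\<lambda>_. A)) (\<lambda>u. \<lambda>i\<in>{..<n}. f (u i))
    (finite_mod_sum n (\<lambda>_. B)) (\<lambda>u. \<lambda>i\<in>{..<n}. g (u i)) (finite_mod_sum n (\<lambda>_. C))"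
proof -
  note D = short_exactD[OF assms]
  show ?thesis
  proof (rule short_exactI)
    show "(\<lambda>u. \<lambda>i\<in>{..<n}. f (u i)) \<in> rhom R (finite_mod_sum n (\<lambda>_. A)) (finite_mod_sum n (\<lambda>_. B))"
      "(\<lambda>u. \<lambda>i\<in>{..<n}. g (u i)) \<in> rhom R (finite_mod_sum n (\<lambda>_. B)) (finite_mod_sum n (\<lambda>_. C))"
      by (rule rhom_pow_map D(1,2))+
    show "inj_on (\<lambda>u. \<lambda>i\<in>{..<n}. f (u i)) (carrier (finite_mod_sum n (\<lambda>_. A)))"
    proof (rule inj_onI)
      fix u v assume uv: "u \<in> carrier (finite_mod_sum n (\<lambda>_. A))" "v \<in> carrier (finite_mod_sum n (\<lambda>_. A))"
        "(\<lambda>i\<in>{..<n}. f (u i)) = (\<lambda>i\<in>{..<n}. f (v i))"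
      have "f (u i) = f (v i)" if "i < n" for i using fun_cong[OF uv(3), of i] that by simp
      then show "u = v" using uv(1,2) D(3)
        by (intro finite_mod_sum_ext[OF uv(1,2)]) (auto intro!: inj_onD[OF D(3)])
    qed
    show "\<exists>x\<in>carrier (finite_mod_sum n (\<lambda>_. A)). (\<lambda>i\<in>{..<n}. f (x i)) = y"
      if y: "y \<in> carrier (finite_mod_sum n (\<lambda>_. B))" "(\<lambda>i\<in>{..<n}. g (y i)) = \<zero>\<^bsub>finite_mod_sum n (\<lambda>_. C)\<^esub>" for y
    proof -
      have "\<exists>x\<in>carrier A. f x = y i" if "i < n" for i
        using fun_cong[OF y(2), of i] that y(1) by (intro D(6)) auto
      then obtain x where x: "\<And>i. i < n \<Longrightarrow> x i \<in> carrier A \<and> f (x i) = y i" by metis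
      show ?thesis
        using y(1) x by (intro bexI[of _ "\<lambda>i\<in>{..<n}. x i"] finite_mod_sum_ext[OF _ y(1)])
          (auto simp: rhom_closed[OF D(1)])
    qed
    show "\<exists>y\<in>carrier (finite_mod_sum n (\<lambda>_. B)). (\<lambda>i\<in>{..<n}. g (y i)) = z"
      if z: "z \<in> carrier (finite_mod_sum n (\<lambda>_. C))" for z
    proof -
      have "\<exists>x\<in>carrier B. g x = z i" if "i < n" for i
        using that z(1) by (intro D(7)) auto
      then obtain x where x: "\<And>i. i < n \<Longrightarrow> x i \<in> carrier B \<and> g (x i) = z i" by metis
      show ?thesis
        using z x by (intro bexI[of _ "\<lambda>i\<in>{..<n}. x i"] finite_mod_sum_ext[OF _ z])
          (auto simp: rhom_closed[OF D(2)])
    qed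
    show "(\<lambda>i\<in>{..<n}. g ((\<lambda>i\<in>{..<n}. f (u i)) i)) = \<zero>\<^bsub>finite_mod_sum n (\<lambda>_. C)\<^esub>"
      if "u \<in> carrier (finite_mod_sum n (\<lambda>_. A))" for u
      using finite_mod_sum_mem[OF that] by (auto simp: D(5) intro!: restrict_ext)
  qed
qed

lemma quot_mod_simps [simp]:
  "carrier (quot_mod M H) = a_rcosets\<^bsub>M\<^esub> H"
  "\<zero>\<^bsub>quot_mod M H\<^esub> = H"
  "C \<oplus>\<^bsub>quot_mod M H\<^esub> D = C <+>\<^bsub>M\<^esub> D"
  "a \<odot>\<^bsub>quot_mod M H\<^esub> C = (\<Union>x\<in>C. H +>\<^bsub>M\<^esub> (a \<odot>\<^bsub>M\<^esub> x))"
  by (simp_all add: quot_mod_def)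

context right_module
begin

context
  fixes H assumes H: "submodule H R M"
begin

lemma submodule_abelian_subgroup: "abelian_subgroup H M"
  using H by (intro abelian_subgroupI3 additive_subgroupI M.abelian_group_axioms) (auto simp: submodule_def)

lemma quot_mod_ops:
  assumes "x \<in> carrier M" 
  shows "y \<in> carrier M \<Longrightarrow> (H +>\<^bsub>M\<^esub> x) \<oplus>\<^bsub>quot_mod M H\<^esub> (H +>\<^bsub>M\<^esub> y) = H +>\<^bsub>M\<^esub> (x \<oplus>\<^bsub>M\<^esub> y)"
    and "a \<in> carrier R \<Longrightarrow> a \<odot>\<^bsub>quot_mod M H\<^esub> (H +>\<^bsub>M\<^esub> x) = H +>\<^bsub>M\<^esub> (a \<odot>\<^bsub>M\<^esub> x)"
    and "H +>\<^bsub>M\<^esub> x \<in> carrier (quot_mod M H)"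
    and "H +>\<^bsub>M\<^esub> x = H \<longleftrightarrow> x \<in> H"
proof -
  interpret H: abelian_subgroup H M by (rule submodule_abelian_subgroup)
  note D = submodD[OF H]
  show "(H +>\<^bsub>M\<^esub> x) \<oplus>\<^bsub>quot_mod M H\<^esub> (H +>\<^bsub>M\<^esub> y) = H +>\<^bsub>M\<^esub> (x \<oplus>\<^bsub>M\<^esub> y)" if "y \<in> carrier M"
    using assms that by (simp add: H.a_rcos_sum)
  show "H +>\<^bsub>M\<^esub> x \<in> carrier (quot_mod M H)" using assms D(1) by (simp add: M.a_rcosetsI)
  show "H +>\<^bsub>M\<^esub> x = H \<longleftrightarrow> x \<in> H"
    using assms H.a_rcos_self M.a_coset_join2[OF assms] H.a_subgroup by blast
  show "a \<odot>\<^bsub>quot_mod M H\<^esub> (H +>\<^bsub>M\<^esub> x) = H +>\<^bsub>M\<^esub> (a \<odot>\<^bsub>M\<^esub> x)" if a: "a \<in> carrier R"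
  proof -
    have "H +>\<^bsub>M\<^esub> (a \<odot>\<^bsub>M\<^esub> y) = H +>\<^bsub>M\<^esub> (a \<odot>\<^bsub>M\<^esub> x)" if y: "y \<in> H +>\<^bsub>M\<^esub> x" for y
    proof -
      obtain h where h: "h \<in> H" "y = h \<oplus>\<^bsub>M\<^esub> x" using y by (auto simp: a_r_coset_def')
      have "a \<odot>\<^bsub>M\<^esub> y = a \<odot>\<^bsub>M\<^esub> h \<oplus>\<^bsub>M\<^esub> a \<odot>\<^bsub>M\<^esub> x"
        using h a assms D(1) by (auto simp: smult_r_distr)
      then have "a \<odot>\<^bsub>M\<^esub> y \<in> H +>\<^bsub>M\<^esub> (a \<odot>\<^bsub>M\<^esub> x)"
        using D(4)[OF a h(1)] by (auto simp: a_r_coset_def')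
      then show ?thesis
        using M.a_repr_independence[of "a \<odot>\<^bsub>M\<^esub> y" H "a \<odot>\<^bsub>M\<^esub> x"] a assms H.a_subgroup by (simp add: smult_closed)
    qed
    then have "(\<Union>y\<in>H +>\<^bsub>M\<^esub> x. H +>\<^bsub>M\<^esub> (a \<odot>\<^bsub>M\<^esub> y)) = (\<Union>y\<in>H +>\<^bsub>M\<^esub> x. H +>\<^bsub>M\<^esub> (a \<odot>\<^bsub>M\<^esub> x))"
      by (rule SUP_cong[OF refl])
    moreover have "x \<in> H +>\<^bsub>M\<^esub> x" using assms by (rule H.a_rcos_self)
    then have "H +>\<^bsub>M\<^esub> x \<noteq> {}" by blast
    ultimately show ?thesis by simp
  qed
qed

lemma quot_mod_cases:
  assumes "C \<in> carrier (quot_mod M H)"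
  obtains x where "x \<in> carrier M" "C = H +>\<^bsub>M\<^esub> x"
  using assms by (auto simp: A_RCOSETS_def')

lemma right_module_quot_mod: "right_module R (quot_mod M H)"
proof -
  have H0: "\<zero>\<^bsub>quot_mod M H\<^esub> = H +>\<^bsub>M\<^esub> \<zero>\<^bsub>M\<^esub>"
    using quot_mod_ops(4)[of "\<zero>\<^bsub>M\<^esub>"] submodD(2)[OF H] by simp
  note ops = quot_mod_ops(1-3)
  have ab: "abelian_group (quot_mod M H)"
  proof (rule abelian_groupI)
    fix C assume C: "C \<in> carrier (quot_mod M H)"
    then obtain x where x: "x \<in> carrier M" "C = H +>\<^bsub>M\<^esub> x" by (rule quot_mod_cases)
    then show "\<exists>D\<in>carrier (quot_mod M H). D \<oplus>\<^bsub>quot_mod M H\<^esub> C = \<zero>\<^bsub>quot_mod M H\<^esub>"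
      unfolding H0
      by (intro bexI[of _ "H +>\<^bsub>M\<^esub> (\<ominus>\<^bsub>M\<^esub> x)"]) (simp_all add: ops M.l_neg del: quot_mod_simps)
  next
    show "\<zero>\<^bsub>quot_mod M H\<^esub> \<in> carrier (quot_mod M H)"
      unfolding H0 by (rule ops) simp
  qed (unfold H0, (elim quot_mod_cases, simp add: ops M.a_ac del: quot_mod_simps)+)
  show ?thesis
    by (intro right_module.intro R.ring_axioms ab right_module_axioms.intro; elim quot_mod_cases)
      (simp_all add: ops smult_closed smult_l_distr smult_r_distr smult_assoc smult_one del: quot_mod_simps)
qed

lemma rhom_quot: "(\<lambda>x. H +>\<^bsub>M\<^esub> x) \<in> rhom R M (quot_mod M H)"
  by (rule rhomI) (simp_all add: quot_mod_ops(1-3) del: quot_mod_simps)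

end

end

lemma right_module_coker_mod:
  assumes "right_module R A" "right_module R B" "f \<in> rhom R A B"
  shows "right_module R (coker_mod A f B)"
  unfolding coker_mod_def
  using right_module.right_module_quot_mod[OF assms(2)
      submodule_image[OF assms right_module.submodule_carrier[OF assms(1)]]] .

lemma short_exact_coker_mod:
  assumes A: "right_module R A" and B: "right_module R B" and f: "f \<in> rhom R A B" "inj_on f (carrier A)"
  shows "short_exact R A f B (\<lambda>x. f ` carrier A +>\<^bsub>B\<^esub> x) (coker_mod A f B)"
proof -
  interpret B: right_module R B by fact
  have H: "submodule (f ` carrier A) R B"
    by (rule submodule_image[OF A B f(1) right_module.submodule_carrier[OF A]])
  note ops = B.quot_mod_ops[OF H]
  show ?thesis unfolding coker_mod_def
  proof (rule short_exactI)
    show "\<exists>x\<in>carrier A. f x = y"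
      if "y \<in> carrier B" "f ` carrier A +>\<^bsub>B\<^esub> y = \<zero>\<^bsub>quot_mod B (f ` carrier A)\<^esub>" for y
      using that ops(4)[OF that(1)] by auto
    show "\<exists>y\<in>carrier B. f ` carrier A +>\<^bsub>B\<^esub> y = z"
      if "z \<in> carrier (quot_mod B (f ` carrier A))" for z
      using B.quot_mod_cases[OF H that] by metis
  qed (use f H B.rhom_quot[OF H] in \<open>auto simp: ops(4) rhom_closed[OF f(1)]\<close>)
qed

section \<open>Finite generation\<close>

context right_module
begin

lemma smult_finsum:
  assumes "finite S" "a \<in> carrier R" "g \<in> S \<rightarrow> carrier M"
  shows "a \<odot>\<^bsub>M\<^esub> (\<Oplus>\<^bsub>M\<^esub>s\<in>S. g s) = (\<Oplus>\<^bsub>M\<^esub>s\<in>S. a \<odot>\<^bsub>M\<^esub> g s)"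
  using assms
  by (induction S rule: finite_induct) (auto simp: smult_r_distr smult_closed Pi_iff M.finsum_closed)

lemma submodule_finsum:
  assumes H: "submodule H R M" and "finite S" "g \<in> S \<rightarrow> H"
  shows "(\<Oplus>\<^bsub>M\<^esub>s\<in>S. g s) \<in> H"
  using assms(2,3)
proof (induction S rule: finite_induct)
  case (insert s S)
  have "(\<Oplus>\<^bsub>M\<^esub>s\<in>insert s S. g s) = g s \<oplus>\<^bsub>M\<^esub> (\<Oplus>\<^bsub>M\<^esub>s\<in>S. g s)"
    using insert submodD(1)[OF H] by (intro M.finsum_insert) auto
  then show ?case using insert submodD(3)[OF H] by auto
qed (use submodD(2)[OF H] in simp)

text \<open>Generation in terms of submodules instead of linear combinations; all later arguments about
  generators test a submodule that contains them.\<close>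

lemma fin_gen_iff:
  "fin_gen R M \<longleftrightarrow>
    (\<exists>S. finite S \<and> S \<subseteq> carrier M \<and> (\<forall>H. submodule H R M \<and> S \<subseteq> H \<longrightarrow> carrier M \<subseteq> H))"
proof
  assume "fin_gen R M"
  then obtain S where S: "finite S" "S \<subseteq> carrier M"
    "\<And>x. x \<in> carrier M \<Longrightarrow> \<exists>c\<in>S \<rightarrow> carrier R. x = (\<Oplus>\<^bsub>M\<^esub>s\<in>S. c s \<odot>\<^bsub>M\<^esub> s)"
    unfolding fin_gen_def by blast
  have "x \<in> H" if H: "submodule H R M" "S \<subseteq> H" and x: "x \<in> carrier M" for H x
  proof -
    obtain c where c: "c \<in> S \<rightarrow> carrier R" "x = (\<Oplus>\<^bsub>M\<^esub>s\<in>S. c s \<odot>\<^bsub>M\<^esub> s)" using S(3)[OF x] by blast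
    show ?thesis unfolding c(2)
      by (rule submodule_finsum[OF H(1) S(1)]) (use H c(1) in \<open>auto intro: submodD(4)\<close>)
  qed
  with S(1,2) show "\<exists>S. finite S \<and> S \<subseteq> carrier M \<and> (\<forall>H. submodule H R M \<and> S \<subseteq> H \<longrightarrow> carrier M \<subseteq> H)"
    by blast
next
  assume "\<exists>S. finite S \<and> S \<subseteq> carrier M \<and> (\<forall>H. submodule H R M \<and> S \<subseteq> H \<longrightarrow> carrier M \<subseteq> H)"
  then obtain S where "finite S \<and> S \<subseteq> carrier M \<and> (\<forall>H. submodule H R M \<and> S \<subseteq> H \<longrightarrow> carrier M \<subseteq> H)"
    by (rule exE)
  then have S: "finite S" "S \<subseteq> carrier M"
    "\<And>H. submodule H R M \<Longrightarrow> S \<subseteq> H \<Longrightarrow> carrier M \<subseteq> H" by simp_all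
  define H where "H = {(\<Oplus>\<^bsub>M\<^esub>s\<in>S. c s \<odot>\<^bsub>M\<^esub> s) | c. c \<in> S \<rightarrow> carrier R}"
  have cs: "(\<lambda>s. c s \<odot>\<^bsub>M\<^esub> s) \<in> S \<rightarrow> carrier M" if "c \<in> S \<rightarrow> carrier R" for c
    using that S(2) by (auto intro!: smult_closed)
  have "submodule H R M"
  proof (rule submodI)
    show "H \<subseteq> carrier M" using cs by (auto simp: H_def intro!: M.finsum_closed)
    have "(\<Oplus>\<^bsub>M\<^esub>s\<in>S. \<zero> \<odot>\<^bsub>M\<^esub> s) = (\<Oplus>\<^bsub>M\<^esub>s\<in>S. \<zero>\<^bsub>M\<^esub>)"
      using S(2) by (intro M.finsum_cong') auto
    then show "\<zero>\<^bsub>M\<^esub> \<in> H" unfolding H_def by (auto intro!: exI[of _ "\<lambda>_. \<zero>"] simp: M.finsum_zero)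
  next
    fix x y assume "x \<in> H" "y \<in> H"
    then obtain c d where c: "c \<in> S \<rightarrow> carrier R" "x = (\<Oplus>\<^bsub>M\<^esub>s\<in>S. c s \<odot>\<^bsub>M\<^esub> s)"
      and d: "d \<in> S \<rightarrow> carrier R" "y = (\<Oplus>\<^bsub>M\<^esub>s\<in>S. d s \<odot>\<^bsub>M\<^esub> s)" by (auto simp: H_def)
    have "x \<oplus>\<^bsub>M\<^esub> y = (\<Oplus>\<^bsub>M\<^esub>s\<in>S. c s \<odot>\<^bsub>M\<^esub> s \<oplus>\<^bsub>M\<^esub> d s \<odot>\<^bsub>M\<^esub> s)"
      using M.finsum_addf[OF cs[OF c(1)] cs[OF d(1)]] c(2) d(2) by simp
    also have "\<dots> = (\<Oplus>\<^bsub>M\<^esub>s\<in>S. (c s \<oplus> d s) \<odot>\<^bsub>M\<^esub> s)"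
      using c(1) d(1) S(2) by (intro M.finsum_cong') (auto simp: Pi_iff subset_iff smult_l_distr intro!: smult_closed)
    finally show "x \<oplus>\<^bsub>M\<^esub> y \<in> H" unfolding H_def using c(1) d(1)
      by (auto intro!: exI[of _ "\<lambda>s. c s \<oplus> d s"])
  next
    fix a x assume a: "a \<in> carrier R" and "x \<in> H"
    then obtain c where c: "c \<in> S \<rightarrow> carrier R" "x = (\<Oplus>\<^bsub>M\<^esub>s\<in>S. c s \<odot>\<^bsub>M\<^esub> s)" by (auto simp: H_def)
    have "a \<odot>\<^bsub>M\<^esub> x = (\<Oplus>\<^bsub>M\<^esub>s\<in>S. a \<odot>\<^bsub>M\<^esub> (c s \<odot>\<^bsub>M\<^esub> s))"
      using smult_finsum[OF S(1) a cs[OF c(1)]] c(2) by simp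
    also have "\<dots> = (\<Oplus>\<^bsub>M\<^esub>s\<in>S. (c s \<otimes> a) \<odot>\<^bsub>M\<^esub> s)"
      using c(1) a S(2) by (intro M.finsum_cong') (auto simp: Pi_iff subset_iff smult_assoc intro!: smult_closed)
    finally show "a \<odot>\<^bsub>M\<^esub> x \<in> H" unfolding H_def using c(1) a
      by (auto intro!: exI[of _ "\<lambda>s. c s \<otimes> a"])
  qed
  moreover have "S \<subseteq> H"
  proof
    fix t assume t: "t \<in> S"
    have "(\<Oplus>\<^bsub>M\<^esub>s\<in>S. (if t = s then \<one> else \<zero>) \<odot>\<^bsub>M\<^esub> s) = (\<Oplus>\<^bsub>M\<^esub>s\<in>S. if t = s then s else \<zero>\<^bsub>M\<^esub>)"
      using S(2) by (intro M.finsum_cong') (auto simp: subset_iff smult_one)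
    also have "\<dots> = t" using t S(1,2) by (intro M.finsum_singleton) auto
    finally show "t \<in> H" unfolding H_def by (auto intro!: exI[of _ "\<lambda>s. if t = s then \<one> else \<zero>"])
  qed
  ultimately have "carrier M \<subseteq> H" by (rule S(3))
  then show "fin_gen R M" unfolding fin_gen_def using S(1,2) by (intro exI[of _ S]) (auto simp: H_def)
qed

lemma fin_genE:
  assumes "fin_gen R M"
  obtains S where "finite S" "S \<subseteq> carrier M"
    "\<And>H. submodule H R M \<Longrightarrow> S \<subseteq> H \<Longrightarrow> carrier M \<subseteq> H"
proof -
  obtain S where "finite S \<and> S \<subseteq> carrier M \<and> (\<forall>H. submodule H R M \<and> S \<subseteq> H \<longrightarrow> carrier M \<subseteq> H)"
    using assms unfolding fin_gen_iff by (rule exE)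
  then show thesis by (intro that[of S]) simp_all
qed

end

lemma fg_modD:
  assumes "fg_mod R M" shows "right_module R M" "fin_gen R M"
  using assms by (auto simp: fg_mod_def)

lemma fg_mod_image:
  assumes M: "fg_mod R M" and N: "right_module R N" and h: "h \<in> rhom R M N" "h ` carrier M = carrier N"
  shows "fg_mod R N"
proof -
  interpret M: right_module R M using M by (rule fg_modD)
  interpret N: right_module R N by fact
  obtain S where S: "finite S" "S \<subseteq> carrier M" "\<And>H. submodule H R M \<Longrightarrow> S \<subseteq> H \<Longrightarrow> carrier M \<subseteq> H"
    by (rule M.fin_genE[OF fg_modD(2)[OF M]]) (rule that)
  have "carrier N \<subseteq> H" if H: "submodule H R N" "h ` S \<subseteq> H" for H
  proof -
    have "carrier M \<subseteq> {x \<in> carrier M. h x \<in> H}"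
      by (rule S(3)[OF submodule_vimage[OF M.right_module_axioms N h(1) H(1)]]) (use S(2) H(2) in auto)
    then have "h ` carrier M \<subseteq> H" by blast
    then show ?thesis using h(2) by simp
  qed
  then have "fin_gen R N" unfolding N.fin_gen_iff
    using S(1,2) by (intro exI[of _ "h ` S"]) (auto simp: rhom_closed[OF h(1)])
  then show ?thesis using N by (simp add: fg_mod_def)
qed

lemma fg_mod_iso:
  assumes "fg_mod R M" "mod_iso R M N" "right_module R N"
  shows "fg_mod R N"
  using assms fg_mod_image[OF assms(1,3)] by (auto simp: mod_iso_def bij_betw_def)

lemma fg_mod_sum:
  assumes M: "fg_mod R M" and N: "fg_mod R N"
  shows "fg_mod R (mod_sum M N)"
proof -
  interpret M: right_module R M using M by (rule fg_modD)
  interpret N: right_module R N using N by (rule fg_modD)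
  interpret S: right_module R "mod_sum M N"
    by (intro right_module_mod_sum M.right_module_axioms N.right_module_axioms)
  obtain S where S: "finite S" "S \<subseteq> carrier M" "\<And>H. submodule H R M \<Longrightarrow> S \<subseteq> H \<Longrightarrow> carrier M \<subseteq> H"
    by (rule M.fin_genE[OF fg_modD(2)[OF M]]) (rule that)
  obtain T where T: "finite T" "T \<subseteq> carrier N" "\<And>H. submodule H R N \<Longrightarrow> T \<subseteq> H \<Longrightarrow> carrier N \<subseteq> H"
    by (rule N.fin_genE[OF fg_modD(2)[OF N]]) (rule that)
  let ?U = "(\<lambda>s. (s, \<zero>\<^bsub>N\<^esub>)) ` S \<union> (\<lambda>t. (\<zero>\<^bsub>M\<^esub>, t)) ` T"
  have "carrier (mod_sum M N) \<subseteq> H" if H: "submodule H R (mod_sum M N)" "?U \<subseteq> H" for H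
  proof -
    have 1: "carrier M \<subseteq> {x \<in> carrier M. (x, \<zero>\<^bsub>N\<^esub>) \<in> H}"
      by (rule S(3)[OF submodule_vimage[OF _ _ rhom_inl H(1)]])
        (use S(2) H(2) M.right_module_axioms N.right_module_axioms S.right_module_axioms in auto)
    have 2: "carrier N \<subseteq> {x \<in> carrier N. (\<zero>\<^bsub>M\<^esub>, x) \<in> H}"
      by (rule T(3)[OF submodule_vimage[OF _ _ rhom_inr H(1)]])
        (use T(2) H(2) M.right_module_axioms N.right_module_axioms S.right_module_axioms in auto)
    have "(x, y) \<in> H" if "x \<in> carrier M" "y \<in> carrier N" for x y
    proof -
      have "(x, \<zero>\<^bsub>N\<^esub>) \<oplus>\<^bsub>mod_sum M N\<^esub> (\<zero>\<^bsub>M\<^esub>, y) \<in> H"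
        by (rule S.submodD(3)[OF H(1)]) (use 1 2 that in auto)
      then show ?thesis using that by simp
    qed
    then show ?thesis by auto
  qed
  then have "fin_gen R (mod_sum M N)" unfolding S.fin_gen_iff
    using S(1,2) T(1,2) by (intro exI[of _ ?U]) auto
  then show ?thesis using S.right_module_axioms by (simp add: fg_mod_def)
qed

lemma rhom_snoc:
  "(\<lambda>z. \<lambda>i\<in>{..<Suc n}. if i < n then fst z i else snd z)
    \<in> rhom R (mod_sum (finite_mod_sum n (\<lambda>_. M)) M) (finite_mod_sum (Suc n) (\<lambda>_. M))"
proof (rule rhom_tuple)
  fix i assume "i < Suc n"
  show "(\<lambda>z. if i < n then fst z i else snd z) \<in> rhom R (mod_sum (finite_mod_sum n (\<lambda>_. M)) M) M"
    using rhom_comp[OF rhom_fst rhom_proj, of i n _ "\<lambda>_. M"] rhom_snd by (cases "i < n") auto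
qed

lemma fg_mod_pow:
  assumes M: "fg_mod R M"
  shows "fg_mod R (finite_mod_sum n (\<lambda>_. M))"
proof (induction n)
  interpret M: right_module R M using M by (rule fg_modD)
  have rm: "right_module R (finite_mod_sum n (\<lambda>_. M))" for n
    by (rule right_module_finite_mod_sum) (rule M.R.ring_axioms M.right_module_axioms)+
  {
    case 0
    interpret Z: right_module R "finite_mod_sum 0 (\<lambda>_. M)" by (rule rm)
    have "fin_gen R (finite_mod_sum 0 (\<lambda>_. M))"
      unfolding Z.fin_gen_iff by (intro exI[of _ "{\<lambda>_. undefined}"]) auto
    then show ?case using rm by (simp add: fg_mod_def)
  next
    case (Suc n)
    have *: "(\<lambda>z. \<lambda>i\<in>{..<Suc n}. if i < n then fst z i else snd z) ` carrier (mod_sum (finite_mod_sum n (\<lambda>_. M)) M)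
      = carrier (finite_mod_sum (Suc n) (\<lambda>_. M))" (is "?h ` _ = _")
    proof (intro equalityI subsetI)
      fix u assume u: "u \<in> carrier (finite_mod_sum (Suc n) (\<lambda>_. M))"
      have hu: "?h (restrict u {..<n}, u n) = u"
      proof (rule finite_mod_sum_ext[OF _ u])
        show "?h (restrict u {..<n}, u n) \<in> carrier (finite_mod_sum (Suc n) (\<lambda>_. M))"
          using finite_mod_sum_mem[OF u] by simp
        show "?h (restrict u {..<n}, u n) i = u i" if "i < Suc n" for i
        proof (cases "i < n")
          case False
          then have "i = n" using that by linarith
          then show ?thesis by simp
        qed simp
      qed
      have "(restrict u {..<n}, u n) \<in> carrier (mod_sum (finite_mod_sum n (\<lambda>_. M)) M)"
        using finite_mod_sum_mem[OF u] by simp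
      then show "u \<in> ?h ` carrier (mod_sum (finite_mod_sum n (\<lambda>_. M)) M)"
        using imageI[of "(restrict u {..<n}, u n)" "carrier (mod_sum (finite_mod_sum n (\<lambda>_. M)) M)" ?h]
        unfolding hu by simp
    next
      fix u assume "u \<in> ?h ` carrier (mod_sum (finite_mod_sum n (\<lambda>_. M)) M)"
      then obtain z where z: "z \<in> carrier (mod_sum (finite_mod_sum n (\<lambda>_. M)) M)" "u = ?h z" by (rule imageE)
      show "u \<in> carrier (finite_mod_sum (Suc n) (\<lambda>_. M))"
        unfolding z(2) by (rule rhom_closed[OF rhom_snoc[where R = R and n = n and M = M] z(1)])
    qed
    show ?case
      by (rule fg_mod_image[OF fg_mod_sum[OF Suc M] rm[of "Suc n"] rhom_snoc[where R = R and n = n and M = M] *])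
  }
qed

section \<open>Chain conditions over artin algebras\<close>

context right_module
begin

lemma submodule_add:
  assumes U: "submodule U R M" and V: "submodule V R M"
  shows "submodule {u \<oplus>\<^bsub>M\<^esub> v | u v. u \<in> U \<and> v \<in> V} R M"
proof (rule submodI)
  note DU = submodD[OF U] note DV = submodD[OF V]
  have c: "\<And>x. x \<in> U \<Longrightarrow> x \<in> carrier M" "\<And>x. x \<in> V \<Longrightarrow> x \<in> carrier M" using DU(1) DV(1) by auto
  show "{u \<oplus>\<^bsub>M\<^esub> v | u v. u \<in> U \<and> v \<in> V} \<subseteq> carrier M" using c by auto
  show "\<zero>\<^bsub>M\<^esub> \<in> {u \<oplus>\<^bsub>M\<^esub> v | u v. u \<in> U \<and> v \<in> V}"
    using DU(2) DV(2) by (auto intro!: exI[of _ "\<zero>\<^bsub>M\<^esub>"])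
  show "x \<oplus>\<^bsub>M\<^esub> y \<in> {u \<oplus>\<^bsub>M\<^esub> v | u v. u \<in> U \<and> v \<in> V}"
    if x: "x \<in> {u \<oplus>\<^bsub>M\<^esub> v | u v. u \<in> U \<and> v \<in> V}" and y: "y \<in> {u \<oplus>\<^bsub>M\<^esub> v | u v. u \<in> U \<and> v \<in> V}" for x y
  proof -
    obtain u v where uv: "u \<in> U" "v \<in> V" "x = u \<oplus>\<^bsub>M\<^esub> v" using x by blast
    obtain u' v' where uv': "u' \<in> U" "v' \<in> V" "y = u' \<oplus>\<^bsub>M\<^esub> v'" using y by blast
    note * = uv(1,2) uv'(1,2) uv(3) uv'(3)
    have "x \<oplus>\<^bsub>M\<^esub> y = (u \<oplus>\<^bsub>M\<^esub> u') \<oplus>\<^bsub>M\<^esub> (v \<oplus>\<^bsub>M\<^esub> v')" using * by (simp add: c M.a_ac)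
    then show ?thesis using * DU(3) DV(3) by blast
  qed
  show "a \<odot>\<^bsub>M\<^esub> x \<in> {u \<oplus>\<^bsub>M\<^esub> v | u v. u \<in> U \<and> v \<in> V}"
    if a: "a \<in> carrier R" and x: "x \<in> {u \<oplus>\<^bsub>M\<^esub> v | u v. u \<in> U \<and> v \<in> V}" for a x
  proof -
    obtain u v where *: "u \<in> U" "v \<in> V" "x = u \<oplus>\<^bsub>M\<^esub> v" using x by blast
    then have "a \<odot>\<^bsub>M\<^esub> x = a \<odot>\<^bsub>M\<^esub> u \<oplus>\<^bsub>M\<^esub> a \<odot>\<^bsub>M\<^esub> v" using a by (simp add: c smult_r_distr)
    then show ?thesis using * a DU(4) DV(4) by blast
  qed
qed

lemma submodule_Int:
  assumes U: "submodule U R M" and V: "submodule V R M"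
  shows "submodule (U \<inter> V) R M"
  by (rule submodI) (use submodD[OF U] submodD[OF V] in auto)

lemma submodule_cyclic:
  assumes x: "x \<in> carrier M"
  shows "submodule ((\<lambda>c. c \<odot>\<^bsub>M\<^esub> x) ` carrier R) R M"
proof (rule submodI)
  show "\<zero>\<^bsub>M\<^esub> \<in> (\<lambda>c. c \<odot>\<^bsub>M\<^esub> x) ` carrier R" using x by (auto intro!: image_eqI[of _ _ \<zero>])
  fix y assume y: "y \<in> (\<lambda>c. c \<odot>\<^bsub>M\<^esub> x) ` carrier R"
  show "y \<oplus>\<^bsub>M\<^esub> z \<in> (\<lambda>c. c \<odot>\<^bsub>M\<^esub> x) ` carrier R" if "z \<in> (\<lambda>c. c \<odot>\<^bsub>M\<^esub> x) ` carrier R" for z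
    using y that x by (auto simp flip: smult_l_distr)
  show "a \<odot>\<^bsub>M\<^esub> y \<in> (\<lambda>c. c \<odot>\<^bsub>M\<^esub> x) ` carrier R" if "a \<in> carrier R" for a
    using y that x by (auto simp flip: smult_assoc)
qed (use x in \<open>auto intro: smult_closed\<close>)

lemma submodule_add_cyclic:
  assumes B: "submodule B R M" and x: "x \<in> carrier M"
  shows "submodule {b \<oplus>\<^bsub>M\<^esub> c \<odot>\<^bsub>M\<^esub> x | b c. b \<in> B \<and> c \<in> carrier R} R M" (is "submodule ?C R M")
    and "B \<subseteq> {b \<oplus>\<^bsub>M\<^esub> c \<odot>\<^bsub>M\<^esub> x | b c. b \<in> B \<and> c \<in> carrier R}"
    and "x \<in> {b \<oplus>\<^bsub>M\<^esub> c \<odot>\<^bsub>M\<^esub> x | b c. b \<in> B \<and> c \<in> carrier R}"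
proof -
  have "?C = {u \<oplus>\<^bsub>M\<^esub> v | u v. u \<in> B \<and> v \<in> (\<lambda>c. c \<odot>\<^bsub>M\<^esub> x) ` carrier R}" by blast
  then show "submodule ?C R M" using submodule_add[OF B submodule_cyclic[OF x]] by simp
  note D = submodD[OF B]
  show "B \<subseteq> ?C"
  proof
    fix b assume b: "b \<in> B"
    have "b = b \<oplus>\<^bsub>M\<^esub> \<zero> \<odot>\<^bsub>M\<^esub> x" using b x D(1) by auto
    then show "b \<in> ?C" using b by blast
  qed
  have "x = \<zero>\<^bsub>M\<^esub> \<oplus>\<^bsub>M\<^esub> \<one> \<odot>\<^bsub>M\<^esub> x" using x by (simp add: smult_one)
  then show "x \<in> ?C" using D(2) by blast
qed

definition dcc :: "'m set \<Rightarrow> bool" where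
  "dcc B \<longleftrightarrow> wf {(U, V). submodule U R M \<and> submodule V R M \<and> U \<subset> V \<and> V \<subseteq> B}"

definition fg_sub :: "'m set \<Rightarrow> bool" where
  "fg_sub H \<longleftrightarrow> (\<exists>S. finite S \<and> S \<subseteq> H \<and> (\<forall>U. submodule U R M \<and> S \<subseteq> U \<longrightarrow> H \<subseteq> U))"

lemma fg_subE:
  assumes "fg_sub H"
  obtains S where "finite S" "S \<subseteq> H" "\<And>U. submodule U R M \<Longrightarrow> S \<subseteq> U \<Longrightarrow> H \<subseteq> U"
proof -
  obtain S where "finite S \<and> S \<subseteq> H \<and> (\<forall>U. submodule U R M \<and> S \<subseteq> U \<longrightarrow> H \<subseteq> U)"
    using assms unfolding fg_sub_def by (rule exE)
  then show thesis by (intro that[of S]) simp_all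
qed

lemma fg_subI:
  assumes "finite S" "S \<subseteq> H" "\<And>U. submodule U R M \<Longrightarrow> S \<subseteq> U \<Longrightarrow> H \<subseteq> U"
  shows "fg_sub H"
  unfolding fg_sub_def using assms by (intro exI[of _ S]) simp

end

locale artinian_module = right_module +
  assumes art: "artinian_cring R"
begin

lemma comm: "a \<in> carrier R \<Longrightarrow> b \<in> carrier R \<Longrightarrow> a \<otimes> b = b \<otimes> a"
  using art cring.cring_simprules(14)[of R] by (simp add: artinian_cring_def)

lemma smult_comm:
  assumes "a \<in> carrier R" "b \<in> carrier R" "x \<in> carrier M"
  shows "a \<odot>\<^bsub>M\<^esub> (b \<odot>\<^bsub>M\<^esub> x) = b \<odot>\<^bsub>M\<^esub> (a \<odot>\<^bsub>M\<^esub> x)"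
  using assms comm[of a b] smult_assoc[of a b x] smult_assoc[of b a x] by simp

lemma rhom_smult_left:
  assumes "c \<in> carrier R" shows "(\<lambda>x. c \<odot>\<^bsub>M\<^esub> x) \<in> rhom R M M"
  by (rule rhomI) (use assms in \<open>auto simp: smult_closed smult_r_distr smult_comm\<close>)

lemma idealI':
  assumes "I \<subseteq> carrier R" "\<zero> \<in> I" "\<And>a b. a \<in> I \<Longrightarrow> b \<in> I \<Longrightarrow> a \<oplus> b \<in> I"
    "\<And>a b. a \<in> carrier R \<Longrightarrow> b \<in> I \<Longrightarrow> a \<otimes> b \<in> I"
  shows "ideal I R"
proof (rule idealI)
  have "\<ominus> a \<in> I" if "a \<in> I" for a
    using assms(4)[of "\<ominus> \<one>" a] that assms(1) by (auto simp: R.l_minus subset_iff)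
  then show "subgroup I (add_monoid R)"
    using assms(1-3) by (intro R.add.subgroupI) (auto simp: a_inv_def)
  show "x \<otimes> a \<in> I" if "a \<in> I" "x \<in> carrier R" for a x using assms(4) that by blast
  show "a \<otimes> x \<in> I" if "a \<in> I" "x \<in> carrier R" for a x
    using assms(4)[OF that(2,1)] comm[of a x] that assms(1) by (auto simp: subset_iff)
qed (rule R.ring_axioms)

lemma colon_ideal:
  assumes S: "submodule S R M" and x: "x \<in> carrier M"
  shows "ideal {c \<in> carrier R. c \<odot>\<^bsub>M\<^esub> x \<in> S} R"
proof (rule idealI')
  note D = submodD[OF S]
  show "a \<otimes> b \<in> {c \<in> carrier R. c \<odot>\<^bsub>M\<^esub> x \<in> S}" if "a \<in> carrier R" "b \<in> {c \<in> carrier R. c \<odot>\<^bsub>M\<^esub> x \<in> S}" for a b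
    using that x D(4) by (auto simp: smult_assoc smult_comm[of b a])
qed (use submodD[OF S] x in \<open>auto simp: smult_l_distr\<close>)

text \<open>A submodule \<open>U\<close> of \<open>B + Rx\<close> is determined, among those comparable with it, by its
  intersection with \<open>B\<close> and by the ideal of all \<open>c\<close> with \<open>c x \<in> U + B\<close>; both grow with \<open>U\<close>.\<close>

lemma dcc_add_cyclic:
  assumes B: "submodule B R M" "dcc B" and x: "x \<in> carrier M"
  shows "dcc {b \<oplus>\<^bsub>M\<^esub> c \<odot>\<^bsub>M\<^esub> x | b c. b \<in> B \<and> c \<in> carrier R}" (is "dcc ?C")
proof -
  define plus where "plus U = {u \<oplus>\<^bsub>M\<^esub> v | u v. u \<in> U \<and> v \<in> B}" for U
  define col where "col U = {c \<in> carrier R. c \<odot>\<^bsub>M\<^esub> x \<in> plus U}" for U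
  let ?I = "{(I, J). ideal I R \<and> ideal J R \<and> I \<subset> J}"
  let ?B = "{(U, V). submodule U R M \<and> submodule V R M \<and> U \<subset> V \<and> V \<subseteq> B}"
  have "wf (?I <*lex*> ?B)"
    using art B(2) by (intro wf_lex_prod) (auto simp: artinian_cring_def dcc_def)
  then have "wf (inv_image (?I <*lex*> ?B) (\<lambda>U. (col U, U \<inter> B)))" by (rule wf_inv_image)
  moreover have "{(U, V). submodule U R M \<and> submodule V R M \<and> U \<subset> V \<and> V \<subseteq> ?C}
      \<subseteq> inv_image (?I <*lex*> ?B) (\<lambda>U. (col U, U \<inter> B))"
  proof (rule subrelI)
    fix U V assume "(U, V) \<in> {(U, V). submodule U R M \<and> submodule V R M \<and> U \<subset> V \<and> V \<subseteq> ?C}"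
    then have U: "submodule U R M" and V: "submodule V R M" and UV: "U \<subset> V" "V \<subseteq> ?C" by simp_all
    note DU = submodD[OF U] note DV = submodD[OF V] note DB = submodD[OF B(1)]
    have c: "\<And>x. x \<in> U \<Longrightarrow> x \<in> carrier M" "\<And>x. x \<in> V \<Longrightarrow> x \<in> carrier M" "\<And>x. x \<in> B \<Longrightarrow> x \<in> carrier M"
      using DU(1) DV(1) DB(1) by auto
    have id: "ideal (col U) R" "ideal (col V) R"
      unfolding col_def plus_def by (intro colon_ideal submodule_add U V B(1) x)+
    have sub: "col U \<subseteq> col V" using UV(1) by (auto simp: col_def plus_def)
    have "U \<inter> B \<subset> V \<inter> B" if eq: "col U = col V"
    proof (rule ccontr)
      assume "\<not> ?thesis"
      then have eqB: "U \<inter> B = V \<inter> B" using UV(1) by blast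
      have "v \<in> U" if v: "v \<in> V" for v
      proof -
        obtain b k where b: "b \<in> B" "k \<in> carrier R" "v = b \<oplus>\<^bsub>M\<^esub> k \<odot>\<^bsub>M\<^esub> x" using UV(2) v by blast
        note kx = smult_closed[OF b(2) x]
        have "k \<odot>\<^bsub>M\<^esub> x = v \<oplus>\<^bsub>M\<^esub> \<ominus>\<^bsub>M\<^esub> b" using b kx c by (simp add: M.a_ac M.r_neg2 M.r_neg1)
        then have "k \<in> col V" using b v DB(5) unfolding col_def plus_def by blast
        then have "k \<in> col U" using eq by simp
        then obtain u b' where u: "u \<in> U" "b' \<in> B" "k \<odot>\<^bsub>M\<^esub> x = u \<oplus>\<^bsub>M\<^esub> b'"
          unfolding col_def plus_def by blast
        have veq: "v = (b \<oplus>\<^bsub>M\<^esub> b') \<oplus>\<^bsub>M\<^esub> u" unfolding b(3) u(3) using u b c by (simp add: M.a_ac)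
        have "v \<ominus>\<^bsub>M\<^esub> u = b \<oplus>\<^bsub>M\<^esub> b'" using u(1,2) b(1) c v veq by (simp add: M.diff_eq_iff)
        then have "b \<oplus>\<^bsub>M\<^esub> b' \<in> V" using DV(6)[OF v, of u] u(1) UV(1) by auto
        then have "b \<oplus>\<^bsub>M\<^esub> b' \<in> U" using eqB DB(3)[OF b(1) u(2)] by blast
        then show ?thesis unfolding veq using u(1) by (rule DU(3))
      qed
      then show False using UV(1) by blast
    qed
    moreover have "submodule (U \<inter> B) R M" "submodule (V \<inter> B) R M" by (intro submodule_Int U V B(1))+
    ultimately show "(U, V) \<in> inv_image (?I <*lex*> ?B) (\<lambda>U. (col U, U \<inter> B))"
      using id sub by auto
  qed
  ultimately show ?thesis unfolding dcc_def by (rule wf_subset)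
qed

lemma dcc_fin_gen:
  assumes "fin_gen R M" shows "dcc (carrier M)"
proof -
  obtain S where S: "finite S" "S \<subseteq> carrier M" "\<And>H. submodule H R M \<Longrightarrow> S \<subseteq> H \<Longrightarrow> carrier M \<subseteq> H"
    by (rule fin_genE[OF assms]) (rule that)
  have "\<exists>C. submodule C R M \<and> S \<subseteq> C \<and> dcc C"
    using S(1,2)
  proof (induction S rule: finite_induct)
    case empty
    have "{(U, V). submodule U R M \<and> submodule V R M \<and> U \<subset> V \<and> V \<subseteq> {\<zero>\<^bsub>M\<^esub>}} = {}"
      using submodD(2) by blast
    then have "dcc {\<zero>\<^bsub>M\<^esub>}" unfolding dcc_def by (simp only: wf_def) simp
    then show ?case using submodule_zero by blast
  next
    case (insert x S)
    then obtain B where B: "submodule B R M" "S \<subseteq> B" "dcc B" by blast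
    have x: "x \<in> carrier M" using insert by simp
    show ?case
      using submodule_add_cyclic[OF B(1) x] dcc_add_cyclic[OF B(1,3) x] B(2) by blast
  qed
  then obtain C where C: "submodule C R M" "S \<subseteq> C" "dcc C" by blast
  then have "C = carrier M" using S(3) submodD(1) by blast
  then show ?thesis using C by simp
qed

text \<open>Over an artinian commutative ring the descending chain condition makes all submodules
  finitely generated.  Let \<open>I\<close> be minimal among the submodules that are not.  If a scalar had a
  proper kernel and a proper image on \<open>I\<close>, both would be finitely generated, hence \<open>I\<close>; so
  every scalar acts on \<open>I\<close> as zero or onto, and in the second case it is invertible by the chain
  condition in the ring.  So \<open>I\<close> is a vector space, and it is spanned by any \<open>x \<noteq> 0\<close> together with a
  hyperplane avoiding \<open>x\<close>, which is finitely generated by minimality.\<close>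

lemma fg_sub_if_dcc:
  assumes dcc: "dcc (carrier M)" and H: "submodule H R M"
  shows "fg_sub H"
proof (rule ccontr)
  assume "\<not> fg_sub H"
  let ?r = "{(U, V). submodule U R M \<and> submodule V R M \<and> U \<subset> V \<and> V \<subseteq> carrier M}"
  have "wf ?r" using dcc by (simp add: dcc_def)
  moreover have "H \<in> {H. submodule H R M \<and> \<not> fg_sub H}" using H \<open>\<not> fg_sub H\<close> by simp
  ultimately obtain I where I0: "I \<in> {H. submodule H R M \<and> \<not> fg_sub H}"
    and min0: "\<And>U. (U, I) \<in> ?r \<Longrightarrow> U \<notin> {H. submodule H R M \<and> \<not> fg_sub H}"
    by (rule wfE_min) (rule that)
  have I: "submodule I R M" "\<not> fg_sub I" using I0 by auto
  note D = submodD[OF I(1)]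
  have c: "\<And>x. x \<in> I \<Longrightarrow> x \<in> carrier M" using D(1) by auto
  have min: "fg_sub U" if "submodule U R M" "U \<subset> I" for U
    using min0[of U] that I(1) D(1) by blast
  have onto: "(\<forall>i\<in>I. k \<odot>\<^bsub>M\<^esub> i = \<zero>\<^bsub>M\<^esub>) \<or> (\<forall>i\<in>I. \<exists>j\<in>I. k \<odot>\<^bsub>M\<^esub> j = i)" if k: "k \<in> carrier R" for k
  proof (rule ccontr)
    assume neg: "\<not> ?thesis"
    note hk = rhom_smult_left[OF k] note RM = right_module_axioms
    let ?A = "I \<inter> {x \<in> carrier M. k \<odot>\<^bsub>M\<^esub> x = \<zero>\<^bsub>M\<^esub>}" and ?B = "(\<lambda>x. k \<odot>\<^bsub>M\<^esub> x) ` I"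
    have "submodule ?A R M" by (intro submodule_Int I submodule_kernel[OF RM RM hk])
    moreover from neg obtain i1 i2 where i: "i1 \<in> I" "k \<odot>\<^bsub>M\<^esub> i1 \<noteq> \<zero>\<^bsub>M\<^esub>" "i2 \<in> I" "\<And>j. j \<in> I \<Longrightarrow> k \<odot>\<^bsub>M\<^esub> j \<noteq> i2"
      unfolding de_Morgan_disj ball_simps bex_simps by (elim conjE bexE) (rule that, auto)
    have "?A \<subset> I" using i(1,2) by auto
    ultimately have "fg_sub ?A" by (rule min)
    then obtain S where S: "finite S" "S \<subseteq> ?A" "\<And>U. submodule U R M \<Longrightarrow> S \<subseteq> U \<Longrightarrow> ?A \<subseteq> U"
      by (rule fg_subE) (rule that)
    have "submodule ?B R M" by (rule submodule_image[OF RM RM hk I(1)])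
    moreover have "i2 \<notin> ?B" using i(4) by auto
    then have "?B \<subset> I" using D(4)[OF k] i(3) by auto
    ultimately have "fg_sub ?B" by (rule min)
    then obtain T where T: "finite T" "T \<subseteq> ?B" "\<And>U. submodule U R M \<Longrightarrow> T \<subseteq> U \<Longrightarrow> ?B \<subseteq> U"
      by (rule fg_subE) (rule that)
    obtain T' where T': "T' \<subseteq> I" "finite T'" "T = (\<lambda>x. k \<odot>\<^bsub>M\<^esub> x) ` T'"
      using finite_subset_image[OF T(1,2)] by blast
    have "fg_sub I"
    proof (rule fg_subI)
      show "finite (S \<union> T')" "S \<union> T' \<subseteq> I" using S(1,2) T' by auto
      fix U assume U: "submodule U R M" "S \<union> T' \<subseteq> U"
      note DU = submodD[OF U(1)]
      have "?A \<subseteq> U" using U(2) by (intro S(3) U(1)) auto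
      have "?B \<subseteq> (\<lambda>x. k \<odot>\<^bsub>M\<^esub> x) ` (U \<inter> I)"
        by (rule T(3)[OF submodule_image[OF RM RM hk submodule_Int[OF U(1) I(1)]]])
          (use T' U(2) in blast)
      show "I \<subseteq> U"
      proof
        fix i assume i: "i \<in> I"
        then have "k \<odot>\<^bsub>M\<^esub> i \<in> (\<lambda>x. k \<odot>\<^bsub>M\<^esub> x) ` (U \<inter> I)" using \<open>?B \<subseteq> _\<close> by blast
        then obtain u where u: "u \<in> U" "u \<in> I" "k \<odot>\<^bsub>M\<^esub> i = k \<odot>\<^bsub>M\<^esub> u" by blast
        have "k \<odot>\<^bsub>M\<^esub> (i \<ominus>\<^bsub>M\<^esub> u) = \<zero>\<^bsub>M\<^esub>"
          using u i c k by (simp add: rhom_diff[OF hk RM RM] M.diff_eq_iff smult_closed)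
        then have "i \<ominus>\<^bsub>M\<^esub> u \<in> ?A" using D(6)[OF i u(2)] c by simp
        then have "i \<ominus>\<^bsub>M\<^esub> u \<in> U" using \<open>?A \<subseteq> U\<close> by blast
        then have "u \<oplus>\<^bsub>M\<^esub> (i \<ominus>\<^bsub>M\<^esub> u) \<in> U" using u(1) DU(3) by blast
        then show "i \<in> U" using M.add_diff_cancel(1)[of u i] c i u by simp
      qed
    qed
    then show False using I(2) by simp
  qed
  have invertible: "\<exists>d\<in>carrier R. \<forall>i\<in>I. d \<odot>\<^bsub>M\<^esub> (k \<odot>\<^bsub>M\<^esub> i) = i"
    if k: "k \<in> carrier R" and kI: "\<forall>i\<in>I. \<exists>j\<in>I. k \<odot>\<^bsub>M\<^esub> j = i" for k
  proof -
    \<comment> \<open>\<open>J e\<close> is the ideal generated by \<open>e\<close> and the annihilator of \<open>I\<close>; one for which it is minimal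
      satisfies \<open>J (e k) = J e\<close>.\<close>
    define E where "E = {e \<in> carrier R. \<forall>i\<in>I. \<exists>j\<in>I. e \<odot>\<^bsub>M\<^esub> j = i}"
    define J where "J e = {a \<in> carrier R. \<exists>b\<in>carrier R. \<forall>i\<in>I. a \<odot>\<^bsub>M\<^esub> i = b \<odot>\<^bsub>M\<^esub> (e \<odot>\<^bsub>M\<^esub> i)}" for e
    have idJ: "ideal (J e) R" if e: "e \<in> carrier R" for e
    proof (rule idealI')
      show "\<zero> \<in> J e" unfolding J_def using e c by (auto intro!: bexI[of _ \<zero>] simp: smult_closed)
      show "a \<oplus> b \<in> J e" if ab: "a \<in> J e" "b \<in> J e" for a b
      proof -
        obtain a' b' where *: "a \<in> carrier R" "b \<in> carrier R" "a' \<in> carrier R" "b' \<in> carrier R"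
          "\<forall>i\<in>I. a \<odot>\<^bsub>M\<^esub> i = a' \<odot>\<^bsub>M\<^esub> (e \<odot>\<^bsub>M\<^esub> i)" "\<forall>i\<in>I. b \<odot>\<^bsub>M\<^esub> i = b' \<odot>\<^bsub>M\<^esub> (e \<odot>\<^bsub>M\<^esub> i)"
          using ab unfolding J_def by blast
        then have "\<forall>i\<in>I. (a \<oplus> b) \<odot>\<^bsub>M\<^esub> i = (a' \<oplus> b') \<odot>\<^bsub>M\<^esub> (e \<odot>\<^bsub>M\<^esub> i)"
          using e c by (simp add: smult_l_distr smult_closed)
        then show ?thesis using * by (auto simp: J_def)
      qed
      show "a \<otimes> b \<in> J e" if "a \<in> carrier R" and b: "b \<in> J e" for a b
      proof -
        obtain b' where *: "b \<in> carrier R" "b' \<in> carrier R" "\<forall>i\<in>I. b \<odot>\<^bsub>M\<^esub> i = b' \<odot>\<^bsub>M\<^esub> (e \<odot>\<^bsub>M\<^esub> i)"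
          using b unfolding J_def by blast
        have "(a \<otimes> b) \<odot>\<^bsub>M\<^esub> i = (b' \<otimes> a) \<odot>\<^bsub>M\<^esub> (e \<odot>\<^bsub>M\<^esub> i)" if "i \<in> I" for i
        proof -
          have "(a \<otimes> b) \<odot>\<^bsub>M\<^esub> i = a \<odot>\<^bsub>M\<^esub> (b \<odot>\<^bsub>M\<^esub> i)"
            using that * c \<open>a \<in> carrier R\<close> by (simp add: smult_assoc smult_comm[of b a])
          also have "\<dots> = (b' \<otimes> a) \<odot>\<^bsub>M\<^esub> (e \<odot>\<^bsub>M\<^esub> i)"
            using that * c \<open>a \<in> carrier R\<close> e by (simp add: smult_assoc smult_closed)
          finally show ?thesis .
        qed
        then show ?thesis using * that(1) by (auto simp: J_def)
      qed
    qed (auto simp: J_def)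
    have "wf {(I, J). ideal I R \<and> ideal J R \<and> I \<subset> J}" using art by (simp add: artinian_cring_def)
    moreover have "J \<one> \<in> J ` E" using c by (auto simp: E_def smult_one)
    ultimately obtain Q where Q0: "Q \<in> J ` E"
      and Qmin: "\<And>Q'. (Q', Q) \<in> {(I, J). ideal I R \<and> ideal J R \<and> I \<subset> J} \<Longrightarrow> Q' \<notin> J ` E"
      by (rule wfE_min) (rule that)
    obtain e where e: "e \<in> E" "Q = J e" using Q0 by blast
    have eR: "e \<in> carrier R" using e by (simp add: E_def)
    have ekE: "e \<otimes> k \<in> E"
    proof -
      have "\<exists>j\<in>I. (e \<otimes> k) \<odot>\<^bsub>M\<^esub> j = i" if i: "i \<in> I" for i
      proof -
        obtain j where j: "j \<in> I" "k \<odot>\<^bsub>M\<^esub> j = i" using kI i by blast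
        obtain l where l: "l \<in> I" "e \<odot>\<^bsub>M\<^esub> l = j" using e(1) j by (auto simp: E_def)
        show ?thesis using l j eR k c by (auto intro!: bexI[of _ l] simp: smult_assoc)
      qed
      then show ?thesis using eR k by (simp add: E_def)
    qed
    have "J (e \<otimes> k) \<subseteq> J e"
    proof
      fix a assume "a \<in> J (e \<otimes> k)"
      then obtain b where b: "a \<in> carrier R" "b \<in> carrier R" "\<forall>i\<in>I. a \<odot>\<^bsub>M\<^esub> i = b \<odot>\<^bsub>M\<^esub> ((e \<otimes> k) \<odot>\<^bsub>M\<^esub> i)"
        by (auto simp: J_def)
      have "a \<odot>\<^bsub>M\<^esub> i = (k \<otimes> b) \<odot>\<^bsub>M\<^esub> (e \<odot>\<^bsub>M\<^esub> i)" if "i \<in> I" for i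
        using b that eR k c by (simp add: smult_assoc smult_closed)
      then show "a \<in> J e" using b k by (auto simp: J_def)
    qed
    then have "J (e \<otimes> k) = J e"
      using Qmin[of "J (e \<otimes> k)"] idJ[of "e \<otimes> k"] idJ[of e] ekE e(2) eR k by auto
    moreover have "e \<in> J e" using eR c by (auto simp: J_def smult_one smult_closed intro!: bexI[of _ \<one>])
    ultimately have "e \<in> J (e \<otimes> k)" by simp
    then obtain b where b: "b \<in> carrier R" "\<forall>i\<in>I. e \<odot>\<^bsub>M\<^esub> i = b \<odot>\<^bsub>M\<^esub> ((e \<otimes> k) \<odot>\<^bsub>M\<^esub> i)"
      by (auto simp: J_def)
    have "b \<odot>\<^bsub>M\<^esub> (k \<odot>\<^bsub>M\<^esub> i) = i" if i: "i \<in> I" for i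
    proof -
      obtain j where j: "j \<in> I" "e \<odot>\<^bsub>M\<^esub> j = i" using e(1) i by (auto simp: E_def)
      have "i = b \<odot>\<^bsub>M\<^esub> ((e \<otimes> k) \<odot>\<^bsub>M\<^esub> j)" using b(2) j by auto
      also have "\<dots> = b \<odot>\<^bsub>M\<^esub> (k \<odot>\<^bsub>M\<^esub> i)" using j eR k c by (simp add: smult_assoc)
      finally show ?thesis by simp
    qed
    then show ?thesis using b by blast
  qed
  have "\<not> I \<subseteq> {\<zero>\<^bsub>M\<^esub>}"
  proof
    assume "I \<subseteq> {\<zero>\<^bsub>M\<^esub>}"
    then have "fg_sub I" using submodD(2) by (intro fg_subI[of "{}"]) auto
    then show False using I(2) by simp
  qed
  then obtain x where x: "x \<in> I" "x \<noteq> \<zero>\<^bsub>M\<^esub>" by blast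
  let ?Z = "{U. submodule U R M \<and> U \<subseteq> I \<and> x \<notin> U}"
  have "\<exists>H\<in>?Z. \<forall>U\<in>?Z. H \<subseteq> U \<longrightarrow> U = H"
  proof (rule subset_Zorn_nonempty)
    show "?Z \<noteq> {}" using submodule_zero x D(2) by blast
    fix C assume C: "C \<noteq> {}" "subset.chain ?Z C"
    have CZ: "\<And>U. U \<in> C \<Longrightarrow> submodule U R M \<and> U \<subseteq> I \<and> x \<notin> U" using C(2) by (auto simp: subset.chain_def)
    have CC: "\<And>U V. U \<in> C \<Longrightarrow> V \<in> C \<Longrightarrow> U \<subseteq> V \<or> V \<subseteq> U" using C(2) by (auto simp: subset.chain_def)
    have "submodule (\<Union>C) R M"
    proof (rule submodI)
      show "\<Union>C \<subseteq> carrier M" using CZ D(1) by blast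
      show "\<zero>\<^bsub>M\<^esub> \<in> \<Union>C" using C(1) CZ submodD(2) by blast
      fix y z assume "y \<in> \<Union>C" "z \<in> \<Union>C"
      then obtain U V where "U \<in> C" "V \<in> C" "y \<in> U" "z \<in> V" by blast
      then obtain W where "W \<in> C" "y \<in> W" "z \<in> W" using CC[of U V] by blast
      then show "y \<oplus>\<^bsub>M\<^esub> z \<in> \<Union>C" using CZ submodD(3) by blast
    next
      fix a y assume "a \<in> carrier R" "y \<in> \<Union>C"
      then show "a \<odot>\<^bsub>M\<^esub> y \<in> \<Union>C" using CZ submodD(4) by blast
    qed
    then show "\<Union>C \<in> ?Z" using CZ by blast
  qed
  then obtain H where H0: "H \<in> ?Z" "\<forall>U\<in>?Z. H \<subseteq> U \<longrightarrow> U = H" by (rule bexE)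
  have H: "submodule H R M" "H \<subseteq> I" "x \<notin> H" using H0(1) by simp_all
  have max: "U = H" if "submodule U R M" "U \<subseteq> I" "x \<notin> U" "H \<subseteq> U" for U
    using bspec[OF H0(2), of U] that by simp
  have "fg_sub H" using H x by (intro min) auto
  then obtain S where S: "finite S" "S \<subseteq> H" "\<And>U. submodule U R M \<Longrightarrow> S \<subseteq> U \<Longrightarrow> H \<subseteq> U"
    by (rule fg_subE) (rule that)
  have "fg_sub I"
  proof (rule fg_subI)
    show "finite (insert x S)" "insert x S \<subseteq> I" using S(1,2) H(2) x(1) by auto
    fix U assume U: "submodule U R M" "insert x S \<subseteq> U"
    note DU = submodD[OF U(1)]
    have HU: "H \<subseteq> U" using U by (intro S(3)) auto
    show "I \<subseteq> U"
    proof
      fix y assume y: "y \<in> I"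
      show "y \<in> U"
      proof (cases "y \<in> H")
        case False
        let ?H = "{b \<oplus>\<^bsub>M\<^esub> k \<odot>\<^bsub>M\<^esub> y | b k. b \<in> H \<and> k \<in> carrier R}"
        have "?H \<subseteq> I" using H(2) y D(3,4) by blast
        then have "x \<in> ?H"
          using max[of ?H] submodule_add_cyclic[OF H(1) c[OF y]] False by blast
        then obtain h k where hk: "h \<in> H" "k \<in> carrier R" "x = h \<oplus>\<^bsub>M\<^esub> k \<odot>\<^bsub>M\<^esub> y" by blast
        have hI: "h \<in> I" using hk(1) H(2) by blast
        have "k \<odot>\<^bsub>M\<^esub> y \<noteq> \<zero>\<^bsub>M\<^esub>" using hk H(3) c[OF hI] by auto
        then obtain d where d: "d \<in> carrier R" "d \<odot>\<^bsub>M\<^esub> (k \<odot>\<^bsub>M\<^esub> y) = y"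
          using onto[OF hk(2)] invertible[OF hk(2)] y by blast
        have "d \<odot>\<^bsub>M\<^esub> x = d \<odot>\<^bsub>M\<^esub> h \<oplus>\<^bsub>M\<^esub> y"
          using hk d c hI y by (simp add: smult_r_distr smult_closed)
        then have "y = d \<odot>\<^bsub>M\<^esub> x \<ominus>\<^bsub>M\<^esub> d \<odot>\<^bsub>M\<^esub> h"
          using d c hI y by (simp add: M.add_diff_cancel smult_closed)
        moreover have "d \<odot>\<^bsub>M\<^esub> x \<in> U" "d \<odot>\<^bsub>M\<^esub> h \<in> U" using d U(2) HU hk(1) by (auto intro: DU(4))
        ultimately show ?thesis using DU(6) by simp
      qed (use HU in auto)
    qed
  qed
  then show False using I(2) by simp
qed

end

definition restrict_scalars :: "('k \<Rightarrow> 'r) \<Rightarrow> ('r, 'm) module \<Rightarrow> ('k, 'm) module" where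
  "restrict_scalars \<phi> M = \<lparr>carrier = carrier M, mult = undefined, one = undefined,
     zero = \<zero>\<^bsub>M\<^esub>, add = add M, smult = (\<lambda>c x. \<phi> c \<odot>\<^bsub>M\<^esub> x)\<rparr>"

lemma restrict_scalars_simps [simp]:
  "carrier (restrict_scalars \<phi> M) = carrier M" "\<zero>\<^bsub>restrict_scalars \<phi> M\<^esub> = \<zero>\<^bsub>M\<^esub>"
  "x \<oplus>\<^bsub>restrict_scalars \<phi> M\<^esub> y = x \<oplus>\<^bsub>M\<^esub> y" "c \<odot>\<^bsub>restrict_scalars \<phi> M\<^esub> x = \<phi> c \<odot>\<^bsub>M\<^esub> x"
  by (simp_all add: restrict_scalars_def)

lemma right_module_restrict_scalars:
  assumes M: "right_module R M" and K: "ring K" and \<phi>: "\<phi> \<in> ring_hom K R"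
  shows "right_module K (restrict_scalars \<phi> M)"
proof -
  interpret right_module R M by fact
  note [simp] = ring_hom_closed[OF \<phi>] ring_hom_mult[OF \<phi>] ring_hom_add[OF \<phi>] ring_hom_one[OF \<phi>]
  have ab: "abelian_group (restrict_scalars \<phi> M)"
  proof (rule abelian_groupI)
    fix x assume "x \<in> carrier (restrict_scalars \<phi> M)"
    then show "\<exists>y\<in>carrier (restrict_scalars \<phi> M). y \<oplus>\<^bsub>restrict_scalars \<phi> M\<^esub> x = \<zero>\<^bsub>restrict_scalars \<phi> M\<^esub>"
      by (intro bexI[of _ "\<ominus>\<^bsub>M\<^esub> x"]) (auto simp: M.l_neg)
  qed (auto simp: M.a_ac)
  show ?thesis
    by (intro right_module.intro K ab right_module_axioms.intro)
      (auto simp: smult_closed smult_l_distr smult_r_distr smult_assoc smult_one)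
qed

lemma submodule_restrict_scalars:
  fixes K :: "'k ring" and R :: "'r ring"
  assumes M: "right_module R M" and K: "ring K" and \<phi>: "\<phi> \<in> ring_hom K R" and H: "submodule H R M"
  shows "submodule H K (restrict_scalars \<phi> M)"
  by (rule right_module.submodI[OF right_module_restrict_scalars[OF M K \<phi>]])
    (use right_module.submodD[OF M H] ring_hom_closed[OF \<phi>] in auto)

lemma right_module_regular_mod:
  assumes "ring R" shows "right_module R (regular_mod R)"
proof -
  interpret ring R by fact
  have ab: "abelian_group (regular_mod R)"
  proof (rule abelian_groupI)
    fix x assume "x \<in> carrier (regular_mod R)"
    then show "\<exists>y\<in>carrier (regular_mod R). y \<oplus>\<^bsub>regular_mod R\<^esub> x = \<zero>\<^bsub>regular_mod R\<^esub>"
      by (intro bexI[of _ "\<ominus>\<^bsub>R\<^esub> x"]) (auto simp: regular_mod_def l_neg)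
  qed (auto simp: regular_mod_def a_ac)
  show ?thesis
    by (intro right_module.intro ring_axioms ab right_module_axioms.intro)
      (auto simp: regular_mod_def l_distr r_distr m_assoc)
qed

lemma submodule_sub_iff:
  assumes M: "right_module R M" and H: "submodule H R M"
  shows "submodule U R (M\<lparr>carrier := H\<rparr>) \<longleftrightarrow> submodule U R M \<and> U \<subseteq> H"
proof
  note D = right_module.submodD[OF M] note D' = right_module.submodD[OF right_module_sub[OF M H]]
  assume U: "submodule U R (M\<lparr>carrier := H\<rparr>)"
  show "submodule U R M \<and> U \<subseteq> H"
    using D'[OF U] D[OF H] by (auto intro!: right_module.submodI[OF M])
next
  note D = right_module.submodD[OF M]
  assume U: "submodule U R M \<and> U \<subseteq> H"
  then show "submodule U R (M\<lparr>carrier := H\<rparr>)"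
    using D[of U] by (auto intro!: right_module.submodI[OF right_module_sub[OF M H]])
qed

context
  fixes K :: "'k ring" and \<phi> :: "'k \<Rightarrow> 'r" and R :: "'r ring"
  assumes art: "artin_algebra K \<phi> R"
begin

lemma artin_algebraD: "ring K" "ring R" "\<phi> \<in> ring_hom K R" "artinian_cring K"
  using art by (auto simp: artin_algebra_def artinian_cring_def cring_def)

text \<open>If \<open>S\<close> generates \<open>M\<close> over \<open>R\<close> and \<open>T\<close> generates \<open>R\<close> over the ground ring, the products of their
  elements generate \<open>M\<close> over the ground ring.  The set of all \<open>x\<close> with \<open>x R\<close> in a given submodule
  over the ground ring is a submodule over \<open>R\<close>; this replaces a computation with double sums.\<close>

lemma artinian_module_restrict_scalars:
  assumes "fg_mod R M"
  shows "artinian_module K (restrict_scalars \<phi> M)" "fin_gen K (restrict_scalars \<phi> M)"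
proof -
  interpret M: right_module R M using assms by (rule fg_modD)
  interpret KM: right_module K "restrict_scalars \<phi> M"
    by (rule right_module_restrict_scalars[OF M.right_module_axioms artin_algebraD(1,3)])
  show "artinian_module K (restrict_scalars \<phi> M)"
    by (intro artinian_module.intro KM.right_module_axioms artinian_module_axioms.intro artin_algebraD)
  let ?R = "restrict_scalars \<phi> (regular_mod R)"
  interpret KR: right_module K ?R
    by (rule right_module_restrict_scalars[OF right_module_regular_mod artin_algebraD(1,3)])
      (rule artin_algebraD)
  obtain T where T0: "finite T" "T \<subseteq> carrier R"
    "\<forall>x\<in>carrier R. \<exists>c\<in>T \<rightarrow> carrier K. x = (\<Oplus>\<^bsub>R\<^esub>s\<in>T. \<phi> (c s) \<otimes>\<^bsub>R\<^esub> s)"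
    using art by (auto simp: artin_algebra_def)
  have central: "\<phi> c \<otimes>\<^bsub>R\<^esub> x = x \<otimes>\<^bsub>R\<^esub> \<phi> c" if "c \<in> carrier K" "x \<in> carrier R" for c x
    using art that by (auto simp: artin_algebra_def)
  note ph = ring_hom_closed[OF artin_algebraD(3)]
  have T: "r \<in> H" if H: "submodule H K ?R" "T \<subseteq> H" and r: "r \<in> carrier R" for H r
  proof -
    obtain c where c: "c \<in> T \<rightarrow> carrier K" "r = (\<Oplus>\<^bsub>R\<^esub>s\<in>T. \<phi> (c s) \<otimes>\<^bsub>R\<^esub> s)" using T0(3) r by blast
    have fs: "(\<Oplus>\<^bsub>R\<^esub>s\<in>T'. g s) \<in> H" if "finite T'" "g \<in> T' \<rightarrow> H" for T' g
      using that
    proof (induction T' rule: finite_induct)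
      case empty
      then show ?case using KR.submodD(2)[OF H(1)] by (simp add: regular_mod_def)
    next
      case (insert t T')
      have "g \<in> T' \<rightarrow> carrier R" "g t \<in> carrier R"
        using insert.prems KR.submodD(1)[OF H(1)] by (auto simp: regular_mod_def)
      then have "(\<Oplus>\<^bsub>R\<^esub>s\<in>insert t T'. g s) = g t \<oplus>\<^bsub>R\<^esub> (\<Oplus>\<^bsub>R\<^esub>s\<in>T'. g s)"
        using insert by (intro M.R.finsum_insert) auto
      moreover have "g t \<in> H" "(\<Oplus>\<^bsub>R\<^esub>s\<in>T'. g s) \<in> H" using insert by auto
      ultimately show ?case using KR.submodD(3)[OF H(1), of "g t"] by (simp add: regular_mod_def)
    qed
    have "\<phi> (c s) \<otimes>\<^bsub>R\<^esub> s \<in> H" if "s \<in> T" for s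
    proof -
      have "c s \<in> carrier K" "s \<in> carrier R" "s \<in> H" using that H(2) T0(2) c(1) by auto
      then show ?thesis
        using KR.submodD(4)[OF H(1), of "c s" s] central[of "c s" s] by (simp add: regular_mod_def)
    qed
    then show ?thesis unfolding c(2) by (intro fs T0(1)) auto
  qed
  obtain S where S: "finite S" "S \<subseteq> carrier M" "\<And>H. submodule H R M \<Longrightarrow> S \<subseteq> H \<Longrightarrow> carrier M \<subseteq> H"
    by (rule M.fin_genE[OF fg_modD(2)[OF assms]]) (rule that)
  let ?G = "(\<lambda>(r, s). r \<odot>\<^bsub>M\<^esub> s) ` (T \<times> S)"
  have "carrier M \<subseteq> H" if H: "submodule H K (restrict_scalars \<phi> M)" "?G \<subseteq> H" for H
  proof -
    note D = KM.submodD[OF H(1), simplified]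
    have rs: "r \<odot>\<^bsub>M\<^esub> s \<in> H" if s: "s \<in> S" and r: "r \<in> carrier R" for r s
    proof -
      have sM: "s \<in> carrier M" using s S(2) by auto
      have "submodule {r \<in> carrier R. r \<odot>\<^bsub>M\<^esub> s \<in> H} K ?R"
      proof (rule KR.submodI)
        fix a x assume a: "a \<in> carrier K" and x: "x \<in> {r \<in> carrier R. r \<odot>\<^bsub>M\<^esub> s \<in> H}"
        have "(x \<otimes>\<^bsub>R\<^esub> \<phi> a) \<odot>\<^bsub>M\<^esub> s = \<phi> a \<odot>\<^bsub>M\<^esub> (x \<odot>\<^bsub>M\<^esub> s)" using a x sM ph by (simp add: M.smult_assoc)
        then show "a \<odot>\<^bsub>?R\<^esub> x \<in> {r \<in> carrier R. r \<odot>\<^bsub>M\<^esub> s \<in> H}"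
          using D(4)[of a] a x ph by (simp add: regular_mod_def)
      qed (use D sM in \<open>auto simp: regular_mod_def M.smult_l_distr\<close>)
      moreover have "T \<subseteq> {r \<in> carrier R. r \<odot>\<^bsub>M\<^esub> s \<in> H}" using H(2) T0(2) s by auto
      ultimately show ?thesis using T r by blast
    qed
    have "carrier M \<subseteq> {x \<in> carrier M. \<forall>r\<in>carrier R. r \<odot>\<^bsub>M\<^esub> x \<in> H}"
    proof (rule S(3))
      show "submodule {x \<in> carrier M. \<forall>r\<in>carrier R. r \<odot>\<^bsub>M\<^esub> x \<in> H} R M"
        by (rule M.submodI) (use D in \<open>auto simp: M.smult_r_distr M.smult_closed simp flip: M.smult_assoc\<close>)
    qed (use S(2) rs in auto)
    then have "\<one>\<^bsub>R\<^esub> \<odot>\<^bsub>M\<^esub> x \<in> H" if "x \<in> carrier M" for x using that by blast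
    then show ?thesis by (auto simp: M.smult_one)
  qed
  then show "fin_gen K (restrict_scalars \<phi> M)"
    unfolding KM.fin_gen_iff using S(1,2) T0(1,2)
    by (intro exI[of _ ?G]) (auto simp: M.smult_closed subset_iff)
qed

lemma fg_mod_submodule:
  assumes M: "fg_mod R M" and H: "submodule H R M"
  shows "fg_mod R (M\<lparr>carrier := H\<rparr>)"
proof -
  note rm = fg_modD(1)[OF M]
  interpret KM: artinian_module K "restrict_scalars \<phi> M" by (rule artinian_module_restrict_scalars[OF M])
  have "KM.fg_sub H"
    by (rule KM.fg_sub_if_dcc[OF KM.dcc_fin_gen[OF artinian_module_restrict_scalars(2)[OF M]]
        submodule_restrict_scalars[OF rm artin_algebraD(1,3) H]])
  then obtain S where S: "finite S" "S \<subseteq> H" 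
    "\<And>U. submodule U K (restrict_scalars \<phi> M) \<Longrightarrow> S \<subseteq> U \<Longrightarrow> H \<subseteq> U"
    by (rule KM.fg_subE) (rule that)
  have "H \<subseteq> U" if "submodule U R M" "S \<subseteq> U" for U
    by (rule S(3)[OF submodule_restrict_scalars[OF rm artin_algebraD(1,3) that(1)] that(2)])
  then have "fin_gen R (M\<lparr>carrier := H\<rparr>)"
    unfolding right_module.fin_gen_iff[OF right_module_sub[OF rm H]]
    using S(1,2) by (intro exI[of _ S]) (simp add: submodule_sub_iff[OF rm H])
  then show ?thesis using right_module_sub[OF rm H] by (simp add: fg_mod_def)
qed

lemma wf_submodules:
  assumes M: "fg_mod R M"
  shows "wf {(U, V). submodule U R M \<and> submodule V R M \<and> U \<subset> V}"
proof -
  note rm = fg_modD(1)[OF M]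
  interpret KM: artinian_module K "restrict_scalars \<phi> M" by (rule artinian_module_restrict_scalars[OF M])
  have "KM.dcc (carrier M)"
    using KM.dcc_fin_gen artinian_module_restrict_scalars[OF M] by simp
  then show ?thesis unfolding KM.dcc_def
    using submodule_restrict_scalars[OF rm artin_algebraD(1,3)] right_module.submodD(1)[OF rm]
    by (rule_tac wf_subset) auto
qed

end

section \<open>Free modules\<close>

lemma free_mod_simps:
  "carrier (free_mod R S) = {u. (\<forall>s\<in>S. u s \<in> carrier R) \<and> (\<forall>s. s \<notin> S \<longrightarrow> u s = \<zero>\<^bsub>R\<^esub>) \<and> finite {s. u s \<noteq> \<zero>\<^bsub>R\<^esub>}}"
  "\<zero>\<^bsub>free_mod R S\<^esub> = (\<lambda>_. \<zero>\<^bsub>R\<^esub>)"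
  "u \<oplus>\<^bsub>free_mod R S\<^esub> v = (\<lambda>s. u s \<oplus>\<^bsub>R\<^esub> v s)"
  "a \<odot>\<^bsub>free_mod R S\<^esub> u = (\<lambda>s. u s \<otimes>\<^bsub>R\<^esub> a)"
  by (simp_all add: free_mod_def)

text \<open>The homomorphism from the free module on the domain of \<open>v\<close> that extends \<open>v\<close>.\<close>

definition lin_ext :: "'r ring \<Rightarrow> ('r, 'm) module \<Rightarrow> ('s \<Rightarrow> 'm) \<Rightarrow> ('s \<Rightarrow> 'r) \<Rightarrow> 'm" where
  "lin_ext R M v u = (\<Oplus>\<^bsub>M\<^esub>s\<in>{s. u s \<noteq> \<zero>\<^bsub>R\<^esub>}. u s \<odot>\<^bsub>M\<^esub> v s)"

definition basis_vec :: "'r ring \<Rightarrow> 's \<Rightarrow> 's \<Rightarrow> 'r" where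
  "basis_vec R s t = (if t = s then \<one>\<^bsub>R\<^esub> else \<zero>\<^bsub>R\<^esub>)"

context
  fixes R :: "'r ring" assumes R: "ring R"
begin

interpretation R: ring R by (rule R)

lemma free_modD:
  assumes "u \<in> carrier (free_mod R S)"
  shows "u s \<in> carrier R" "s \<notin> S \<Longrightarrow> u s = \<zero>\<^bsub>R\<^esub>" "finite {s. u s \<noteq> \<zero>\<^bsub>R\<^esub>}" "{s. u s \<noteq> \<zero>\<^bsub>R\<^esub>} \<subseteq> S"
  using assms by (cases "s \<in> S", auto simp: free_mod_simps)

lemma free_modI:
  assumes "\<And>s. u s \<in> carrier R" "\<And>s. s \<notin> S \<Longrightarrow> u s = \<zero>\<^bsub>R\<^esub>" "finite T" "\<And>s. s \<notin> T \<Longrightarrow> u s = \<zero>\<^bsub>R\<^esub>"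
  shows "u \<in> carrier (free_mod R S)"
proof -
  have "{s. u s \<noteq> \<zero>\<^bsub>R\<^esub>} \<subseteq> T" using assms(4) by auto
  then show ?thesis using assms(1,2) finite_subset[OF _ assms(3)] by (simp add: free_mod_simps)
qed

lemma right_module_free_mod: "right_module R (free_mod R S)"
proof -
  let ?F = "free_mod R S"
  let ?s = "\<lambda>u. {s. u s \<noteq> \<zero>\<^bsub>R\<^esub>}"
  have ab: "abelian_group ?F"
  proof (rule abelian_groupI)
    fix u assume u: "u \<in> carrier ?F"
    note U = free_modD[OF u]
    have "(\<lambda>s. \<ominus>\<^bsub>R\<^esub> u s) \<in> carrier ?F"
      by (rule free_modI[where T = "?s u"]) (use U in auto)
    then show "\<exists>v\<in>carrier ?F. v \<oplus>\<^bsub>?F\<^esub> u = \<zero>\<^bsub>?F\<^esub>"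
      by (rule bexI[rotated]) (use U(1) in \<open>simp add: free_mod_simps R.l_neg\<close>)
    show "\<zero>\<^bsub>?F\<^esub> \<oplus>\<^bsub>?F\<^esub> u = u" using U(1) by (simp add: free_mod_simps)
    fix v assume v: "v \<in> carrier ?F"
    note V = free_modD[OF v]
    show "u \<oplus>\<^bsub>?F\<^esub> v \<in> carrier ?F" unfolding free_mod_simps(3)
      by (rule free_modI[where T = "?s u \<union> ?s v"]) (use U V in auto)
    show "u \<oplus>\<^bsub>?F\<^esub> v = v \<oplus>\<^bsub>?F\<^esub> u" using U(1) V(1) by (simp add: free_mod_simps R.a_comm)
    fix w assume w: "w \<in> carrier ?F"
    show "u \<oplus>\<^bsub>?F\<^esub> v \<oplus>\<^bsub>?F\<^esub> w = u \<oplus>\<^bsub>?F\<^esub> (v \<oplus>\<^bsub>?F\<^esub> w)"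
      using U(1) V(1) free_modD(1)[OF w] by (simp add: free_mod_simps R.a_assoc)
  qed (simp add: free_mod_simps)
  show ?thesis
  proof (intro right_module.intro R ab right_module_axioms.intro)
    fix u assume u: "u \<in> carrier ?F"
    note U = free_modD[OF u]
    show "\<one>\<^bsub>R\<^esub> \<odot>\<^bsub>?F\<^esub> u = u" using U(1) by (simp add: free_mod_simps)
    fix a assume a: "a \<in> carrier R"
    show "a \<odot>\<^bsub>?F\<^esub> u \<in> carrier ?F" unfolding free_mod_simps(4)
      by (rule free_modI[where T = "?s u"]) (use U a in auto)
    show "a \<odot>\<^bsub>?F\<^esub> (u \<oplus>\<^bsub>?F\<^esub> v) = a \<odot>\<^bsub>?F\<^esub> u \<oplus>\<^bsub>?F\<^esub> a \<odot>\<^bsub>?F\<^esub> v" if v: "v \<in> carrier ?F" for v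
      using U(1) free_modD(1)[OF v] a by (simp add: free_mod_simps R.l_distr)
    fix b assume b: "b \<in> carrier R"
    show "(a \<oplus>\<^bsub>R\<^esub> b) \<odot>\<^bsub>?F\<^esub> u = a \<odot>\<^bsub>?F\<^esub> u \<oplus>\<^bsub>?F\<^esub> b \<odot>\<^bsub>?F\<^esub> u"
      using U(1) a b by (simp add: free_mod_simps R.r_distr)
    show "(a \<otimes>\<^bsub>R\<^esub> b) \<odot>\<^bsub>?F\<^esub> u = b \<odot>\<^bsub>?F\<^esub> (a \<odot>\<^bsub>?F\<^esub> u)"
      using U(1) a b by (simp add: free_mod_simps R.m_assoc)
  qed
qed

lemma basis_vec_carrier: "s \<in> S \<Longrightarrow> basis_vec R s \<in> carrier (free_mod R S)"
  by (rule free_modI[where T = "{s}"]) (auto simp: basis_vec_def)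

lemma free_mod_span:
  assumes H: "submodule H R (free_mod R S)" and b: "\<And>s. s \<in> S \<Longrightarrow> basis_vec R s \<in> H"
  shows "carrier (free_mod R S) \<subseteq> H"
proof
  fix u assume u: "u \<in> carrier (free_mod R S)"
  interpret F: right_module R "free_mod R S" by (rule right_module_free_mod)
  have "u \<in> H" if "finite T" "u \<in> carrier (free_mod R S)" "{s. u s \<noteq> \<zero>\<^bsub>R\<^esub>} \<subseteq> T" for T u
    using that
  proof (induction T arbitrary: u rule: finite_induct)
    case empty
    then have "u = \<zero>\<^bsub>free_mod R S\<^esub>" by (auto simp: free_mod_simps)
    then show ?case using F.submodD(2)[OF H] by simp
  next
    case (insert t T)
    note U = free_modD[OF insert.prems(1)]
    show ?case
    proof (cases "t \<in> S")
      case True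
      have "u(t := \<zero>\<^bsub>R\<^esub>) \<in> carrier (free_mod R S)"
        by (rule free_modI[where T = "insert t T"]) (use U insert.hyps insert.prems(2) in auto)
      then have 1: "u(t := \<zero>\<^bsub>R\<^esub>) \<in> H" by (rule insert.IH) (use insert.prems(2) in auto)
      have "u = u(t := \<zero>\<^bsub>R\<^esub>) \<oplus>\<^bsub>free_mod R S\<^esub> (u t \<odot>\<^bsub>free_mod R S\<^esub> basis_vec R t)"
        using U(1) by (auto simp: free_mod_simps basis_vec_def fun_eq_iff)
      moreover have "\<dots> \<in> H"
        by (rule F.submodD(3)[OF H 1]) (rule F.submodD(4)[OF H U(1) b[OF True]])
      ultimately show ?thesis by simp
    next
      case False
      then have "{s. u s \<noteq> \<zero>\<^bsub>R\<^esub>} \<subseteq> T" using U(2) insert.prems(2) by auto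
      then show ?thesis using insert.IH insert.prems(1) by blast
    qed
  qed
  then show "u \<in> H" using u free_modD(3)[OF u] by blast
qed

lemma rhom_free_mod_eqI:
  assumes N: "right_module R N" and g: "g \<in> rhom R (free_mod R S) N" and h: "h \<in> rhom R (free_mod R S) N"
    and eq: "\<And>s. s \<in> S \<Longrightarrow> g (basis_vec R s) = h (basis_vec R s)" and u: "u \<in> carrier (free_mod R S)"
  shows "g u = h u"
proof -
  interpret N: right_module R N by fact
  let ?K = "{u \<in> carrier (free_mod R S). g u \<ominus>\<^bsub>N\<^esub> h u = \<zero>\<^bsub>N\<^esub>}"
  have "submodule ?K R (free_mod R S)"
    by (rule submodule_kernel[OF right_module_free_mod N rhom_minus[OF N g h]])
  then have "carrier (free_mod R S) \<subseteq> ?K"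
    by (rule free_mod_span)
      (use eq rhom_closed[OF h] in \<open>simp add: basis_vec_carrier N.minus_eq N.r_neg\<close>)
  then have "g u \<ominus>\<^bsub>N\<^esub> h u = \<zero>\<^bsub>N\<^esub>" using u by blast
  then show ?thesis using rhom_closed[OF g u] rhom_closed[OF h u] by (simp add: N.diff_eq_iff)
qed

lemma lin_ext_superset:
  assumes M: "right_module R M" and u: "u \<in> carrier (free_mod R S)" and v: "v \<in> S \<rightarrow> carrier M"
    and T: "finite T" "{s. u s \<noteq> \<zero>\<^bsub>R\<^esub>} \<subseteq> T" "T \<subseteq> S"
  shows "lin_ext R M v u = (\<Oplus>\<^bsub>M\<^esub>s\<in>T. u s \<odot>\<^bsub>M\<^esub> v s)"
proof -
  interpret M: right_module R M by fact
  show ?thesis unfolding lin_ext_def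
    by (rule M.add.finprod_mono_neutral_cong_left[OF T(1,2)])
      (use T(3) v free_modD(1)[OF u] in \<open>auto simp: Pi_iff subset_iff intro!: M.smult_closed\<close>)
qed

lemma rhom_lin_ext:
  assumes M: "right_module R M" and v: "v \<in> S \<rightarrow> carrier M"
  shows "lin_ext R M v \<in> rhom R (free_mod R S) M"
proof -
  interpret M: right_module R M by fact
  interpret F: right_module R "free_mod R S" by (rule right_module_free_mod)
  have cl: "(\<lambda>s. u s \<odot>\<^bsub>M\<^esub> v s) \<in> T \<rightarrow> carrier M" if "u \<in> carrier (free_mod R S)" "T \<subseteq> S" for u T
    using free_modD(1)[OF that(1)] that(2) v by (auto intro!: M.smult_closed)
  show ?thesis
  proof (rule rhomI)
    fix u assume u: "u \<in> carrier (free_mod R S)"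
    note U = free_modD[OF u]
    show "lin_ext R M v u \<in> carrier M"
      unfolding lin_ext_def by (intro M.finsum_closed cl u U(4))
    {
      fix w assume w: "w \<in> carrier (free_mod R S)"
      note W = free_modD[OF w]
      let ?T = "{s. u s \<noteq> \<zero>\<^bsub>R\<^esub>} \<union> {s. w s \<noteq> \<zero>\<^bsub>R\<^esub>}"
      have T: "finite ?T" "?T \<subseteq> S" using U W by auto
      have uw: "u \<oplus>\<^bsub>free_mod R S\<^esub> w \<in> carrier (free_mod R S)" using u w by (rule F.M.a_closed)
      have "lin_ext R M v (u \<oplus>\<^bsub>free_mod R S\<^esub> w) = (\<Oplus>\<^bsub>M\<^esub>s\<in>?T. (u \<oplus>\<^bsub>free_mod R S\<^esub> w) s \<odot>\<^bsub>M\<^esub> v s)"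
        by (rule lin_ext_superset[OF M uw v T(1) _ T(2)]) (auto simp: free_mod_simps)
      also have "\<dots> = (\<Oplus>\<^bsub>M\<^esub>s\<in>?T. u s \<odot>\<^bsub>M\<^esub> v s \<oplus>\<^bsub>M\<^esub> w s \<odot>\<^bsub>M\<^esub> v s)"
        by (rule M.finsum_cong')
          (use U(1) W(1) T(2) v in \<open>auto simp: free_mod_simps subset_iff Pi_iff M.smult_l_distr intro!: M.smult_closed M.M.a_closed\<close>)
      also have "\<dots> = (\<Oplus>\<^bsub>M\<^esub>s\<in>?T. u s \<odot>\<^bsub>M\<^esub> v s) \<oplus>\<^bsub>M\<^esub> (\<Oplus>\<^bsub>M\<^esub>s\<in>?T. w s \<odot>\<^bsub>M\<^esub> v s)"
        by (rule M.finsum_addf[OF cl[OF u T(2)] cl[OF w T(2)]])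
      also have "\<dots> = lin_ext R M v u \<oplus>\<^bsub>M\<^esub> lin_ext R M v w"
        using lin_ext_superset[OF M u v T(1) _ T(2)] lin_ext_superset[OF M w v T(1) _ T(2)] by simp
      finally show "lin_ext R M v (u \<oplus>\<^bsub>free_mod R S\<^esub> w) = lin_ext R M v u \<oplus>\<^bsub>M\<^esub> lin_ext R M v w" .
    }
    fix a assume a: "a \<in> carrier R"
    let ?T = "{s. u s \<noteq> \<zero>\<^bsub>R\<^esub>}"
    have au: "a \<odot>\<^bsub>free_mod R S\<^esub> u \<in> carrier (free_mod R S)" using a u by (rule F.smult_closed)
    have "lin_ext R M v (a \<odot>\<^bsub>free_mod R S\<^esub> u) = (\<Oplus>\<^bsub>M\<^esub>s\<in>?T. (a \<odot>\<^bsub>free_mod R S\<^esub> u) s \<odot>\<^bsub>M\<^esub> v s)"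
      by (rule lin_ext_superset[OF M au v U(3) _ U(4)]) (use a in \<open>auto simp: free_mod_simps\<close>)
    also have "\<dots> = (\<Oplus>\<^bsub>M\<^esub>s\<in>?T. a \<odot>\<^bsub>M\<^esub> (u s \<odot>\<^bsub>M\<^esub> v s))"
      by (rule M.finsum_cong')
        (use U a v in \<open>auto simp: free_mod_simps subset_iff Pi_iff M.smult_assoc intro!: M.smult_closed\<close>)
    also have "\<dots> = a \<odot>\<^bsub>M\<^esub> lin_ext R M v u"
      unfolding lin_ext_def by (rule M.smult_finsum[OF U(3) a cl[OF u U(4)], symmetric])
    finally show "lin_ext R M v (a \<odot>\<^bsub>free_mod R S\<^esub> u) = a \<odot>\<^bsub>M\<^esub> lin_ext R M v u" .
  qed
qed

lemma lin_ext_basis_vec: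
  assumes M: "right_module R M" and v: "v \<in> S \<rightarrow> carrier M" and s: "s \<in> S"
  shows "lin_ext R M v (basis_vec R s) = v s"
proof -
  interpret M: right_module R M by fact
  have vs: "v s \<in> carrier M" using v s by auto
  have "lin_ext R M v (basis_vec R s) = (\<Oplus>\<^bsub>M\<^esub>t\<in>{s}. basis_vec R s t \<odot>\<^bsub>M\<^esub> v t)"
    by (rule lin_ext_superset[OF M basis_vec_carrier[OF s] v]) (use s in \<open>auto simp: basis_vec_def\<close>)
  also have "\<dots> = basis_vec R s s \<odot>\<^bsub>M\<^esub> v s \<oplus>\<^bsub>M\<^esub> (\<Oplus>\<^bsub>M\<^esub>t\<in>{}. basis_vec R s t \<odot>\<^bsub>M\<^esub> v t)"
    by (rule M.finsum_insert) (use vs in \<open>auto simp: basis_vec_def M.smult_one\<close>)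
  also have "\<dots> = v s" using vs by (simp add: basis_vec_def M.smult_one)
  finally show ?thesis .
qed

lemma free_mod_lift:
  assumes A: "right_module R A" and B: "right_module R B"
    and p: "p \<in> rhom R A B" "p ` carrier A = carrier B" and h: "h \<in> rhom R (free_mod R S) B"
  shows "\<exists>l\<in>rhom R (free_mod R S) A. \<forall>u\<in>carrier (free_mod R S). p (l u) = h u"
proof -
  define v where "v s = inv_into (carrier A) p (h (basis_vec R s))" for s
  have im: "h (basis_vec R s) \<in> p ` carrier A" if "s \<in> S" for s
    unfolding p(2) by (rule rhom_closed[OF h basis_vec_carrier[OF that]])
  have v: "v s \<in> carrier A" "p (v s) = h (basis_vec R s)" if "s \<in> S" for s
    using inv_into_into[OF im[OF that]] f_inv_into_f[OF im[OF that]] by (simp_all add: v_def)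
  then have vS: "v \<in> S \<rightarrow> carrier A" by blast
  note l = rhom_lin_ext[OF A vS]
  have "p (lin_ext R A v u) = h u" if "u \<in> carrier (free_mod R S)" for u
    by (rule rhom_free_mod_eqI[OF B rhom_comp[OF l p(1)] h _ that])
      (simp add: lin_ext_basis_vec[OF A vS] v)
  then show ?thesis using l by blast
qed

lemma free_cover_eq: "free_cover R M = lin_ext R M (\<lambda>x. x)"
  by (simp add: free_cover_def lin_ext_def fun_eq_iff)

lemma rhom_free_cover:
  assumes M: "right_module R M"
  shows "free_cover R M \<in> rhom R (free_mod R (carrier M)) M"
    and "free_cover R M ` carrier (free_mod R (carrier M)) = carrier M"
proof -
  show hom: "free_cover R M \<in> rhom R (free_mod R (carrier M)) M"
    unfolding free_cover_eq by (rule rhom_lin_ext[OF M]) auto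
  have "x \<in> free_cover R M ` carrier (free_mod R (carrier M))" if "x \<in> carrier M" for x
    using lin_ext_basis_vec[OF M _ that, of "\<lambda>x. x"] basis_vec_carrier[OF that]
    unfolding free_cover_eq by (metis Pi_I image_eqI)
  then show "free_cover R M ` carrier (free_mod R (carrier M)) = carrier M"
    using rhom_closed[OF hom] by blast
qed

lemma fg_mod_free_mod:
  assumes "finite S" shows "fg_mod R (free_mod R S)"
proof -
  interpret F: right_module R "free_mod R S" by (rule right_module_free_mod)
  have "fin_gen R (free_mod R S)" unfolding F.fin_gen_iff
    using assms by (intro exI[of _ "basis_vec R ` S"]) (auto simp: basis_vec_carrier intro: subsetD[OF free_mod_span])
  then show ?thesis using F.right_module_axioms by (simp add: fg_mod_def)
qed

lemma fg_mod_free_presentation: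
  assumes "fg_mod R (M :: ('r, 'm) module)"
  obtains S :: "'m set" and p where "finite S" "p \<in> rhom R (free_mod R S) M" "p ` carrier (free_mod R S) = carrier M"
proof -
  interpret M: right_module R M using assms by (rule fg_modD)
  note rmM = M.right_module_axioms
  obtain S where S: "finite S" "S \<subseteq> carrier M" "\<And>H. submodule H R M \<Longrightarrow> S \<subseteq> H \<Longrightarrow> carrier M \<subseteq> H"
    by (rule M.fin_genE[OF fg_modD(2)[OF assms]]) (rule that)
  let ?p = "lin_ext R M (\<lambda>x. x)"
  have v: "(\<lambda>x. x) \<in> S \<rightarrow> carrier M" using S(2) by auto
  note p = rhom_lin_ext[OF rmM v]
  have "carrier M \<subseteq> ?p ` carrier (free_mod R S)"
  proof (rule S(3))
    show "submodule (?p ` carrier (free_mod R S)) R M"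
      by (rule submodule_image[OF right_module_free_mod rmM p right_module.submodule_carrier[OF right_module_free_mod]])
    show "S \<subseteq> ?p ` carrier (free_mod R S)"
    proof
      fix s assume s: "s \<in> S"
      show "s \<in> ?p ` carrier (free_mod R S)"
        by (rule image_eqI[where x = "basis_vec R s"])
          (simp_all add: lin_ext_basis_vec[OF rmM v s] basis_vec_carrier[OF s])
    qed
  qed
  then have "?p ` carrier (free_mod R S) = carrier M" using rhom_closed[OF p] by blast
  then show thesis using that S(1) p by blast
qed

end

section \<open>Vanishing of the first extension group\<close>

text \<open>The restriction map, whose cokernel is \<open>Ext\<^sup>1(M, N)\<close>, is onto.  Everything below is done with
  this elementwise form; lemma \<open>trivial_Ext1_iff\<close> is the only place where the group \<open>Ext\<^sup>1\<close> occurs.\<close>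

definition ext_zero :: "'r ring \<Rightarrow> ('r, 'm) module \<Rightarrow> ('r, 'n) module \<Rightarrow> bool" where
  "ext_zero R M N \<longleftrightarrow> (\<forall>h\<in>rhom R (syzygy R M) N.
     \<exists>g\<in>rhom R (free_mod R (carrier M)) N. \<forall>k\<in>carrier (syzygy R M). g k = h k)"

lemma comm_group_Hom_group:
  assumes M: "right_module R M" and N: "right_module R N"
  shows "comm_group (Hom_group R M N)"
proof -
  interpret N: right_module R N by fact
  have res: "restrict h (carrier M) \<in> carrier (Hom_group R M N)" if "h \<in> rhom R M N" for h
    using rhom_cong[OF that M, of "restrict h (carrier M)"] by (simp add: Hom_group_def)
  show ?thesis
  proof (rule comm_groupI)
    fix g assume g: "g \<in> carrier (Hom_group R M N)"
    then have gh: "g \<in> rhom R M N" and ge: "g \<in> extensional (carrier M)" by (simp_all add: Hom_group_def)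
    note gc = rhom_closed[OF gh]
    show "\<one>\<^bsub>Hom_group R M N\<^esub> \<otimes>\<^bsub>Hom_group R M N\<^esub> g = g"
      using ge gc by (auto simp: Hom_group_def intro!: extensionalityI[OF _ ge])
    show "\<exists>h\<in>carrier (Hom_group R M N). h \<otimes>\<^bsub>Hom_group R M N\<^esub> g = \<one>\<^bsub>Hom_group R M N\<^esub>"
      by (rule bexI[OF _ res[OF rhom_uminus[OF N gh]]])
        (auto simp: Hom_group_def gc N.l_neg intro!: restrict_ext)
    fix h assume "h \<in> carrier (Hom_group R M N)"
    then have hh: "h \<in> rhom R M N" by (simp add: Hom_group_def)
    note hc = rhom_closed[OF hh]
    show "g \<otimes>\<^bsub>Hom_group R M N\<^esub> h \<in> carrier (Hom_group R M N)"
      using res[OF rhom_plus[OF N gh hh]] by (simp add: Hom_group_def)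
    show "g \<otimes>\<^bsub>Hom_group R M N\<^esub> h = h \<otimes>\<^bsub>Hom_group R M N\<^esub> g"
      by (auto simp: Hom_group_def gc hc N.a_comm intro!: restrict_ext)
    fix k assume "k \<in> carrier (Hom_group R M N)"
    then have "k \<in> rhom R M N" by (simp add: Hom_group_def)
    note kc = rhom_closed[OF this]
    show "g \<otimes>\<^bsub>Hom_group R M N\<^esub> h \<otimes>\<^bsub>Hom_group R M N\<^esub> k = g \<otimes>\<^bsub>Hom_group R M N\<^esub> (h \<otimes>\<^bsub>Hom_group R M N\<^esub> k)"
      by (auto simp: Hom_group_def gc hc kc N.a_assoc intro!: restrict_ext)
  qed (use res[OF rhom_zero_map[OF N]] in \<open>simp add: Hom_group_def\<close>)
qed

lemma (in comm_group) trivial_Mod_iff: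
  assumes H: "subgroup H G"
  shows "trivial_group (G Mod H) \<longleftrightarrow> carrier G \<subseteq> H"
proof -
  have N: "H \<lhd> G" using H by (simp add: normal_iff_subgroup)
  have "trivial_group (G Mod H) \<longleftrightarrow> rcosets H = {H}"
    using normal.factorgroup_is_group[OF N] by (simp add: trivial_group_def FactGroup_def)
  also have "\<dots> \<longleftrightarrow> carrier G \<subseteq> H"
  proof
    assume *: "rcosets H = {H}"
    show "carrier G \<subseteq> H"
    proof
      fix a assume a: "a \<in> carrier G"
      then have "H #> a = H" using * rcosetsI[OF subgroup.subset[OF H] a] by simp
      then show "a \<in> H" using rcos_self[OF a H] by simp
    qed
  next
    assume *: "carrier G \<subseteq> H"
    have "H #> a = H" if "a \<in> carrier G" for a
      by (rule coset_join2[OF that H]) (use * that in auto)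
    then show "rcosets H = {H}" using one_closed by (auto simp: RCOSETS_def)
  qed
  finally show ?thesis .
qed

context
  fixes R :: "'r ring" assumes R: "ring R"
begin

lemma syzygy_eq: "syzygy R M = (free_mod R (carrier M))\<lparr>carrier := {u \<in> carrier (free_mod R (carrier M)). free_cover R M u = \<zero>\<^bsub>M\<^esub>}\<rparr>"
  by (simp add: syzygy_def a_kernel_def')

lemma syzygy_exact:
  assumes M: "right_module R M"
  shows "short_exact R (syzygy R M) (\<lambda>x. x) (free_mod R (carrier M)) (free_cover R M) M"
  unfolding syzygy_eq by (rule short_exact_kernel[OF right_module_free_mod[OF R] M rhom_free_cover[OF R M]])

lemma right_module_syzygy:
  assumes M: "right_module R M" shows "right_module R (syzygy R M)"
  unfolding syzygy_eq
  by (rule right_module_sub[OF right_module_free_mod[OF R] submodule_kernel[OF right_module_free_mod[OF R] M rhom_free_cover(1)[OF R M]]])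

lemma trivial_Ext1_iff:
  assumes M: "right_module R M" and N: "right_module R N"
  shows "trivial_group (Ext1 R M N) \<longleftrightarrow> ext_zero R M N"
proof -
  let ?F = "free_mod R (carrier M)" and ?K = "syzygy R M"
  note F = right_module_free_mod[OF R, of "carrier M"] and K = right_module_syzygy[OF M]
  interpret F: comm_group "Hom_group R ?F N" by (rule comm_group_Hom_group[OF F N])
  interpret K: comm_group "Hom_group R ?K N" by (rule comm_group_Hom_group[OF K N])
  interpret N: right_module R N by fact
  let ?r = "\<lambda>h. restrict h (carrier ?K)"
  have sub: "carrier ?K \<subseteq> carrier ?F" by (auto simp: syzygy_eq)
  have hr: "?r \<in> hom (Hom_group R ?F N) (Hom_group R ?K N)"
  proof (rule homI)
    fix h assume "h \<in> carrier (Hom_group R ?F N)"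
    then have "h \<in> rhom R ?F N" by (simp add: Hom_group_def)
    then have "h \<in> rhom R ?K N" by (rule rhom_comp[OF short_exactD(1)[OF syzygy_exact[OF M]]])
    then show "?r h \<in> carrier (Hom_group R ?K N)"
      using rhom_cong[OF _ K, of h N "?r h"] by (simp add: Hom_group_def)
  next
    fix g h
    show "?r (g \<otimes>\<^bsub>Hom_group R ?F N\<^esub> h) = ?r g \<otimes>\<^bsub>Hom_group R ?K N\<^esub> ?r h"
      using sub by (auto simp: Hom_group_def restrict_def fun_eq_iff)
  qed
  then interpret r: group_hom "Hom_group R ?F N" "Hom_group R ?K N" ?r
    by (intro group_hom.intro F.is_group K.is_group group_hom_axioms.intro)
  have "trivial_group (Ext1 R M N) \<longleftrightarrow> carrier (Hom_group R ?K N) \<subseteq> ?r ` carrier (Hom_group R ?F N)"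
    unfolding Ext1_def by (rule K.trivial_Mod_iff[OF r.img_is_subgroup])
  also have "\<dots> \<longleftrightarrow> ext_zero R M N"
  proof
    assume *: "carrier (Hom_group R ?K N) \<subseteq> ?r ` carrier (Hom_group R ?F N)"
    show "ext_zero R M N" unfolding ext_zero_def
    proof
      fix h assume h: "h \<in> rhom R ?K N"
      have "?r h \<in> carrier (Hom_group R ?K N)"
        using rhom_cong[OF h K, of "?r h"] by (simp add: Hom_group_def)
      then obtain g where g: "g \<in> carrier (Hom_group R ?F N)" "?r h = ?r g" using * by blast
      have "g k = h k" if "k \<in> carrier ?K" for k using fun_cong[OF g(2), of k] that by simp
      then show "\<exists>g\<in>rhom R ?F N. \<forall>k\<in>carrier ?K. g k = h k" using g(1) by (auto simp: Hom_group_def)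
    qed
  next
    assume *: "ext_zero R M N"
    show "carrier (Hom_group R ?K N) \<subseteq> ?r ` carrier (Hom_group R ?F N)"
    proof
      fix h assume h: "h \<in> carrier (Hom_group R ?K N)"
      then have hh: "h \<in> rhom R ?K N" "h \<in> extensional (carrier ?K)" by (simp_all add: Hom_group_def)
      obtain g where g: "g \<in> rhom R ?F N" "\<forall>k\<in>carrier ?K. g k = h k"
        using bspec[OF *[unfolded ext_zero_def] hh(1)] by (rule bexE)
      have "restrict g (carrier ?F) \<in> carrier (Hom_group R ?F N)"
        using rhom_cong[OF g(1) F, of "restrict g (carrier ?F)"] by (simp add: Hom_group_def)
      moreover have "h = ?r (restrict g (carrier ?F))"
        by (rule extensionalityI[OF hh(2)]) (use g(2) sub in auto)
      ultimately show "h \<in> ?r ` carrier (Hom_group R ?F N)" by blast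
    qed
  qed
  finally show ?thesis .
qed

end

text \<open>Exactness of \<open>Hom(B, N) \<rightarrow> Hom(A, N) \<rightarrow> Ext\<^sup>1(C, N)\<close>.  Lifting the free cover of \<open>C\<close> to \<open>B\<close> writes
  \<open>B\<close> as a quotient of the sum of the free module and \<open>A\<close>; a map on this sum is given by \<open>h\<close> and an
  extension of \<open>h\<close> from the syzygy, and it factors through \<open>B\<close>.\<close>

lemma ext_zero_extend:
  assumes C: "ext_zero R C N" and ex: "short_exact R A f B g C"
    and rm: "right_module R A" "right_module R B" "right_module R C" "right_module R N"
    and h: "h \<in> rhom R A N"
  shows "\<exists>h'\<in>rhom R B N. \<forall>a\<in>carrier A. h' (f a) = h a"
proof -
  note R = right_moduleD(2)[OF rm(1)]
  interpret A: right_module R A by (rule rm)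
  interpret B: right_module R B by (rule rm)
  interpret N: right_module R N by (rule rm)
  note D = short_exactD[OF ex]
  let ?F = "free_mod R (carrier C)" and ?K = "syzygy R C" and ?e = "free_cover R C"
  note rmF = right_module_free_mod[OF R, of "carrier C"] and rmK = right_module_syzygy[OF R rm(3)]
  note cov = rhom_free_cover[OF R rm(3)] and DK = short_exactD[OF syzygy_exact[OF R rm(3)]]
  interpret F: right_module R ?F by (rule rmF)
  obtain l where l: "l \<in> rhom R ?F B" "\<forall>u\<in>carrier ?F. g (l u) = ?e u"
    using free_mod_lift[OF R rm(2,3) D(2,4) cov(1)] by (rule bexE)
  have lK: "l \<in> rhom R ?K B" using rhom_comp[OF DK(1) l(1)] .
  have "l k \<in> f ` carrier A" if k: "k \<in> carrier ?K" for k
    using D(6)[OF rhom_closed[OF lK k]] l(2) rhom_closed[OF DK(1) k] DK(5)[OF k] by force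
  then obtain \<kappa> where \<kappa>: "\<kappa> \<in> rhom R ?K A" "\<forall>k\<in>carrier ?K. f (\<kappa> k) = l k"
    using factor_through_inj[OF rm(1) rmK D(1,3) lK] by blast
  obtain e where e: "e \<in> rhom R ?F N" "\<forall>k\<in>carrier ?K. e k = h (\<kappa> k)"
    using bspec[OF C[unfolded ext_zero_def] rhom_comp[OF \<kappa>(1) h]] by (rule bexE)
  let ?W = "mod_sum ?F A"
  note rmW = right_module_mod_sum[OF rmF rm(1)]
  let ?p = "\<lambda>w. l (fst w) \<oplus>\<^bsub>B\<^esub> f (snd w)" and ?q = "\<lambda>w. e (fst w) \<oplus>\<^bsub>N\<^esub> h (snd w)"
  note p = rhom_copair[OF rm(2) l(1) D(1)] and q = rhom_copair[OF rm(4) e(1) h]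
  have surj: "?p ` carrier ?W = carrier B"
  proof (intro equalityI subsetI)
    fix b assume b: "b \<in> carrier B"
    obtain u where u: "u \<in> carrier ?F" "?e u = g b"
      using cov(2) rhom_closed[OF D(2) b] by (metis imageE)
    have "g (b \<ominus>\<^bsub>B\<^esub> l u) = \<zero>\<^bsub>C\<^esub>"
      using u l(2) b rhom_closed[OF l(1) u(1)] right_moduleD(1)[OF rm(3)] rhom_closed[OF D(2) b]
      by (simp add: rhom_diff[OF D(2) rm(2,3)] abelian_group.diff_eq_iff abelian_group.axioms(1) abelian_monoid.l_zero abelian_monoid.zero_closed)
    then obtain a where a: "a \<in> carrier A" "f a = b \<ominus>\<^bsub>B\<^esub> l u"
      using D(6) b rhom_closed[OF l(1) u(1)] by blast
    have "?p (u, a) = b" using a u b rhom_closed[OF l(1) u(1)] by (simp add: B.add_diff_cancel)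
    then show "b \<in> ?p ` carrier ?W" using a(1) u(1) by (intro image_eqI[where x = "(u, a)"]) simp_all
  qed (use rhom_closed[OF p] in blast)
  have ker: "?q w = \<zero>\<^bsub>N\<^esub>" if w: "w \<in> carrier ?W" "?p w = \<zero>\<^bsub>B\<^esub>" for w
  proof -
    obtain u a where ua: "w = (u, a)" "u \<in> carrier ?F" "a \<in> carrier A" using w(1) by auto
    note cl = rhom_closed[OF l(1) ua(2)] rhom_closed[OF D(1) ua(3)] rhom_closed[OF h ua(3)]
    have "g (l u \<oplus>\<^bsub>B\<^esub> f a) = \<zero>\<^bsub>C\<^esub>" using w(2) ua(1) rhom_zero[OF D(2) rm(2,3)] by simp
    then have "?e u = \<zero>\<^bsub>C\<^esub>"
      using cl l(2) ua D(5) rhom_closed[OF cov(1) ua(2)] right_moduleD(1)[OF rm(3)]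
      by (simp add: rhom_add[OF D(2)] abelian_group.axioms(1) abelian_monoid.r_zero)
    then have u: "u \<in> carrier ?K" using ua(2) by (simp add: syzygy_eq[OF R])
    note \<kappa>u = rhom_closed[OF \<kappa>(1) u]
    have "f (\<kappa> u \<oplus>\<^bsub>A\<^esub> a) = \<zero>\<^bsub>B\<^esub>" using \<kappa>(2) u w(2) ua \<kappa>u by (simp add: rhom_add[OF D(1)])
    then have "\<kappa> u \<oplus>\<^bsub>A\<^esub> a = \<zero>\<^bsub>A\<^esub>"
      using D(3) \<kappa>u ua(3) unfolding rhom_inj_iff[OF rm(1,2) D(1)] by simp
    then have "h (\<kappa> u \<oplus>\<^bsub>A\<^esub> a) = \<zero>\<^bsub>N\<^esub>" using rhom_zero[OF h rm(1,4)] by simp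
    then show ?thesis using e(2) u ua \<kappa>u by (simp add: rhom_add[OF h])
  qed
  obtain h' where h': "h' \<in> rhom R B N" "\<forall>w\<in>carrier ?W. h' (?p w) = ?q w"
    using factor_through_surj[OF rmW rm(2,4) p surj q ker] by blast
  have "h' (f a) = h a" if a: "a \<in> carrier A" for a
    using bspec[OF h'(2), of "(\<zero>\<^bsub>?F\<^esub>, a)"] a rhom_zero[OF l(1) rmF rm(2)] rhom_zero[OF e(1) rmF rm(4)]
      rhom_closed[OF D(1) a] rhom_closed[OF h a] by simp
  then show ?thesis using h'(1) by blast
qed

text \<open>Exactness of \<open>Hom(Q, B) \<rightarrow> Hom(Q, C) \<rightarrow> Ext\<^sup>1(Q, A)\<close>.\<close>

lemma ext_zero_lift:
  assumes Q: "ext_zero R Q A" and ex: "short_exact R A f B g C"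
    and rm: "right_module R A" "right_module R B" "right_module R C" "right_module R Q"
    and h: "h \<in> rhom R Q C"
  shows "\<exists>l\<in>rhom R Q B. \<forall>q\<in>carrier Q. g (l q) = h q"
proof -
  note R = right_moduleD(2)[OF rm(1)]
  interpret A: right_module R A by (rule rm)
  interpret B: right_module R B by (rule rm)
  interpret C: right_module R C by (rule rm)
  note D = short_exactD[OF ex]
  let ?F = "free_mod R (carrier Q)" and ?K = "syzygy R Q" and ?e = "free_cover R Q"
  note rmF = right_module_free_mod[OF R, of "carrier Q"] and rmK = right_module_syzygy[OF R rm(4)]
  note cov = rhom_free_cover[OF R rm(4)] and DK = short_exactD[OF syzygy_exact[OF R rm(4)]]
  interpret F: right_module R ?F by (rule rmF)
  obtain l where l: "l \<in> rhom R ?F B" "\<forall>u\<in>carrier ?F. g (l u) = h (?e u)"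
    using free_mod_lift[OF R rm(2,3) D(2,4) rhom_comp[OF cov(1) h]] by (rule bexE)
  have lK: "l \<in> rhom R ?K B" using rhom_comp[OF DK(1) l(1)] .
  have "l k \<in> f ` carrier A" if k: "k \<in> carrier ?K" for k
    using D(6)[OF rhom_closed[OF lK k]] l(2) rhom_closed[OF DK(1) k] DK(5)[OF k] rhom_zero[OF h rm(4,3)] by force
  then obtain \<kappa> where \<kappa>: "\<kappa> \<in> rhom R ?K A" "\<forall>k\<in>carrier ?K. f (\<kappa> k) = l k"
    using factor_through_inj[OF rm(1) rmK D(1,3) lK] by blast
  obtain e where e: "e \<in> rhom R ?F A" "\<forall>k\<in>carrier ?K. e k = \<kappa> k"
    using bspec[OF Q[unfolded ext_zero_def] \<kappa>(1)] by (rule bexE)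
  let ?m = "\<lambda>u. l u \<ominus>\<^bsub>B\<^esub> f (e u)"
  have m: "?m \<in> rhom R ?F B" by (rule rhom_minus[OF rm(2) l(1) rhom_comp[OF e(1) D(1)]])
  have ker: "?m u = \<zero>\<^bsub>B\<^esub>" if u: "u \<in> carrier ?F" "?e u = \<zero>\<^bsub>Q\<^esub>" for u
  proof -
    have "u \<in> carrier ?K" using u by (simp add: syzygy_eq[OF R])
    then show ?thesis using e(2) \<kappa>(2) rhom_closed[OF l(1) u(1)] by (simp add: B.minus_eq B.r_neg)
  qed
  obtain l' where l': "l' \<in> rhom R Q B" "\<forall>u\<in>carrier ?F. l' (?e u) = ?m u"
    using factor_through_surj[OF rmF rm(4,2) cov m ker] by blast
  have "g (l' q) = h q" if q: "q \<in> carrier Q" for q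
  proof -
    obtain u where u: "u \<in> carrier ?F" "?e u = q" using cov(2) q by (metis imageE)
    note cl = rhom_closed[OF l(1) u(1)] rhom_closed[OF e(1) u(1)] rhom_closed[OF h q]
    have "g (?m u) = h q"
      using cl l(2) u D(5) rhom_closed[OF D(1)]
      by (simp add: rhom_diff[OF D(2) rm(2,3)] C.diff_eq_iff)
    moreover have "l' q = ?m u" using bspec[OF l'(2) u(1)] u(2) by simp
    ultimately show ?thesis by simp
  qed
  then show ?thesis using l'(1) by blast
qed

text \<open>Exactness of \<open>Hom(B, N) \<rightarrow> Hom(A, N) \<rightarrow> Ext\<^sup>1(C, N) \<rightarrow> Ext\<^sup>1(B, N)\<close>.  The pullback \<open>W\<close> of \<open>B\<close> and the
  free cover of \<open>C\<close> is an extension of \<open>B\<close> by the syzygy, so a map \<open>h\<close> on the syzygy extends to \<open>W\<close>.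
  Corrected by a map from \<open>B\<close> it vanishes on \<open>A\<close>, and \<open>W / A\<close> is the free module.\<close>

lemma ext_zero_if_extend:
  assumes ex: "short_exact R A f B g C" and BN: "ext_zero R B N"
    and rm: "right_module R A" "right_module R B" "right_module R C" "right_module R N"
    and ext: "\<And>h. h \<in> rhom R A N \<Longrightarrow> \<exists>h'\<in>rhom R B N. \<forall>a\<in>carrier A. h' (f a) = h a"
  shows "ext_zero R C N"
  unfolding ext_zero_def
proof
  note R = right_moduleD(2)[OF rm(1)]
  interpret A: right_module R A by (rule rm)
  interpret B: right_module R B by (rule rm)
  interpret C: right_module R C by (rule rm)
  interpret N: right_module R N by (rule rm)
  note D = short_exactD[OF ex]
  let ?F = "free_mod R (carrier C)" and ?K = "syzygy R C" and ?e = "free_cover R C"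
  note rmF = right_module_free_mod[OF R, of "carrier C"] and rmK = right_module_syzygy[OF R rm(3)]
  note cov = rhom_free_cover[OF R rm(3)] and DK = short_exactD[OF syzygy_exact[OF R rm(3)]]
  interpret F: right_module R ?F by (rule rmF)
  fix h assume h: "h \<in> rhom R ?K N"
  let ?S = "mod_sum ?F B" and ?d = "\<lambda>w. ?e (fst w) \<ominus>\<^bsub>C\<^esub> g (snd w)"
  note rmS = right_module_mod_sum[OF rmF rm(2)]
  have d: "?d \<in> rhom R ?S C"
    by (rule rhom_minus[OF rm(3) rhom_comp[OF rhom_fst cov(1)] rhom_comp[OF rhom_snd D(2)]])
  define W where "W = ?S\<lparr>carrier := {w \<in> carrier ?S. ?d w = \<zero>\<^bsub>C\<^esub>}\<rparr>"
  have rmW: "right_module R W" unfolding W_def by (rule right_module_sub[OF rmS submodule_kernel[OF rmS rm(3) d]])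
  have Wmem: "(u, b) \<in> carrier W \<longleftrightarrow> u \<in> carrier ?F \<and> b \<in> carrier B \<and> ?e u = g b" for u b
    using rhom_closed[OF cov(1)] rhom_closed[OF D(2)] by (auto simp: W_def C.diff_eq_iff)
  have fstW: "fst \<in> rhom R W ?F" and sndW: "snd \<in> rhom R W B"
    unfolding W_def by (rule rhom_from_sub[OF _ rhom_fst] rhom_from_sub[OF _ rhom_snd]; blast)+
  have Kc: "k \<in> carrier ?F" "?e k = \<zero>\<^bsub>C\<^esub>" if "k \<in> carrier ?K" for k
    using that by (simp_all add: syzygy_eq[OF R])
  have exW: "short_exact R ?K (\<lambda>k. (k, \<zero>\<^bsub>B\<^esub>)) W snd B"
  proof (rule short_exactI)
    show "(\<lambda>k. (k, \<zero>\<^bsub>B\<^esub>)) \<in> rhom R ?K W" unfolding W_def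
      by (rule rhom_into_sub[OF rhom_pair[OF DK(1) rhom_zero_map[OF rm(2)]]])
        (use Kc rhom_zero[OF D(2) rm(2,3)] in \<open>simp add: C.minus_eq C.r_neg\<close>)
    show "snd \<in> rhom R W B" by (rule sndW)
    show "\<exists>k\<in>carrier ?K. (k, \<zero>\<^bsub>B\<^esub>) = y" if "y \<in> carrier W" "snd y = \<zero>\<^bsub>B\<^esub>" for y
    proof -
      have y: "y = (fst y, \<zero>\<^bsub>B\<^esub>)" using that(2) by (cases y) auto
      have "(fst y, \<zero>\<^bsub>B\<^esub>) \<in> carrier W" using that(1) y by simp
      then have "fst y \<in> carrier ?K" using rhom_zero[OF D(2) rm(2,3)] by (simp add: Wmem syzygy_eq[OF R])
      then show ?thesis using y by (intro bexI[of _ "fst y"]) simp_all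
    qed
    show "\<exists>y\<in>carrier W. snd y = z" if z: "z \<in> carrier B" for z
    proof -
      obtain u where "u \<in> carrier ?F" "?e u = g z" using cov(2) rhom_closed[OF D(2) z] by (metis imageE)
      then show ?thesis using z Wmem by (intro bexI[of _ "(u, z)"]) simp_all
    qed
  qed (auto intro: inj_onI)
  obtain k where k: "k \<in> rhom R W N" "\<forall>x\<in>carrier ?K. k (x, \<zero>\<^bsub>B\<^esub>) = h x"
    using ext_zero_extend[OF BN exW rmK rmW rm(2,4) h] by (rule bexE)
  have fW: "(\<lambda>a. (\<zero>\<^bsub>?F\<^esub>, f a)) \<in> rhom R A W" unfolding W_def
    by (rule rhom_into_sub[OF rhom_pair[OF rhom_zero_map[OF rmF] D(1)]])
      (use D(5) rhom_closed[OF D(1)] rhom_zero[OF cov(1) rmF rm(3)] in \<open>simp add: C.minus_eq C.r_neg\<close>)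
  obtain g1 where g1: "g1 \<in> rhom R B N" "\<forall>a\<in>carrier A. g1 (f a) = k (\<zero>\<^bsub>?F\<^esub>, f a)"
    using ext[OF rhom_comp[OF fW k(1)]] by (rule bexE)
  let ?H = "\<lambda>w. k w \<ominus>\<^bsub>N\<^esub> g1 (snd w)"
  have H: "?H \<in> rhom R W N" by (rule rhom_minus[OF rm(4) k(1) rhom_comp[OF sndW g1(1)]])
  have surj: "fst ` carrier W = carrier ?F"
  proof (intro equalityI subsetI)
    fix u assume u: "u \<in> carrier ?F"
    obtain b where "b \<in> carrier B" "g b = ?e u" using D(7)[OF rhom_closed[OF cov(1) u]] by blast
    then show "u \<in> fst ` carrier W" using u Wmem by (intro image_eqI[of _ _ "(u, b)"]) simp_all
  qed (use rhom_closed[OF fstW] in blast)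
  have ker: "?H w = \<zero>\<^bsub>N\<^esub>" if w: "w \<in> carrier W" "fst w = \<zero>\<^bsub>?F\<^esub>" for w
  proof -
    obtain b where b: "w = (\<zero>\<^bsub>?F\<^esub>, b)" using w(2) by (cases w) auto
    have "b \<in> carrier B" "g b = \<zero>\<^bsub>C\<^esub>" using w(1) Wmem rhom_zero[OF cov(1) rmF rm(3)] unfolding b by auto
    then obtain a where a: "a \<in> carrier A" "f a = b" using D(6) by blast
    have "k w \<in> carrier N" using rhom_closed[OF k(1) w(1)] .
    then show ?thesis using g1(2) a unfolding b by (auto simp: N.minus_eq N.r_neg)
  qed
  obtain e where e: "e \<in> rhom R ?F N" "\<forall>w\<in>carrier W. e (fst w) = ?H w"
    using factor_through_surj[OF rmW rmF rm(4) fstW surj H ker] by blast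
  have "e x = h x" if x: "x \<in> carrier ?K" for x
  proof -
    have "(x, \<zero>\<^bsub>B\<^esub>) \<in> carrier W" using Kc[OF x] rhom_zero[OF D(2) rm(2,3)] by (simp add: Wmem)
    then show ?thesis
      using bspec[OF e(2), of "(x, \<zero>\<^bsub>B\<^esub>)"] k(2) x rhom_zero[OF g1(1) rm(2,4)] rhom_closed[OF h x]
      by simp
  qed
  then show "\<exists>g\<in>rhom R ?F N. \<forall>k\<in>carrier ?K. g k = h k" using e(1) by blast
qed

text \<open>A section of the free cover makes the syzygy a retract of the free module.\<close>

lemma ext_zero_section:
  assumes Q: "right_module R Q" and N: "right_module R N"
    and s: "s \<in> rhom R Q (free_mod R (carrier Q))" "\<And>q. q \<in> carrier Q \<Longrightarrow> free_cover R Q (s q) = q"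
  shows "ext_zero R Q N"
  unfolding ext_zero_def
proof
  note R = right_moduleD(2)[OF Q]
  let ?F = "free_mod R (carrier Q)" and ?K = "syzygy R Q" and ?e = "free_cover R Q"
  note rmF = right_module_free_mod[OF R, of "carrier Q"] and cov = rhom_free_cover[OF R Q]
  interpret Q: right_module R Q by (rule Q)
  interpret N: right_module R N by (rule N)
  interpret F: right_module R ?F by (rule rmF)
  fix h assume h: "h \<in> rhom R ?K N"
  have "(\<lambda>u. u \<ominus>\<^bsub>?F\<^esub> s (?e u)) \<in> rhom R ?F ?F" by (rule rhom_minus[OF rmF rhom_id rhom_comp[OF cov(1) s(1)]])
  then have r: "(\<lambda>u. u \<ominus>\<^bsub>?F\<^esub> s (?e u)) \<in> rhom R ?F ?K" unfolding syzygy_eq[OF R]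
  proof (rule rhom_into_sub)
    fix u assume u: "u \<in> carrier ?F"
    note cl = rhom_closed[OF cov(1) u] rhom_closed[OF s(1) rhom_closed[OF cov(1) u]]
    show "u \<ominus>\<^bsub>?F\<^esub> s (?e u) \<in> {u \<in> carrier ?F. ?e u = \<zero>\<^bsub>Q\<^esub>}"
      using u cl s(2) by (simp add: rhom_diff[OF cov(1) rmF Q] Q.minus_eq Q.r_neg)
  qed
  have "h (u \<ominus>\<^bsub>?F\<^esub> s (?e u)) = h u" if u: "u \<in> carrier ?K" for u
    using u rhom_zero[OF s(1) Q rmF] by (simp add: syzygy_eq[OF R])
  then show "\<exists>g\<in>rhom R ?F N. \<forall>k\<in>carrier ?K. g k = h k"
    by (intro bexI[OF _ rhom_comp[OF r h]]) simp
qed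

lemma ext_zero_free_mod:
  assumes R: "ring R" and N: "right_module R N"
  shows "ext_zero R (free_mod R S) N"
proof -
  note rmF = right_module_free_mod[OF R, of S]
  obtain s where "s \<in> rhom R (free_mod R S) (free_mod R (carrier (free_mod R S)))"
    "\<forall>u\<in>carrier (free_mod R S). free_cover R (free_mod R S) (s u) = u"
    using free_mod_lift[OF R right_module_free_mod[OF R] rmF rhom_free_cover[OF R rmF] rhom_id] by (rule bexE)
  then show ?thesis by (intro ext_zero_section[OF rmF N]) auto
qed

section \<open>Hereditary algebras\<close>

text \<open>The lifting property is stated for modules with carriers in one type; it passes to all
  finitely generated modules by isomorphism.\<close>

lemma projective_mod_lift:
  assumes Q: "projective_mod R Q" and A: "fg_mod R A" and B: "fg_mod R B"
    and p: "p \<in> rhom R A B" "p ` carrier A = carrier B" and h: "h \<in> rhom R Q B"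
  shows "\<exists>l\<in>rhom R Q A. \<forall>x\<in>carrier Q. p (l x) = h x"
proof -
  note rA = fg_modD(1)[OF A] and rB = fg_modD(1)[OF B]
  obtain A' :: "'a umod" where A': "fg_mod R A'" "mod_iso R A A'" using fg_mod_representative[OF A] by blast
  obtain B' :: "'a umod" where B': "fg_mod R B'" "mod_iso R B B'" using fg_mod_representative[OF B] by blast
  obtain a a' where a: "a \<in> rhom R A A'" "a' \<in> rhom R A' A" "\<And>x. x \<in> carrier A \<Longrightarrow> a' (a x) = x"
    by (rule mod_isoE[OF A'(2) rA]) (rule that)
  obtain b b' where b: "b \<in> rhom R B B'" "b' \<in> rhom R B' B" "\<And>x. x \<in> carrier B \<Longrightarrow> b' (b x) = x"
      "\<And>y. y \<in> carrier B' \<Longrightarrow> b (b' y) = y"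
    by (rule mod_isoE[OF B'(2) rB]) (rule that)
  let ?p = "\<lambda>x. b (p (a' x))"
  have hp: "?p \<in> rhom R A' B'" by (intro rhom_comp[OF rhom_comp[OF a(2) p(1)] b(1)])
  have sp: "?p ` carrier A' = carrier B'"
  proof (intro equalityI subsetI)
    fix y assume y: "y \<in> carrier B'"
    obtain x where x: "x \<in> carrier A" "p x = b' y" using p(2) rhom_closed[OF b(2) y] by (metis imageE)
    then have "?p (a x) = y" using a(3) b(4) y by simp
    then show "y \<in> ?p ` carrier A'" using rhom_closed[OF a(1) x(1)] by blast
  qed (use rhom_closed[OF hp] in blast)
  obtain l where l: "l \<in> rhom R Q A'" "\<forall>x\<in>carrier Q. ?p (l x) = b (h x)"
    using Q A'(1) B'(1) hp sp rhom_comp[OF h b(1)] unfolding projective_mod_def by blast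
  have "p (a' (l x)) = h x" if x: "x \<in> carrier Q" for x
  proof -
    have "b' (?p (l x)) = b' (b (h x))" using l(2) x by simp
    then show ?thesis
      using b(3) rhom_closed[OF p(1) rhom_closed[OF a(2) rhom_closed[OF l(1) x]]] rhom_closed[OF h x] by simp
  qed
  then show ?thesis by (intro bexI[OF _ rhom_comp[OF l(1) a(2)]]) simp
qed

text \<open>The operations of a free module do not involve its basis, so a submodule may be regarded in
  free modules of different rank.\<close>

lemma free_mod_update: "(free_mod R S)\<lparr>carrier := H\<rparr> = (free_mod R T)\<lparr>carrier := H\<rparr>"
  by (simp add: free_mod_def)

locale hereditary_artin_algebra =
  fixes K :: "'k ring" and \<phi> :: "'k \<Rightarrow> 'r" and R :: "'r ring"
  assumes artin: "artin_algebra K \<phi> R" and hered: "hereditary R"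
begin

lemma ring_R: "ring R" by (rule artin_algebraD(2)[OF artin])

lemmas rm_free_mod = right_module_free_mod[OF ring_R]

text \<open>A submodule \<open>H\<close> of a free module of finite rank is projective: by its last coordinate it maps
  onto a right ideal, which is projective, so it splits off, and the kernel lies in a free
  module of smaller rank.\<close>

lemma submodule_free_lift:
  assumes "finite S" and "submodule H R (free_mod R S)"
    and A: "fg_mod R A" and B: "fg_mod R B" and p: "p \<in> rhom R A B" "p ` carrier A = carrier B"
    and "h \<in> rhom R ((free_mod R S)\<lparr>carrier := H\<rparr>) B"
  shows "\<exists>l\<in>rhom R ((free_mod R S)\<lparr>carrier := H\<rparr>) A. \<forall>x\<in>H. p (l x) = h x"
  using assms(1,2,7)
proof (induction S arbitrary: H h rule: finite_induct)
  note rA = fg_modD(1)[OF A] and rB = fg_modD(1)[OF B]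
  interpret A: right_module R A by (rule rA)
  interpret B: right_module R B by (rule rB)
  {
    case empty
    note rF = rm_free_mod[of "{}"] and rH = right_module_sub[OF rm_free_mod empty.prems(1)]
    have "x = \<zero>\<^bsub>(free_mod R {})\<lparr>carrier := H\<rparr>\<^esub>" if "x \<in> H" for x
      using right_module.submodD(1)[OF rF empty.prems(1)] that by (auto simp: free_mod_simps)
    then have "h x = \<zero>\<^bsub>B\<^esub>" if "x \<in> H" for x using rhom_zero[OF empty.prems(2) rH rB] that by simp
    then show ?case
      by (intro bexI[OF _ rhom_zero_map[OF rA]]) (simp add: rhom_zero[OF p(1) rA rB])
  next
    case (insert s S)
    let ?F = "free_mod R (insert s S)"
    let ?H = "?F\<lparr>carrier := H\<rparr>"
    note rF = rm_free_mod[of "insert s S"] and rH = right_module_sub[OF rm_free_mod insert.prems(1)]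
    interpret F: right_module R ?F by (rule rF)
    note DH = F.submodD[OF insert.prems(1)]
    note rreg = right_module_regular_mod[OF ring_R]
    have ev: "(\<lambda>u. u s) \<in> rhom R ?F (regular_mod R)"
      by (rule rhomI) (auto simp: regular_mod_def free_mod_simps)
    define J where "J = (\<lambda>u. u s) ` H"
    let ?J = "(regular_mod R)\<lparr>carrier := J\<rparr>"
    have subJ: "submodule J R (regular_mod R)"
      unfolding J_def by (rule submodule_image[OF rF rreg ev insert.prems(1)])
    have projJ: "projective_mod R ?J" using hered subJ by (simp add: hereditary_def)
    have fgreg: "fg_mod R (regular_mod R)"
    proof -
      interpret reg: right_module R "regular_mod R" by (rule rreg)
      interpret R: ring R by (rule ring_R)
      have "fin_gen R (regular_mod R)" unfolding reg.fin_gen_iff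
      proof (intro exI[of _ "{\<one>\<^bsub>R\<^esub>}"] conjI allI impI subsetI)
        fix H x assume H: "submodule H R (regular_mod R) \<and> {\<one>\<^bsub>R\<^esub>} \<subseteq> H" and x: "x \<in> carrier (regular_mod R)"
        have "x \<odot>\<^bsub>regular_mod R\<^esub> \<one>\<^bsub>R\<^esub> \<in> H"
          by (rule reg.submodD(4)) (use H x in \<open>auto simp: regular_mod_def\<close>)
        then show "x \<in> H" using x by (simp add: regular_mod_def)
      qed (auto simp: regular_mod_def)
      then show ?thesis using rreg by (simp add: fg_mod_def)
    qed
    have fgJ: "fg_mod R ?J" by (rule fg_mod_submodule[OF artin fgreg subJ])
    have fgH: "fg_mod R ?H"
      by (rule fg_mod_submodule[OF artin fg_mod_free_mod[OF ring_R] insert.prems(1)]) (use insert.hyps in simp)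
    have evH: "(\<lambda>u. u s) \<in> rhom R ?H ?J"
      by (rule rhom_into_sub[OF rhom_from_sub[OF DH(1) ev]]) (simp add: J_def)
    have imJ: "(\<lambda>u. u s) ` carrier ?H = carrier ?J" by (simp add: J_def)
    obtain \<sigma> where \<sigma>: "\<sigma> \<in> rhom R ?J ?H" "\<forall>x\<in>carrier ?J. \<sigma> x s = x"
      using projective_mod_lift[OF projJ fgH fgJ evH imJ rhom_id] by (rule bexE)
    define H' where "H' = {u \<in> H. u s = \<zero>\<^bsub>R\<^esub>}"
    have H'S: "H' \<subseteq> carrier (free_mod R S)"
      using DH(1) by (auto simp: H'_def free_mod_simps)
    interpret R: ring R by (rule ring_R)
    have subH': "submodule H' R (free_mod R S)"
    proof (rule right_module.submodI[OF rm_free_mod H'S])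
      show "\<zero>\<^bsub>free_mod R S\<^esub> \<in> H'" using DH(2) by (simp add: H'_def free_mod_simps)
      show "x \<oplus>\<^bsub>free_mod R S\<^esub> y \<in> H'" if "x \<in> H'" "y \<in> H'" for x y
        using that DH(3)[of x y] by (simp add: H'_def free_mod_simps)
      show "a \<odot>\<^bsub>free_mod R S\<^esub> x \<in> H'" if "a \<in> carrier R" "x \<in> H'" for a x
        using that DH(4)[of a x] by (simp add: H'_def free_mod_simps)
    qed
    have eqH': "(free_mod R S)\<lparr>carrier := H'\<rparr> = ?F\<lparr>carrier := H'\<rparr>" by (rule free_mod_update)
    have hH': "h \<in> rhom R ((free_mod R S)\<lparr>carrier := H'\<rparr>) B"
      using rhom_from_sub[of H' ?H h R B] insert.prems(2) unfolding eqH' by (simp add: H'_def)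
    obtain l1 where l1: "l1 \<in> rhom R ((free_mod R S)\<lparr>carrier := H'\<rparr>) A" "\<forall>x\<in>H'. p (l1 x) = h x"
      using insert.IH[OF subH' hH'] by (rule bexE)
    obtain l2 where l2: "l2 \<in> rhom R ?J A" "\<forall>x\<in>carrier ?J. p (l2 x) = h (\<sigma> x)"
      using projective_mod_lift[OF projJ A B p rhom_comp[OF \<sigma>(1) insert.prems(2)]] by (rule bexE)
    let ?r = "\<lambda>u. u \<ominus>\<^bsub>?H\<^esub> \<sigma> (u s)"
    interpret H: right_module R ?H by (rule rH)
    have r: "?r \<in> rhom R ?H ?H" by (rule rhom_minus[OF rH rhom_id rhom_comp[OF evH \<sigma>(1)]])
    have rs: "?r u s = \<zero>\<^bsub>R\<^esub>" if u: "u \<in> H" for u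
    proof -
      have \<sigma>u: "\<sigma> (u s) \<in> H" using rhom_closed[OF \<sigma>(1), of "u s"] u by (auto simp: J_def)
      have us: "u s \<in> J" "u s \<in> carrier R" using u DH(1) by (auto simp: J_def free_mod_simps)
      have "?r u \<oplus>\<^bsub>?H\<^esub> \<sigma> (u s) = u" by (rule H.M.add_diff_cancel(2)) (use u \<sigma>u in simp_all)
      then have "(?r u \<oplus>\<^bsub>?H\<^esub> \<sigma> (u s)) s = u s" by (rule fun_cong)
      then have "?r u s \<oplus>\<^bsub>R\<^esub> \<sigma> (u s) s = u s" by (simp add: free_mod_simps(3))
      moreover have "?r u s \<in> carrier R"
        using rhom_closed[OF r, of u] u DH(1) by (auto simp: free_mod_simps)
      moreover have "\<sigma> (u s) s = u s" using \<sigma>(2) us(1) by simp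
      ultimately show ?thesis
        using us(2) abelian_group.diff_eq_iff[OF ring.is_abelian_group[OF ring_R], of "u s" "u s" "?r u s"]
          abelian_group.r_neg[OF ring.is_abelian_group[OF ring_R] us(2)] by (simp add: a_minus_def)
    qed
    have r': "?r \<in> rhom R ?H ((free_mod R S)\<lparr>carrier := H'\<rparr>)"
      using rhom_into_sub[OF r, of H'] rs rhom_closed[OF r] unfolding eqH' by (simp add: H'_def)
    let ?l = "\<lambda>u. l1 (?r u) \<oplus>\<^bsub>A\<^esub> l2 (u s)"
    have l: "?l \<in> rhom R ?H A" by (rule rhom_plus[OF rA rhom_comp[OF r' l1(1)] rhom_comp[OF evH l2(1)]])
    have "p (?l u) = h u" if u: "u \<in> H" for u
    proof -
      have \<sigma>u: "\<sigma> (u s) \<in> H" "u s \<in> J" using rhom_closed[OF \<sigma>(1), of "u s"] u by (auto simp: J_def)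
      have ru: "?r u \<in> H'" using rhom_closed[OF r', of u] u by simp
      have "p (?l u) = p (l1 (?r u)) \<oplus>\<^bsub>B\<^esub> p (l2 (u s))"
        using rhom_closed[OF l1(1)] rhom_closed[OF l2(1)] ru \<sigma>u by (intro rhom_add[OF p(1)]) simp_all
      also have "\<dots> = h (?r u) \<oplus>\<^bsub>B\<^esub> h (\<sigma> (u s))" using l1(2) l2(2) ru \<sigma>u by simp
      also have "\<dots> = h (?r u \<oplus>\<^bsub>?H\<^esub> \<sigma> (u s))"
        using ru \<sigma>u by (intro rhom_add[OF insert.prems(2), symmetric]) (simp_all add: H'_def)
      also have "?r u \<oplus>\<^bsub>?H\<^esub> \<sigma> (u s) = u" by (rule H.M.add_diff_cancel(2)) (use u \<sigma>u in simp_all)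
      finally show ?thesis .
    qed
    then have "\<forall>u\<in>H. p (?l u) = h u" by (rule ballI)
    then show ?case by (rule bexI[where x = ?l]) (rule l)
  }
qed

text \<open>Right exactness of \<open>Ext\<^sup>1\<close> in both arguments; in the second one, a map from the syzygy to \<open>N'\<close>
  lifts to \<open>N\<close> as the syzygy of a finite free cover is projective.\<close>

lemma ext_zero_surj:
  fixes M :: "('r, 'm) module"
  assumes M: "fg_mod R M" and N: "fg_mod R N" and N': "fg_mod R N'"
    and q: "q \<in> rhom R N N'" "q ` carrier N = carrier N'" and ez: "ext_zero R M N"
  shows "ext_zero R M N'"
proof -
  note rM = fg_modD(1)[OF M] and rN = fg_modD(1)[OF N] and rN' = fg_modD(1)[OF N']
  obtain S :: "'m set" and p where S: "finite S" "p \<in> rhom R (free_mod R S) M" "p ` carrier (free_mod R S) = carrier M"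
    by (rule fg_mod_free_presentation[OF ring_R M]) (rule that)
  note rF = rm_free_mod[of S]
  let ?H = "{x \<in> carrier (free_mod R S). p x = \<zero>\<^bsub>M\<^esub>}"
  let ?K = "(free_mod R S)\<lparr>carrier := ?H\<rparr>"
  note ex = short_exact_kernel[OF rF rM S(2,3)]
  have subH: "submodule ?H R (free_mod R S)" by (rule submodule_kernel[OF rF rM S(2)])
  note rK = right_module_sub[OF rF subH]
  show ?thesis
  proof (rule ext_zero_if_extend[OF ex ext_zero_free_mod[OF ring_R rN'] rK rF rM rN'])
    fix h assume h: "h \<in> rhom R ?K N'"
    obtain l where l: "l \<in> rhom R ?K N" "\<forall>x\<in>?H. q (l x) = h x"
      using submodule_free_lift[OF S(1) subH N N' q h] by (rule bexE)
    obtain e where e: "e \<in> rhom R (free_mod R S) N" "\<forall>a\<in>carrier ?K. e a = l a"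
      using ext_zero_extend[OF ez ex rK rF rM rN l(1)] by (rule bexE)
    show "\<exists>h'\<in>rhom R (free_mod R S) N'. \<forall>a\<in>carrier ?K. h' a = h a"
      by (rule bexI[OF _ rhom_comp[OF e(1) q(1)]]) (use e(2) l(2) in simp)
  qed
qed

text \<open>The preimage of \<open>A\<close> in a free cover of \<open>B\<close> is projective and covers \<open>A\<close> with the same kernel, so
  maps from the kernel extend to it by restriction.\<close>

lemma ext_zero_sub:
  fixes B :: "('r, 'b) module"
  assumes A: "fg_mod R A" and B: "fg_mod R B" and N: "right_module R N"
    and f: "f \<in> rhom R A B" "inj_on f (carrier A)" and ez: "ext_zero R B N"
  shows "ext_zero R A N"
proof -
  note rA = fg_modD(1)[OF A] and rB = fg_modD(1)[OF B]
  obtain S :: "'b set" and p where S: "finite S" "p \<in> rhom R (free_mod R S) B" "p ` carrier (free_mod R S) = carrier B"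
    by (rule fg_mod_free_presentation[OF ring_R B]) (rule that)
  note rF = rm_free_mod[of S]
  let ?H = "{x \<in> carrier (free_mod R S). p x \<in> f ` carrier A}"
  let ?Q = "(free_mod R S)\<lparr>carrier := ?H\<rparr>"
  have subH: "submodule ?H R (free_mod R S)"
    by (rule submodule_vimage[OF rF rB S(2) submodule_image[OF rA rB f(1) right_module.submodule_carrier[OF rA]]])
  note rQ = right_module_sub[OF rF subH]
  have fgQ: "fg_mod R ?Q" by (rule fg_mod_submodule[OF artin fg_mod_free_mod[OF ring_R S(1)] subH])
  have pQ: "p \<in> rhom R ?Q B" by (rule rhom_from_sub[OF _ S(2)]) blast
  have "p q \<in> f ` carrier A" if "q \<in> carrier ?Q" for q using that by simp
  then obtain p' where p': "p' \<in> rhom R ?Q A" "\<forall>x\<in>carrier ?Q. f (p' x) = p x"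
    using factor_through_inj[OF rA rQ f pQ] by blast
  have surj: "p' ` carrier ?Q = carrier A"
  proof (intro equalityI subsetI)
    fix a assume a: "a \<in> carrier A"
    obtain u where u: "u \<in> carrier (free_mod R S)" "p u = f a" using S(3) rhom_closed[OF f(1) a] by (metis imageE)
    have "f (p' u) = f a" using p'(2) u a by simp
    then have "p' u = a" using u a rhom_closed[OF p'(1), of u] by (intro inj_onD[OF f(2)]) auto
    then show "a \<in> p' ` carrier ?Q" using u a by auto
  qed (use rhom_closed[OF p'(1)] in blast)
  have p'0: "p' x = \<zero>\<^bsub>A\<^esub> \<longleftrightarrow> p x = \<zero>\<^bsub>B\<^esub>" if "x \<in> carrier ?Q" for x
  proof
    show "p x = \<zero>\<^bsub>B\<^esub>" if "p' x = \<zero>\<^bsub>A\<^esub>"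
      using bspec[OF p'(2) \<open>x \<in> _\<close>] that rhom_zero[OF f(1) rA rB] by simp
    assume "p x = \<zero>\<^bsub>B\<^esub>"
    then have "f (p' x) = \<zero>\<^bsub>B\<^esub>" using bspec[OF p'(2) that] by simp
    then show "p' x = \<zero>\<^bsub>A\<^esub>"
      using f(2) rhom_closed[OF p'(1) that] unfolding rhom_inj_iff[OF rA rB f(1)] by blast
  qed
  let ?Z = "{x \<in> carrier ?Q. p' x = \<zero>\<^bsub>A\<^esub>}"
  let ?K = "?Q\<lparr>carrier := ?Z\<rparr>"
  note ex = short_exact_kernel[OF rQ rA p'(1) surj]
  have Zeq: "?Z = {x \<in> carrier (free_mod R S). p x = \<zero>\<^bsub>B\<^esub>}"
  proof -
    have "\<zero>\<^bsub>B\<^esub> \<in> f ` carrier A"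
      using right_module.submodD(2)[OF rB submodule_image[OF rA rB f(1) right_module.submodule_carrier[OF rA]]] .
    then show ?thesis using p'0 by auto
  qed
  have Keq: "?K = (free_mod R S)\<lparr>carrier := {x \<in> carrier (free_mod R S). p x = \<zero>\<^bsub>B\<^esub>}\<rparr>"
    unfolding Zeq by simp
  note exB = short_exact_kernel[OF rF rB S(2,3), folded Keq]
  have rK: "right_module R ?K"
    unfolding Keq by (rule right_module_sub[OF rF submodule_kernel[OF rF rB S(2)]])
  have projQ: "ext_zero R ?Q N"
  proof -
    obtain T :: "('b \<Rightarrow> 'r) set" and t where T: "finite T" "t \<in> rhom R (free_mod R T) ?Q" "t ` carrier (free_mod R T) = carrier ?Q"
      by (rule fg_mod_free_presentation[OF ring_R fgQ]) (rule that)
    obtain s where s: "s \<in> rhom R ?Q (free_mod R T)" "\<forall>x\<in>?H. t (s x) = x"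
      using submodule_free_lift[OF S(1) subH fg_mod_free_mod[OF ring_R T(1)] fgQ T(2,3) rhom_id] by (rule bexE)
    obtain l where l: "l \<in> rhom R (free_mod R T) (free_mod R (carrier ?Q))"
      "\<forall>u\<in>carrier (free_mod R T). free_cover R ?Q (l u) = t u"
      using free_mod_lift[OF ring_R rm_free_mod rQ rhom_free_cover[OF ring_R rQ] T(2)] by (rule bexE)
    show ?thesis
      by (rule ext_zero_section[OF rQ N rhom_comp[OF s(1) l(1)]]) (use s l rhom_closed[OF s(1)] in simp)
  qed
  show ?thesis
  proof (rule ext_zero_if_extend[OF ex projQ rK rQ rA N])
    fix h assume h: "h \<in> rhom R ?K N"
    obtain e where e: "e \<in> rhom R (free_mod R S) N" "\<forall>a\<in>carrier ?K. e a = h a"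
      using ext_zero_extend[OF ez exB rK rF rB N h] by (rule bexE)
    show "\<exists>h'\<in>rhom R ?Q N. \<forall>a\<in>carrier ?K. h' a = h a"
    proof (rule bexI[where x = e])
      show "e \<in> rhom R ?Q N" by (rule rhom_from_sub[OF _ e(1)]) blast
    qed (rule e(2))
  qed
qed

end

section \<open>Additive closures\<close>

text \<open>The homomorphisms that are finite sums of maps \<open>A \<rightarrow> I \<rightarrow> B\<close>.  They form an ideal, and a
  module lies in \<open>add I\<close> iff its identity is one of them.  So membership in \<open>add I\<close> is shown by
  writing down maps, and complements never have to be identified.\<close>

inductive factors :: "'r ring \<Rightarrow> ('r, 'i) module \<Rightarrow> ('r, 'a) module \<Rightarrow> ('r, 'b) module \<Rightarrow> ('a \<Rightarrow> 'b) \<Rightarrow> bool"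
  for R I A B where
  zero: "(\<And>x. x \<in> carrier A \<Longrightarrow> t x = \<zero>\<^bsub>B\<^esub>) \<Longrightarrow> factors R I A B t"
| step: "factors R I A B s \<Longrightarrow> a \<in> rhom R A I \<Longrightarrow> b \<in> rhom R I B \<Longrightarrow>
    (\<And>x. x \<in> carrier A \<Longrightarrow> t x = s x \<oplus>\<^bsub>B\<^esub> b (a x)) \<Longrightarrow> factors R I A B t"

lemma factors_rhom:
  assumes "factors R I A B t" and A: "right_module R A" and B: "right_module R B"
  shows "t \<in> rhom R A B"
  using assms(1)
proof induction
  case (zero t)
  show ?case by (rule rhom_cong[OF rhom_zero_map[OF B] A]) (rule zero)
next
  case (step s a b t)
  show ?case by (rule rhom_cong[OF rhom_plus[OF B step.IH rhom_comp[OF step.hyps(2,3)]] A]) (rule step)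
qed

lemma factors_cong:
  assumes "factors R I A B s" "\<And>x. x \<in> carrier A \<Longrightarrow> t x = s x"
  shows "factors R I A B t"
  using assms(1)
proof cases
  case zero
  show ?thesis by (rule factors.zero) (simp add: assms(2) zero)
next
  case (step s' a b)
  show ?thesis by (rule factors.step[OF step(1-3)]) (simp add: assms(2) step(4))
qed

lemma factors_plus:
  assumes "factors R I A B t" and s: "factors R I A B s" and A: "right_module R A" and B: "right_module R B"
  shows "factors R I A B (\<lambda>x. s x \<oplus>\<^bsub>B\<^esub> t x)"
  using assms(1)
proof induction
  interpret B: right_module R B by fact
  note sc = rhom_closed[OF factors_rhom[OF s A B]]
  {
    case (zero t)
    show ?case by (rule factors_cong[OF s]) (simp add: zero sc)
  next
    case (step t' a b t)
    note tc = rhom_closed[OF factors_rhom[OF step.hyps(1) A B]]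
    show ?case
      by (rule factors.step[OF step.IH step.hyps(2,3)])
        (simp add: step.hyps(4) sc tc rhom_closed[OF step.hyps(2)] rhom_closed[OF step.hyps(3)] B.a_assoc)
  }
qed

lemma factors_comp:
  assumes "factors R I A B t" and A: "right_module R A" and B: "right_module R B" and B': "right_module R B'"
    and g: "g \<in> rhom R A' A" and h: "h \<in> rhom R B B'"
  shows "factors R I A' B' (\<lambda>x. h (t (g x)))"
  using assms(1)
proof induction
  case (zero t)
  show ?case by (rule factors.zero) (simp add: zero rhom_closed[OF g] rhom_zero[OF h B B'])
next
  case (step s a b t)
  note sc = rhom_closed[OF factors_rhom[OF step.hyps(1) A B]]
  show ?case
    by (rule factors.step[OF step.IH rhom_comp[OF g step.hyps(2)] rhom_comp[OF step.hyps(3) h]])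
      (simp add: step.hyps(4) sc rhom_closed[OF g] rhom_closed[OF step.hyps(2)] rhom_closed[OF step.hyps(3)] rhom_add[OF h])
qed

lemma factors_single:
  assumes B: "right_module R B" and a: "a \<in> rhom R A I" and b: "b \<in> rhom R I B"
  shows "factors R I A B (\<lambda>x. b (a x))"
proof -
  interpret B: right_module R B by fact
  have z: "factors R I A B (\<lambda>x. \<zero>\<^bsub>B\<^esub>)" by (rule factors.zero) simp
  show ?thesis
    by (rule factors.step[OF z a b]) (simp add: rhom_closed[OF a] rhom_closed[OF b])
qed

lemma factors_trans:
  assumes "factors R I A B t" and J: "factors R J I I (\<lambda>x. x)"
    and A: "right_module R A" and B: "right_module R B" and I: "right_module R I"
  shows "factors R J A B t"
  using assms(1)
proof induction
  case (zero t)
  show ?case by (rule factors.zero) (rule zero)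
next
  case (step s a b t)
  have "factors R J A B (\<lambda>x. s x \<oplus>\<^bsub>B\<^esub> b (a x))"
    by (rule factors_plus[OF _ step.IH A B]) (rule factors_comp[OF J I I B step.hyps(2,3)])
  then show ?case by (rule factors_cong) (rule step)
qed

lemma factors_pow:
  assumes I: "right_module R I"
  shows "factors R I (finite_mod_sum n (\<lambda>_. I)) (finite_mod_sum n (\<lambda>_. I)) (\<lambda>x. x)"
proof -
  let ?P = "finite_mod_sum n (\<lambda>_. I)"
  interpret I: right_module R I by fact
  have rP: "right_module R ?P" by (rule right_module_finite_mod_sum[OF I.R.ring_axioms I])
  have "factors R I ?P ?P (\<lambda>u. \<lambda>i\<in>{..<n}. if i < k then u i else \<zero>\<^bsub>I\<^esub>)" if "k \<le> n" for k
    using that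
  proof (induction k)
    case 0
    show ?case by (rule factors.zero) (simp add: restrict_def)
  next
    case (Suc k)
    then have k: "k < n" by simp
    note IH = Suc.IH[OF Suc_leD[OF Suc.prems]]
    show ?case
    proof (rule factors.step[OF IH rhom_proj[OF k] rhom_inj_summand[OF k I]])
      fix u assume u: "u \<in> carrier ?P"
      note ui = finite_mod_sum_mem[OF u]
      show "(\<lambda>i\<in>{..<n}. if i < Suc k then u i else \<zero>\<^bsub>I\<^esub>) =
        (\<lambda>i\<in>{..<n}. if i < k then u i else \<zero>\<^bsub>I\<^esub>) \<oplus>\<^bsub>?P\<^esub> (\<lambda>j\<in>{..<n}. if j = k then u k else \<zero>\<^bsub>I\<^esub>)"
      proof (rule finite_mod_sum_ext[where n = n and N = "\<lambda>_. I"])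
        show "(\<lambda>i\<in>{..<n}. if i < Suc k then u i else \<zero>\<^bsub>I\<^esub>) \<in> carrier ?P" using ui by simp
        show "(\<lambda>i\<in>{..<n}. if i < k then u i else \<zero>\<^bsub>I\<^esub>) \<oplus>\<^bsub>?P\<^esub> (\<lambda>j\<in>{..<n}. if j = k then u k else \<zero>\<^bsub>I\<^esub>) \<in> carrier ?P"
          using ui by simp
        show "(\<lambda>i\<in>{..<n}. if i < Suc k then u i else \<zero>\<^bsub>I\<^esub>) i =
          ((\<lambda>i\<in>{..<n}. if i < k then u i else \<zero>\<^bsub>I\<^esub>) \<oplus>\<^bsub>?P\<^esub> (\<lambda>j\<in>{..<n}. if j = k then u k else \<zero>\<^bsub>I\<^esub>)) i"
          if "i < n" for i
          using ui[OF that] that by (cases i k rule: linorder_cases) simp_all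
      qed
    qed
  qed
  then have "factors R I ?P ?P (\<lambda>u. \<lambda>i\<in>{..<n}. if i < n then u i else \<zero>\<^bsub>I\<^esub>)" by simp
  then show ?thesis
  proof (rule factors_cong)
    fix u assume u: "u \<in> carrier ?P"
    show "u = (\<lambda>i\<in>{..<n}. if i < n then u i else \<zero>\<^bsub>I\<^esub>)"
      by (rule finite_mod_sum_ext[OF u]) (use finite_mod_sum_mem[OF u] in auto)
  qed
qed

lemma factors_through_pow:
  assumes "factors R I A B t" and A: "right_module R A" and B: "right_module R B" and I: "right_module R I"
  shows "\<exists>n. \<exists>a\<in>rhom R A (finite_mod_sum n (\<lambda>_. I)). \<exists>b\<in>rhom R (finite_mod_sum n (\<lambda>_. I)) B.
    \<forall>x\<in>carrier A. b (a x) = t x"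
  using assms(1)
proof induction
  interpret I: right_module R I by fact
  interpret A: right_module R A by fact
  have rP: "right_module R (finite_mod_sum n (\<lambda>_. I))" for n
    by (rule right_module_finite_mod_sum[OF I.R.ring_axioms I])
  {
    case (zero t)
    show ?case
      by (intro exI[of _ 0] bexI[OF _ rhom_zero_map[OF rP]] bexI[OF _ rhom_zero_map[OF B]]) (simp add: zero)
  next
    case (step s a b t)
    obtain n a' b' where a': "a' \<in> rhom R A (finite_mod_sum n (\<lambda>_. I))"
      and b': "b' \<in> rhom R (finite_mod_sum n (\<lambda>_. I)) B" and s: "\<forall>x\<in>carrier A. b' (a' x) = s x"
      using step.IH by blast
    let ?P = "finite_mod_sum (Suc n) (\<lambda>_. I)"
    let ?a = "\<lambda>x. \<lambda>i\<in>{..<Suc n}. if i < n then fst (a' x, a x) i else snd (a' x, a x)"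
    have ra: "?a \<in> rhom R A ?P"
      by (rule rhom_comp[OF rhom_pair[OF a' step.hyps(2)] rhom_snoc])
    have res: "(\<lambda>u. restrict u {..<n}) \<in> rhom R ?P (finite_mod_sum n (\<lambda>_. I))"
      using rhom_tuple[where n = n and N = "\<lambda>_. I" and L = ?P and a = "\<lambda>i u. u i"]
        rhom_proj[where n = "Suc n" and N = "\<lambda>_. I"] by simp
    let ?b = "\<lambda>u. b' (restrict u {..<n}) \<oplus>\<^bsub>B\<^esub> b (u n)"
    have rb: "?b \<in> rhom R ?P B"
      by (rule rhom_plus[OF B rhom_comp[OF res b'] rhom_comp[OF rhom_proj[where N = "\<lambda>_. I"] step.hyps(3)]]) simp
    have "?b (?a x) = t x" if x: "x \<in> carrier A" for x
    proof -
      have "restrict (?a x) {..<n} = a' x"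
        by (rule finite_mod_sum_ext[OF _ rhom_closed[OF a' x]])
          (use rhom_closed[OF res rhom_closed[OF ra x]] in simp_all)
      moreover have "?a x n = a x" by simp
      ultimately show ?thesis using s x step.hyps(4)[OF x] by simp
    qed
    then have "\<forall>x\<in>carrier A. ?b (?a x) = t x" by (rule ballI)
    then have "\<exists>b\<in>rhom R ?P B. \<forall>x\<in>carrier A. b (?a x) = t x" by (rule bexI[where x = ?b]) (rule rb)
    then have "\<exists>a\<in>rhom R A ?P. \<exists>b\<in>rhom R ?P B. \<forall>x\<in>carrier A. b (a x) = t x"
      by (rule bexI[where x = ?a]) (rule ra)
    then show ?case by (rule exI[where x = "Suc n"])
  }
qed

lemma fg_mod_retract:
  assumes M: "fg_mod R M" and N: "right_module R N" and a: "a \<in> rhom R N M" and b: "b \<in> rhom R M N"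
    and ba: "\<And>x. x \<in> carrier N \<Longrightarrow> b (a x) = x"
  shows "fg_mod R N"
proof (rule fg_mod_image[OF M N b])
  show "b ` carrier M = carrier N"
    using rhom_closed[OF b] rhom_closed[OF a] ba by (metis (no_types, lifting) image_subset_iff image_eqI subsetI subset_antisym)
qed

lemma retract_complement:
  assumes P: "fg_mod R P" and N: "right_module R N" and a: "a \<in> rhom R N P" and b: "b \<in> rhom R P N"
    and ba: "\<And>x. x \<in> carrier N \<Longrightarrow> b (a x) = x"
  defines "L \<equiv> P\<lparr>carrier := {x \<in> carrier P. b x = \<zero>\<^bsub>N\<^esub>}\<rparr>"
  shows "fg_mod R L" and "mod_iso R (mod_sum N L) P"
proof -
  note rP = fg_modD(1)[OF P]
  interpret P: right_module R P by (rule rP)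
  interpret N: right_module R N by (rule N)
  have subL: "submodule {x \<in> carrier P. b x = \<zero>\<^bsub>N\<^esub>} R P" by (rule submodule_kernel[OF rP N b])
  have rL: "right_module R L" unfolding L_def by (rule right_module_sub[OF rP subL])
  let ?c = "\<lambda>x. x \<ominus>\<^bsub>P\<^esub> a (b x)"
  have c: "?c \<in> rhom R P L" unfolding L_def
  proof (rule rhom_into_sub[OF rhom_minus[OF rP rhom_id rhom_comp[OF b a]]])
    fix x assume x: "x \<in> carrier P"
    show "?c x \<in> {x \<in> carrier P. b x = \<zero>\<^bsub>N\<^esub>}"
      using x rhom_closed[OF b x] rhom_closed[OF a rhom_closed[OF b x]]
      by (simp add: rhom_diff[OF b rP N] ba N.minus_eq N.r_neg)
  qed
  have cL: "?c x = x" if "x \<in> carrier L" for x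
    using that rhom_zero[OF a N rP] by (simp add: L_def)
  show "fg_mod R L"
    by (rule fg_mod_retract[OF P rL _ c cL]) (simp_all add: L_def rhom_from_sub subset_iff)
  have iL: "(\<lambda>x. x) \<in> rhom R L P" unfolding L_def by (rule rhom_from_sub) auto
  show "mod_iso R (mod_sum N L) P"
  proof (rule mod_isoI)
    show "(\<lambda>z. a (fst z) \<oplus>\<^bsub>P\<^esub> snd z) \<in> rhom R (mod_sum N L) P"
      using rhom_copair[OF rP a iL] .
    show "(\<lambda>x. (b x, ?c x)) \<in> rhom R P (mod_sum N L)" by (rule rhom_pair[OF b c])
    fix z assume z: "z \<in> carrier (mod_sum N L)"
    obtain x y where xy: "z = (x, y)" "x \<in> carrier N" "y \<in> carrier P" "b y = \<zero>\<^bsub>N\<^esub>"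
      using z by (auto simp: L_def)
    note ax = rhom_closed[OF a xy(2)]
    have "b (a x \<oplus>\<^bsub>P\<^esub> y) = x" using xy ax by (simp add: rhom_add[OF b] ba)
    then show "(b (a (fst z) \<oplus>\<^bsub>P\<^esub> snd z), ?c (a (fst z) \<oplus>\<^bsub>P\<^esub> snd z)) = z"
      using xy ax by (simp add: P.add_diff_cancel)
  next
    fix y assume y: "y \<in> carrier P"
    show "a (fst (b y, ?c y)) \<oplus>\<^bsub>P\<^esub> snd (b y, ?c y) = y"
      using y rhom_closed[OF a rhom_closed[OF b y]] by (simp add: P.add_diff_cancel)
  qed
qed

lemma in_add_iff_factors:
  assumes I: "fg_mod R I"
  shows "in_add R I N \<longleftrightarrow> right_module R N \<and> factors R I N N (\<lambda>x. x)"
proof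
  note rI = fg_modD(1)[OF I]
  assume "in_add R I N"
  then obtain n and N' :: "'a umod" where N: "fg_mod R N" and N': "fg_mod R N'"
    and iso: "mod_iso R (mod_sum N N') (finite_mod_sum n (\<lambda>_. I))"
    by (auto simp: in_add_def)
  note rN = fg_modD(1)[OF N] and rN' = fg_modD(1)[OF N']
  let ?P = "finite_mod_sum n (\<lambda>_. I)"
  have rP: "right_module R ?P" by (rule fg_modD(1)[OF fg_mod_pow[OF I]])
  obtain h g where hg: "h \<in> rhom R (mod_sum N N') ?P" "g \<in> rhom R ?P (mod_sum N N')"
    "\<And>x. x \<in> carrier (mod_sum N N') \<Longrightarrow> g (h x) = x"
    by (rule mod_isoE[OF iso right_module_mod_sum[OF rN rN']]) (rule that)
  interpret N': right_module R N' by (rule rN')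
  have "factors R I N N (\<lambda>x. fst (g (h (x, \<zero>\<^bsub>N'\<^esub>))))"
    by (rule factors_comp[OF factors_pow[OF rI] rP rP rN rhom_comp[OF rhom_inl[OF rN'] hg(1)] rhom_comp[OF hg(2) rhom_fst]])
  then have "factors R I N N (\<lambda>x. x)" by (rule factors_cong) (simp add: hg(3))
  then show "right_module R N \<and> factors R I N N (\<lambda>x. x)" using rN by blast
next
  note rI = fg_modD(1)[OF I]
  assume *: "right_module R N \<and> factors R I N N (\<lambda>x. x)"
  then have rN: "right_module R N" and f: "factors R I N N (\<lambda>x. x)" by auto
  obtain n a b where ab: "a \<in> rhom R N (finite_mod_sum n (\<lambda>_. I))" "b \<in> rhom R (finite_mod_sum n (\<lambda>_. I)) N"
    "\<forall>x\<in>carrier N. b (a x) = x"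
    using factors_through_pow[OF f rN rN rI] by blast
  let ?P = "finite_mod_sum n (\<lambda>_. I)"
  note fgP = fg_mod_pow[OF I, of n]
  have ba: "b (a x) = x" if "x \<in> carrier N" for x using ab(3) that by blast
  define L where "L = ?P\<lparr>carrier := {x \<in> carrier ?P. b x = \<zero>\<^bsub>N\<^esub>}\<rparr>"
  note C = retract_complement[OF fgP rN ab(1,2), OF ba, folded L_def]
  obtain N' :: "'a umod" where N': "fg_mod R N'" "mod_iso R L N'" using fg_mod_representative[OF C(1)] by blast
  have "mod_iso R (mod_sum N N') (mod_sum N L)"
    by (rule mod_sum_iso[OF mod_iso_refl mod_iso_sym[OF N'(2) fg_modD(1)[OF C(1)]] rN fg_modD(1)[OF N'(1)]])
  then have "mod_iso R (mod_sum N N') ?P" using C(2) by (rule mod_iso_trans)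
  moreover have "fg_mod R N" by (rule fg_mod_retract[OF fgP rN ab(1,2), OF ba])
  ultimately show "in_add R I N" unfolding in_add_def using N'(1) by blast
qed

lemma in_addD: 
  assumes "in_add R I N" shows "fg_mod R N" "right_module R N"
  using assms by (auto simp: in_add_def fg_mod_def)

lemma in_add_pow_retract:
  assumes I: "fg_mod R I" and N: "in_add R I N"
  obtains n a b where "a \<in> rhom R N (finite_mod_sum n (\<lambda>_. I))" "b \<in> rhom R (finite_mod_sum n (\<lambda>_. I)) N"
    "\<And>x. x \<in> carrier N \<Longrightarrow> b (a x) = x"
proof -
  have f: "factors R I N N (\<lambda>x. x)" using N in_add_iff_factors[OF I] by blast
  obtain n a b where "a \<in> rhom R N (finite_mod_sum n (\<lambda>_. I))" "b \<in> rhom R (finite_mod_sum n (\<lambda>_. I)) N"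
    "\<forall>x\<in>carrier N. b (a x) = x"
    using factors_through_pow[OF f in_addD(2)[OF N] in_addD(2)[OF N] fg_modD(1)[OF I]] by blast
  then show thesis by (intro that[of a n b]) auto
qed

lemma in_add_trans:
  assumes J: "fg_mod R J" and I: "in_add R J I" and N: "in_add R I N"
  shows "in_add R J N"
  using assms factors_trans[of R I N N "\<lambda>x. x" J] in_addD(1)[OF I] in_addD(2)[OF I]
  by (simp add: in_add_iff_factors)

lemma in_add_retract:
  assumes I: "fg_mod R I" and M: "in_add R I M" and N: "right_module R N"
    and a: "a \<in> rhom R N M" and b: "b \<in> rhom R M N" and ba: "\<And>x. x \<in> carrier N \<Longrightarrow> b (a x) = x"
  shows "in_add R I N"
proof -
  have f: "factors R I M M (\<lambda>x. x)" using M in_add_iff_factors[OF I] by blast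
  note rM = in_addD(2)[OF M]
  have "factors R I N N (\<lambda>x. b (a x))" by (rule factors_comp[OF f rM rM N a b])
  then have "factors R I N N (\<lambda>x. x)" by (rule factors_cong) (simp add: ba)
  then show ?thesis using N in_add_iff_factors[OF I] by blast
qed

lemma in_add_self:
  assumes I: "fg_mod R I" shows "in_add R I I"
  using factors_single[OF fg_modD(1)[OF I] rhom_id rhom_id] fg_modD(1)[OF I] by (simp add: in_add_iff_factors[OF I])

lemma in_add_iso:
  assumes I: "fg_mod R I" and M: "in_add R I M" and N: "mod_iso R M N" "right_module R N"
  shows "in_add R I N"
proof -
  obtain h g where "h \<in> rhom R M N" "g \<in> rhom R N M" "\<And>y. y \<in> carrier N \<Longrightarrow> h (g y) = y"
    by (rule mod_isoE[OF N(1) in_addD(2)[OF M]]) (rule that)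
  then show ?thesis by (intro in_add_retract[OF I M N(2), of g h])
qed

lemma factors_mod_sum:
  assumes A: "right_module R A" and B: "right_module R B"
    and fA: "factors R I A A (\<lambda>x. x)" and fB: "factors R I B B (\<lambda>x. x)"
  shows "factors R I (mod_sum A B) (mod_sum A B) (\<lambda>x. x)"
proof -
  interpret A: right_module R A by fact
  interpret B: right_module R B by fact
  let ?S = "mod_sum A B"
  note S = right_module_mod_sum[OF A B]
  have 1: "factors R I ?S ?S (\<lambda>z. (fst z, \<zero>\<^bsub>B\<^esub>))"
    by (rule factors_comp[OF fA A A S rhom_fst rhom_inl[OF B]])
  have 2: "factors R I ?S ?S (\<lambda>z. (\<zero>\<^bsub>A\<^esub>, snd z))"
    by (rule factors_comp[OF fB B B S rhom_snd rhom_inr[OF A]])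
  show ?thesis by (rule factors_cong[OF factors_plus[OF 2 1 S S]]) auto
qed

lemma in_add_mod_sum:
  assumes I: "fg_mod R I" and A: "in_add R I A" and B: "in_add R I B"
  shows "in_add R I (mod_sum A B)"
  using factors_mod_sum[of R A B I] right_module_mod_sum[of R A B] A B
  by (simp add: in_add_iff_factors[OF I])

lemma in_add_pow:
  assumes I: "fg_mod R I" and A: "in_add R I A"
  shows "in_add R I (finite_mod_sum n (\<lambda>_. A))"
proof -
  have "in_add R A (finite_mod_sum n (\<lambda>_. A))"
    using factors_pow[OF in_addD(2)[OF A]] fg_modD(1)[OF fg_mod_pow[OF in_addD(1)[OF A]]]
    by (simp add: in_add_iff_factors[OF in_addD(1)[OF A]])
  then show ?thesis by (rule in_add_trans[OF I A])
qed

lemma in_add_summands: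
  assumes A: "fg_mod R A" and B: "fg_mod R B"
  shows "in_add R (mod_sum A B) A" "in_add R (mod_sum A B) B"
proof -
  note AB = fg_mod_sum[OF A B] and rA = fg_modD(1)[OF A] and rB = fg_modD(1)[OF B]
  show "in_add R (mod_sum A B) A"
    by (rule in_add_retract[OF AB in_add_self[OF AB] rA rhom_inl[OF rB] rhom_fst]) simp
  show "in_add R (mod_sum A B) B"
    by (rule in_add_retract[OF AB in_add_self[OF AB] rB rhom_inr[OF rA] rhom_snd]) simp
qed

section \<open>Extensions and additive closures\<close>

text \<open>A class in \<open>Ext\<^sup>1(A, N)\<close>, given by a homomorphism \<open>h\<close> on the syzygy of \<open>A\<close>.  It pulls back
  along the endomorphisms of \<open>A\<close>, additively, and its pullback along \<open>A \<rightarrow> B \<rightarrow> A\<close> comes from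
  \<open>Ext\<^sup>1(B, N)\<close>.  So if these groups vanish for maps \<open>A \<rightarrow> B \<rightarrow> A\<close> that sum up to the identity, the
  class is zero.\<close>

locale ext_class =
  fixes R :: "'r ring" and A :: "('r, 'a) module" and N :: "('r, 'n) module" and h
  assumes A: "right_module R A" and N: "right_module R N" and h: "h \<in> rhom R (syzygy R A) N"
begin

sublocale A: right_module R A by (rule A)
sublocale N: right_module R N by (rule N)

abbreviation (input) "FA \<equiv> free_mod R (carrier A)"

lemma ringR: "ring R" by (rule right_moduleD(2)[OF A])
lemmas rF = right_module_free_mod[OF ringR, of "carrier A"] and rK = right_module_syzygy[OF ringR A]
lemmas cov = rhom_free_cover[OF ringR A]

text \<open>The class vanishes after pullback along \<open>t\<close>, witnessed by a lift of \<open>t\<close> to the free cover.\<close>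

definition kills_ext :: "('a \<Rightarrow> 'a) \<Rightarrow> bool" where
  "kills_ext t \<longleftrightarrow> (\<exists>\<tau>\<in>rhom R FA FA. \<exists>g\<in>rhom R FA N.
     (\<forall>u\<in>carrier FA. free_cover R A (\<tau> u) = t (free_cover R A u)) \<and>
     (\<forall>k\<in>carrier (syzygy R A). g k = h (\<tau> k)))"

lemma syzygy_mem: "k \<in> carrier (syzygy R A) \<longleftrightarrow> k \<in> carrier FA \<and> free_cover R A k = \<zero>\<^bsub>A\<^esub>"
  by (simp add: syzygy_eq[OF ringR])

lemma syzygy_ops: "x \<oplus>\<^bsub>syzygy R A\<^esub> y = x \<oplus>\<^bsub>FA\<^esub> y" "\<zero>\<^bsub>syzygy R A\<^esub> = \<zero>\<^bsub>FA\<^esub>"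
  by (simp_all add: syzygy_eq[OF ringR])

lemma kills_ext_zero:
  assumes "\<And>x. x \<in> carrier A \<Longrightarrow> t x = \<zero>\<^bsub>A\<^esub>" shows "kills_ext t"
  unfolding kills_ext_def
  by (rule bexI[OF _ rhom_zero_map[OF rF]], rule bexI[OF _ rhom_zero_map[OF N]])
    (use assms rhom_zero[OF cov(1) rF A] rhom_closed[OF cov(1)] rhom_zero[OF h rK N] syzygy_ops in simp)

lemma kills_ext_plus:
  assumes s: "kills_ext s" and t: "kills_ext t"
    and r: "\<And>x. x \<in> carrier A \<Longrightarrow> r x = s x \<oplus>\<^bsub>A\<^esub> t x" and t0: "s \<zero>\<^bsub>A\<^esub> = \<zero>\<^bsub>A\<^esub>" "t \<zero>\<^bsub>A\<^esub> = \<zero>\<^bsub>A\<^esub>"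
  shows "kills_ext r"
proof -
  obtain \<tau> g where \<tau>: "\<tau> \<in> rhom R FA FA" "g \<in> rhom R FA N"
    "\<And>u. u \<in> carrier FA \<Longrightarrow> free_cover R A (\<tau> u) = s (free_cover R A u)"
    "\<And>k. k \<in> carrier (syzygy R A) \<Longrightarrow> g k = h (\<tau> k)"
    using s unfolding kills_ext_def by blast
  obtain \<tau>' g' where \<tau>': "\<tau>' \<in> rhom R FA FA" "g' \<in> rhom R FA N"
    "\<And>u. u \<in> carrier FA \<Longrightarrow> free_cover R A (\<tau>' u) = t (free_cover R A u)"
    "\<And>k. k \<in> carrier (syzygy R A) \<Longrightarrow> g' k = h (\<tau>' k)"
    using t unfolding kills_ext_def by blast
  have 1: "free_cover R A (\<tau> u \<oplus>\<^bsub>FA\<^esub> \<tau>' u) = r (free_cover R A u)" if u: "u \<in> carrier FA" for u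
    using rhom_closed[OF \<tau>(1) u] rhom_closed[OF \<tau>'(1) u] \<tau>(3)[OF u] \<tau>'(3)[OF u] r[OF rhom_closed[OF cov(1) u]]
    by (simp add: rhom_add[OF cov(1)])
  have 2: "g k \<oplus>\<^bsub>N\<^esub> g' k = h (\<tau> k \<oplus>\<^bsub>FA\<^esub> \<tau>' k)" if k: "k \<in> carrier (syzygy R A)" for k
  proof -
    have kF: "k \<in> carrier FA" "free_cover R A k = \<zero>\<^bsub>A\<^esub>" using k syzygy_mem by auto
    have "\<tau> k \<in> carrier (syzygy R A)" "\<tau>' k \<in> carrier (syzygy R A)"
      using rhom_closed[OF \<tau>(1) kF(1)] rhom_closed[OF \<tau>'(1) kF(1)] \<tau>(3)[OF kF(1)] \<tau>'(3)[OF kF(1)] kF(2) t0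
      by (simp_all add: syzygy_mem)
    then show ?thesis using \<tau>(4)[OF k] \<tau>'(4)[OF k] rhom_add[OF h, of "\<tau> k" "\<tau>' k"] by (simp add: syzygy_ops)
  qed
  show ?thesis unfolding kills_ext_def
    by (rule bexI[OF _ rhom_plus[OF rF \<tau>(1) \<tau>'(1)]], rule bexI[OF _ rhom_plus[OF N \<tau>(2) \<tau>'(2)]])
      (use 1 2 in simp)
qed

lemma kills_ext_through:
  assumes B: "right_module R B" and a: "a \<in> rhom R A B" and b: "b \<in> rhom R B A" and ez: "ext_zero R B N"
  shows "kills_ext (\<lambda>x. b (a x))"
proof -
  let ?FB = "free_mod R (carrier B)"
  note covB = rhom_free_cover[OF ringR B] and rFB = right_module_free_mod[OF ringR, of "carrier B"]
  obtain \<alpha> where \<alpha>: "\<alpha> \<in> rhom R FA ?FB" "\<forall>u\<in>carrier FA. free_cover R B (\<alpha> u) = a (free_cover R A u)"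
    using free_mod_lift[OF ringR rFB B covB rhom_comp[OF cov(1) a]] by (rule bexE)
  obtain \<beta> where \<beta>: "\<beta> \<in> rhom R ?FB FA" "\<forall>u\<in>carrier ?FB. free_cover R A (\<beta> u) = b (free_cover R B u)"
    using free_mod_lift[OF ringR rF A cov rhom_comp[OF covB(1) b]] by (rule bexE)
  have memB: "k \<in> carrier (syzygy R B) \<longleftrightarrow> k \<in> carrier ?FB \<and> free_cover R B k = \<zero>\<^bsub>B\<^esub>" for k
    by (simp add: syzygy_eq[OF ringR])
  have "\<beta> \<in> rhom R (syzygy R B) FA" by (rule rhom_comp[OF short_exactD(1)[OF syzygy_exact[OF ringR B]] \<beta>(1)])
  then have "\<beta> \<in> rhom R (syzygy R B) (syzygy R A)"
    unfolding syzygy_eq[OF ringR, of A]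
    by (rule rhom_into_sub) (use \<beta>(2) memB rhom_closed[OF \<beta>(1)] rhom_zero[OF b B A] in simp)
  then obtain g where g: "g \<in> rhom R ?FB N" "\<forall>k\<in>carrier (syzygy R B). g k = h (\<beta> k)"
    using bspec[OF ez[unfolded ext_zero_def] rhom_comp[OF _ h]] by blast
  have "\<alpha> k \<in> carrier (syzygy R B)" if "k \<in> carrier (syzygy R A)" for k
    using that \<alpha>(2) rhom_closed[OF \<alpha>(1)] rhom_zero[OF a A B] by (simp add: memB syzygy_mem)
  then show ?thesis unfolding kills_ext_def
    by (intro bexI[OF _ rhom_comp[OF \<alpha>(1) \<beta>(1)]] bexI[OF _ rhom_comp[OF \<alpha>(1) g(1)]])
      (use \<alpha> \<beta> g rhom_closed[OF \<alpha>(1)] in simp)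
qed

lemma kills_ext_id:
  assumes "kills_ext (\<lambda>x. x)"
  shows "\<exists>g\<in>rhom R FA N. \<forall>k\<in>carrier (syzygy R A). g k = h k"
proof -
  obtain \<tau> g where \<tau>: "\<tau> \<in> rhom R FA FA" "g \<in> rhom R FA N"
    "\<And>u. u \<in> carrier FA \<Longrightarrow> free_cover R A (\<tau> u) = free_cover R A u"
    "\<And>k. k \<in> carrier (syzygy R A) \<Longrightarrow> g k = h (\<tau> k)"
    using assms unfolding kills_ext_def by blast
  interpret F: right_module R FA by (rule rF)
  let ?d = "\<lambda>u. \<tau> u \<ominus>\<^bsub>FA\<^esub> u"
  have d: "?d \<in> rhom R FA (syzygy R A)"
    unfolding syzygy_eq[OF ringR]
  proof (rule rhom_into_sub[OF rhom_minus[OF rF \<tau>(1) rhom_id]])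
    fix u assume u: "u \<in> carrier FA"
    show "?d u \<in> {u \<in> carrier FA. free_cover R A u = \<zero>\<^bsub>A\<^esub>}"
      using u rhom_closed[OF \<tau>(1) u] \<tau>(3)[OF u] rhom_closed[OF cov(1) u]
      by (simp add: rhom_diff[OF cov(1) rF A] A.minus_eq A.r_neg)
  qed
  have "g k \<ominus>\<^bsub>N\<^esub> h (?d k) = h k" if k: "k \<in> carrier (syzygy R A)" for k
  proof -
    have kF: "k \<in> carrier FA" using k syzygy_mem by auto
    note dk = rhom_closed[OF d kF]
    have "h (k \<oplus>\<^bsub>syzygy R A\<^esub> ?d k) = h k \<oplus>\<^bsub>N\<^esub> h (?d k)" by (rule rhom_add[OF h k dk])
    moreover have "k \<oplus>\<^bsub>syzygy R A\<^esub> ?d k = \<tau> k"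
      using F.add_diff_cancel(1)[OF kF rhom_closed[OF \<tau>(1) kF]] by (simp add: syzygy_ops)
    ultimately have "g k = h k \<oplus>\<^bsub>N\<^esub> h (?d k)" using \<tau>(4)[OF k] by simp
    then show ?thesis using rhom_closed[OF h k] rhom_closed[OF h dk] by (simp add: N.add_diff_cancel)
  qed
  then have "\<forall>k\<in>carrier (syzygy R A). g k \<ominus>\<^bsub>N\<^esub> h (?d k) = h k" by (rule ballI)
  then show ?thesis by (rule bexI[where x = "\<lambda>k. g k \<ominus>\<^bsub>N\<^esub> h (?d k)"]) (rule rhom_minus[OF N \<tau>(2) rhom_comp[OF d h]])
qed

end

lemma ext_zero_factors_left:
  assumes A: "right_module R A" and I: "right_module R I" and N: "right_module R N"
    and f: "factors R I A A (\<lambda>x. x)" and ez: "ext_zero R I N"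
  shows "ext_zero R A N"
  unfolding ext_zero_def
proof
  fix h assume h: "h \<in> rhom R (syzygy R A) N"
  interpret ext_class R A N h by (rule ext_class.intro[OF A N h])
  have "kills_ext t" if "factors R I A A t" for t
    using that
  proof induction
    case (zero t)
    then show ?case by (rule kills_ext_zero)
  next
    case (step s a b t)
    have "s \<in> rhom R A A" by (rule factors_rhom[OF step.hyps(1) A A])
    then have z: "s \<zero>\<^bsub>A\<^esub> = \<zero>\<^bsub>A\<^esub>" using rhom_zero A by blast
    show ?case
      by (rule kills_ext_plus[OF step.IH kills_ext_through[OF I step.hyps(2,3) ez] step.hyps(4) z
            rhom_zero[OF rhom_comp[OF step.hyps(2,3)] A A]])
  qed
  then show "\<exists>g\<in>rhom R (free_mod R (carrier A)) N. \<forall>k\<in>carrier (syzygy R A). g k = h k"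
    using f by (intro kills_ext_id)
qed

lemma ext_zero_mod_sum_left:
  assumes A: "right_module R A" and B: "right_module R B" and N: "right_module R N"
    and eA: "ext_zero R A N" and eB: "ext_zero R B N"
  shows "ext_zero R (mod_sum A B) N"
  unfolding ext_zero_def
proof
  let ?S = "mod_sum A B"
  note S = right_module_mod_sum[OF A B]
  interpret A: right_module R A by fact
  interpret B: right_module R B by fact
  fix h assume h: "h \<in> rhom R (syzygy R ?S) N"
  interpret S: ext_class R ?S N h by (rule ext_class.intro[OF S N h])
  have 1: "S.kills_ext (\<lambda>z. (fst z, \<zero>\<^bsub>B\<^esub>))"
    by (rule S.kills_ext_through[OF A rhom_fst rhom_inl[OF B] eA])
  have 2: "S.kills_ext (\<lambda>z. (\<zero>\<^bsub>A\<^esub>, snd z))"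
    by (rule S.kills_ext_through[OF B rhom_snd rhom_inr[OF A] eB])
  have "S.kills_ext (\<lambda>z. z)" by (rule S.kills_ext_plus[OF 1 2]) auto
  then show "\<exists>g\<in>rhom R (free_mod R (carrier ?S)) N. \<forall>k\<in>carrier (syzygy R ?S). g k = h k"
    by (rule S.kills_ext_id)
qed

lemma ext_zero_factors_right:
  assumes B: "right_module R B" and I: "right_module R I"
    and f: "factors R I B B (\<lambda>x. x)" and ez: "ext_zero R M I"
  shows "ext_zero R M B"
  unfolding ext_zero_def
proof
  fix h assume h: "h \<in> rhom R (syzygy R M) B"
  have "\<exists>g\<in>rhom R (free_mod R (carrier M)) B. \<forall>k\<in>carrier (syzygy R M). g k = t (h k)" if "factors R I B B t" for t
    using that
  proof induction
    case (zero t)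
    show ?case by (rule bexI[OF _ rhom_zero_map[OF B]]) (use zero rhom_closed[OF h] in simp)
  next
    case (step s a b t)
    obtain g where g: "g \<in> rhom R (free_mod R (carrier M)) B" "\<forall>k\<in>carrier (syzygy R M). g k = s (h k)"
      using step.IH by (rule bexE)
    obtain e where e: "e \<in> rhom R (free_mod R (carrier M)) I" "\<forall>k\<in>carrier (syzygy R M). e k = a (h k)"
      using bspec[OF ez[unfolded ext_zero_def] rhom_comp[OF h step.hyps(2)]] by (rule bexE)
    show ?case
      by (rule bexI[OF _ rhom_plus[OF B g(1) rhom_comp[OF e(1) step.hyps(3)]]])
        (use g(2) e(2) step.hyps(4) rhom_closed[OF h] in simp)
  qed
  from this[OF f] show "\<exists>g\<in>rhom R (free_mod R (carrier M)) B. \<forall>k\<in>carrier (syzygy R M). g k = h k" .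
qed

lemma ext_zero_mod_sum_right:
  assumes eA: "ext_zero R M A" and eB: "ext_zero R M B"
  shows "ext_zero R M (mod_sum A B)"
  unfolding ext_zero_def
proof
  fix h assume h: "h \<in> rhom R (syzygy R M) (mod_sum A B)"
  obtain e where e: "e \<in> rhom R (free_mod R (carrier M)) A" "\<forall>k\<in>carrier (syzygy R M). e k = fst (h k)"
    using bspec[OF eA[unfolded ext_zero_def] rhom_comp[OF h rhom_fst]] by (rule bexE)
  obtain g where g: "g \<in> rhom R (free_mod R (carrier M)) B" "\<forall>k\<in>carrier (syzygy R M). g k = snd (h k)"
    using bspec[OF eB[unfolded ext_zero_def] rhom_comp[OF h rhom_snd]] by (rule bexE)
  show "\<exists>g\<in>rhom R (free_mod R (carrier M)) (mod_sum A B). \<forall>k\<in>carrier (syzygy R M). g k = h k"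
    by (rule bexI[OF _ rhom_pair[OF e(1) g(1)]]) (use e(2) g(2) in simp)
qed

lemma ext_zero_in_add_left:
  assumes "fg_mod R I" "in_add R I A" "right_module R N" "ext_zero R I N"
  shows "ext_zero R A N"
  using assms ext_zero_factors_left[of R A I N] fg_modD(1)[OF assms(1)] by (simp add: in_add_iff_factors)

lemma ext_zero_in_add_right:
  assumes "fg_mod R I" "in_add R I B" "ext_zero R M I"
  shows "ext_zero R M B"
  using assms ext_zero_factors_right[of R B I M] fg_modD(1)[OF assms(1)] by (simp add: in_add_iff_factors)

lemma ext_zero_in_add:
  assumes "fg_mod R I" "in_add R I A" "fg_mod R J" "in_add R J B" "ext_zero R I J"
  shows "ext_zero R A B"
  by (rule ext_zero_in_add_left[OF assms(1,2) in_addD(2)[OF assms(4)]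
        ext_zero_in_add_right[OF assms(3,4,5)]])

section \<open>Exchanging coresolutions and resolutions\<close>

lemma short_exact_iso:
  assumes ex: "short_exact R A f B g C" and A: "mod_iso R A A'" and B: "mod_iso R B B'" and C: "mod_iso R C C'"
    and rm: "right_module R A" "right_module R B" "right_module R C" "right_module R C'"
  shows "\<exists>f' g'. short_exact R A' f' B' g' C'"
proof -
  note D = short_exactD[OF ex]
  obtain a a' where a: "a \<in> rhom R A A'" "a' \<in> rhom R A' A" "\<And>x. x \<in> carrier A \<Longrightarrow> a' (a x) = x"
    "\<And>x. x \<in> carrier A' \<Longrightarrow> a (a' x) = x"
    by (rule mod_isoE[OF A rm(1)]) (rule that)
  obtain b b' where b: "b \<in> rhom R B B'" "b' \<in> rhom R B' B" "\<And>x. x \<in> carrier B \<Longrightarrow> b' (b x) = x"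
    "\<And>x. x \<in> carrier B' \<Longrightarrow> b (b' x) = x"
    by (rule mod_isoE[OF B rm(2)]) (rule that)
  obtain c c' where c: "c \<in> rhom R C C'" "c' \<in> rhom R C' C" "\<And>x. x \<in> carrier C \<Longrightarrow> c' (c x) = x"
    "\<And>x. x \<in> carrier C' \<Longrightarrow> c (c' x) = x"
    by (rule mod_isoE[OF C rm(3)]) (rule that)
  have "short_exact R A' (\<lambda>x. b (f (a' x))) B' (\<lambda>y. c (g (b' y))) C'"
  proof (rule short_exactI)
    show "(\<lambda>x. b (f (a' x))) \<in> rhom R A' B'" by (rule rhom_comp[OF rhom_comp[OF a(2) D(1)] b(1)])
    show "(\<lambda>y. c (g (b' y))) \<in> rhom R B' C'" by (rule rhom_comp[OF rhom_comp[OF b(2) D(2)] c(1)])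
    show "inj_on (\<lambda>x. b (f (a' x))) (carrier A')"
    proof (rule inj_onI)
      fix x y assume x: "x \<in> carrier A'" and y: "y \<in> carrier A'" and eq: "b (f (a' x)) = b (f (a' y))"
      note ax = rhom_closed[OF a(2) x] and ay = rhom_closed[OF a(2) y]
      have "b' (b (f (a' x))) = b' (b (f (a' y)))" using eq by (rule arg_cong)
      then have "f (a' x) = f (a' y)" by (simp only: b(3)[OF rhom_closed[OF D(1) ax]] b(3)[OF rhom_closed[OF D(1) ay]])
      then have "a' x = a' y" by (rule inj_onD[OF D(3) _ ax ay])
      then have "a (a' x) = a (a' y)" by (rule arg_cong)
      then show "x = y" by (simp only: a(4)[OF x] a(4)[OF y])
    qed
    show "c (g (b' (b (f (a' x))))) = \<zero>\<^bsub>C'\<^esub>" if x: "x \<in> carrier A'" for x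
      using b(3)[OF rhom_closed[OF D(1) rhom_closed[OF a(2) x]]] D(5)[OF rhom_closed[OF a(2) x]]
        rhom_zero[OF c(1) rm(3,4)] by simp
    show "\<exists>x\<in>carrier A'. b (f (a' x)) = y" if y: "y \<in> carrier B'" "c (g (b' y)) = \<zero>\<^bsub>C'\<^esub>" for y
    proof -
      note by' = rhom_closed[OF b(2) y(1)]
      have "c' (c (g (b' y))) = c' \<zero>\<^bsub>C'\<^esub>" using y(2) by (rule arg_cong)
      then have "g (b' y) = \<zero>\<^bsub>C\<^esub>" using c(3)[OF rhom_closed[OF D(2) by']] rhom_zero[OF c(2) rm(4,3)] by simp
      then obtain z where z: "z \<in> carrier A" "f z = b' y" using D(6)[OF by'] by blast
      show ?thesis
        by (rule bexI[OF _ rhom_closed[OF a(1) z(1)]]) (simp add: a(3)[OF z(1)] z(2) b(4)[OF y(1)])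
    qed
    show "\<exists>y\<in>carrier B'. c (g (b' y)) = z" if z: "z \<in> carrier C'" for z
    proof -
      obtain y where y: "y \<in> carrier B" "g y = c' z" using D(7)[OF rhom_closed[OF c(2) z]] by blast
      show ?thesis
        by (rule bexI[OF _ rhom_closed[OF b(1) y(1)]]) (simp add: b(3)[OF y(1)] y(2) c(4)[OF z])
    qed
  qed
  then show ?thesis by blast
qed

context hereditary_artin_algebra
begin

text \<open>Let \<open>0 \<rightarrow> I \<rightarrow> J \<rightarrow> Y \<rightarrow> 0\<close> be exact with \<open>J, Y \<in> add T\<close>.  A coresolution of \<open>P\<close> may be taken of
  the form \<open>0 \<rightarrow> P \<rightarrow> I\<^sup>n \<rightarrow> Q\<close> with \<open>Q\<close> a summand of \<open>I\<^sup>k\<close>.  Composing with \<open>I\<^sup>n \<rightarrow> J\<^sup>n\<close> embeds \<open>P\<close>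
  into \<open>J\<^sup>n\<close>; the claim is that \<open>F = J\<^sup>n / P\<close> lies in \<open>add T\<close>.  The projection \<open>\<pi>: J\<^sup>n \<rightarrow> F\<close> restricts
  to \<open>I\<^sup>n\<close> through \<open>I\<^sup>k\<close>, hence, as \<open>Ext\<^sup>1(Y, F) = 0\<close>, through \<open>J\<^sup>k\<close>, and what is missing to \<open>\<pi>\<close> factors
  through \<open>Y\<^sup>n\<close>.  Both factorizations kill \<open>P\<close>, so the identity of \<open>F\<close> factors through
  \<open>J\<^sup>k \<oplus> Y\<^sup>n\<close>.\<close>

lemma coresolution_exchange:
  assumes I: "fg_mod R I" and ex: "short_exact R I u J y Y"
    and T: "fg_mod R T" and J: "in_add R T J" and Y: "in_add R T Y" and YJ: "ext_zero R Y J"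
    and I0: "in_add R I I0" and I1: "in_add R I I1" and P: "right_module R P"
    and exP: "short_exact R P f I0 g I1"
  shows "\<exists>(E :: 'r umod) (F :: 'r umod) f' g'. in_add R T E \<and> in_add R T F \<and> short_exact R P f' E g' F"
proof -
  note rI = fg_modD(1)[OF I] and rJ = in_addD(2)[OF J] and rY = in_addD(2)[OF Y] and rT = fg_modD(1)[OF T]
    and rI0 = in_addD(2)[OF I0] and rI1 = in_addD(2)[OF I1]
  note D = short_exactD[OF exP]
  obtain n a b where ab: "a \<in> rhom R I0 (finite_mod_sum n (\<lambda>_. I))" "b \<in> rhom R (finite_mod_sum n (\<lambda>_. I)) I0"
    and ba: "\<And>x. x \<in> carrier I0 \<Longrightarrow> b (a x) = x"
    by (rule in_add_pow_retract[OF I I0]) (rule that)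
  let ?In = "finite_mod_sum n (\<lambda>_. I)" and ?Jn = "finite_mod_sum n (\<lambda>_. J)" and ?Yn = "finite_mod_sum n (\<lambda>_. Y)"
  have Jn: "in_add R T ?Jn" and Yn: "in_add R T ?Yn" by (intro in_add_pow T J Y)+
  have YnY: "in_add R Y ?Yn" and JnJ: "in_add R J ?Jn"
    by (intro in_add_pow in_add_self in_addD(1)[OF Y] in_addD(1)[OF J])+
  have In: "in_add R I ?In" by (intro in_add_pow in_add_self I)
  note rIn = in_addD(2)[OF In] and rJn = in_addD(2)[OF Jn] and rYn = in_addD(2)[OF Yn]
  interpret In: right_module R ?In by (rule rIn)
  let ?Q = "mod_sum I1 ?In"
  have Q: "in_add R I ?Q" by (rule in_add_mod_sum[OF I I1 In])
  note rQ = in_addD(2)[OF Q]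
  obtain k c d where cd: "c \<in> rhom R ?Q (finite_mod_sum k (\<lambda>_. I))" "d \<in> rhom R (finite_mod_sum k (\<lambda>_. I)) ?Q"
    and dc: "\<And>x. x \<in> carrier ?Q \<Longrightarrow> d (c x) = x"
    by (rule in_add_pow_retract[OF I Q]) (rule that)
  let ?Ik = "finite_mod_sum k (\<lambda>_. I)" and ?Jk = "finite_mod_sum k (\<lambda>_. J)" and ?Yk = "finite_mod_sum k (\<lambda>_. Y)"
  have Jk: "in_add R T ?Jk" by (intro in_add_pow T J)
  have YkY: "in_add R Y ?Yk" and JkJ: "in_add R J ?Jk"
    by (intro in_add_pow in_add_self in_addD(1)[OF Y] in_addD(1)[OF J])+
  note rIk = fg_modD(1)[OF fg_mod_pow[OF I, of k]] and rJk = in_addD(2)[OF Jk] and rYk = in_addD(2)[OF YkY]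
  define un where "un = (\<lambda>e. \<lambda>i\<in>{..<n}. u (e i))"
  define yn where "yn = (\<lambda>e. \<lambda>i\<in>{..<n}. y (e i))"
  define uk where "uk = (\<lambda>e. \<lambda>i\<in>{..<k}. u (e i))"
  define yk where "yk = (\<lambda>e. \<lambda>i\<in>{..<k}. y (e i))"
  have exn: "short_exact R ?In un ?Jn yn ?Yn" unfolding un_def yn_def by (rule short_exact_pow[OF ex])
  have exk: "short_exact R ?Ik uk ?Jk yk ?Yk" unfolding uk_def yk_def by (rule short_exact_pow[OF ex])
  note Dn = short_exactD[OF exn] and Dk = short_exactD[OF exk]
  \<comment> \<open>\<open>q\<close> is the map \<open>I\<^sup>n \<rightarrow> I\<^sub>1 \<oplus> C\<close> for the complement \<open>C\<close> of \<open>I\<^sub>0\<close> in \<open>I\<^sup>n\<close>, viewed in \<open>I\<^sub>1 \<oplus> I\<^sup>n\<close>; its kernel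
    is \<open>P\<close>.\<close>
  define q where "q e = (g (b e), e \<ominus>\<^bsub>?In\<^esub> a (b e))" for e
  have q: "q \<in> rhom R ?In ?Q"
    using rhom_pair[OF rhom_comp[OF ab(2) D(2)] rhom_minus[OF rIn rhom_id rhom_comp[OF ab(2,1)]]]
    by (simp add: q_def[abs_def])
  have ezk: "ext_zero R ?Yn ?Jk"
    by (rule ext_zero_in_add[OF in_addD(1)[OF Y] YnY in_addD(1)[OF J] JkJ YJ])
  obtain w where w: "w \<in> rhom R ?Jn ?Jk" "\<forall>e\<in>carrier ?In. w (un e) = uk (c (q e))"
    using ext_zero_extend[OF ezk exn rIn rJn rYn rJk rhom_comp[OF rhom_comp[OF q cd(1)] Dk(1)]] by (rule bexE)
  let ?j = "\<lambda>p. un (a (f p))"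
  have j: "?j \<in> rhom R P ?Jn" by (rule rhom_comp[OF rhom_comp[OF D(1) ab(1)] Dn(1)])
  have inj_a: "inj_on a (carrier I0)" by (rule inj_on_inverseI[where g = b]) (rule ba)
  have injj: "inj_on ?j (carrier P)"
  proof (rule inj_onI)
    fix p p' assume p: "p \<in> carrier P" and p': "p' \<in> carrier P" and eq: "un (a (f p)) = un (a (f p'))"
    note fp = rhom_closed[OF D(1) p] and fp' = rhom_closed[OF D(1) p']
    have "a (f p) = a (f p')"
      by (rule inj_onD[OF Dn(3), OF eq rhom_closed[OF ab(1) fp] rhom_closed[OF ab(1) fp']])
    then have "f p = f p'" by (rule inj_onD[OF inj_a _ fp fp'])
    then show "p = p'" by (rule inj_onD[OF D(3) _ p p'])
  qed
  define F where "F = coker_mod P ?j ?Jn"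
  have rF: "right_module R F" unfolding F_def by (rule right_module_coker_mod[OF P rJn j])
  obtain \<pi> where exF: "short_exact R P ?j ?Jn \<pi> F"
    using short_exact_coker_mod[OF P rJn j injj] unfolding F_def by blast
  note DF = short_exactD[OF exF]
  interpret F: right_module R F by (rule rF)
  interpret Jk: right_module R ?Jk by (rule rJk)
  have fgF: "fg_mod R F" by (rule fg_mod_image[OF in_addD(1)[OF Jn] rF DF(2,4)])
  have "ext_zero R Y ?Jn" by (rule ext_zero_in_add_right[OF in_addD(1)[OF J] JnJ YJ])
  then have "ext_zero R Y F" by (rule ext_zero_surj[OF in_addD(1)[OF Y] in_addD(1)[OF Jn] fgF DF(2,4)])
  then have ezF: "ext_zero R ?Yk F" by (rule ext_zero_in_add_left[OF in_addD(1)[OF Y] YkY rF])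
  have s0: "(\<lambda>e. \<pi> (un e)) \<in> rhom R ?In F" by (rule rhom_comp[OF Dn(1) DF(2)])
  have "\<pi> (un (a x)) = \<zero>\<^bsub>F\<^esub>" if x: "x \<in> carrier I0" "g x = \<zero>\<^bsub>I1\<^esub>" for x
    using D(6)[OF x] DF(5) by blast
  then obtain s' where s': "s' \<in> rhom R I1 F" "\<forall>x\<in>carrier I0. s' (g x) = \<pi> (un (a x))"
    using factor_through_surj[OF rI0 rI1 rF D(2,4) rhom_comp[OF ab(1) s0]] by blast
  define s where "s z = s' (fst z) \<oplus>\<^bsub>F\<^esub> \<pi> (un (snd z))" for z
  have s: "s \<in> rhom R ?Q F" using rhom_copair[OF rF s'(1) s0] by (simp add: s_def[abs_def])
  have sq: "s (q e) = \<pi> (un e)" if e: "e \<in> carrier ?In" for e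
  proof -
    note be = rhom_closed[OF ab(2) e] and abe = rhom_closed[OF ab(1) rhom_closed[OF ab(2) e]]
    have "s (q e) = \<pi> (un (a (b e))) \<oplus>\<^bsub>F\<^esub> (\<pi> (un e) \<ominus>\<^bsub>F\<^esub> \<pi> (un (a (b e))))"
      using s'(2) be rhom_diff[OF s0 rIn rF e abe] by (simp add: s_def q_def)
    then show ?thesis using rhom_closed[OF s0 e] rhom_closed[OF s0 abe] by (simp add: F.add_diff_cancel)
  qed
  obtain h1 where h1: "h1 \<in> rhom R ?Jk F" "\<forall>z\<in>carrier ?Ik. h1 (uk z) = s (d z)"
    using ext_zero_extend[OF ezF exk rIk rJk rYk rF rhom_comp[OF cd(2) s]] by (rule bexE)
  have h1w: "h1 (w (un e)) = \<pi> (un e)" if e: "e \<in> carrier ?In" for e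
    using w(2) h1(2) e rhom_closed[OF cd(1) rhom_closed[OF q e]] dc[OF rhom_closed[OF q e]] sq[OF e] by simp
  let ?m = "\<lambda>x. \<pi> x \<ominus>\<^bsub>F\<^esub> h1 (w x)"
  have m: "?m \<in> rhom R ?Jn F" by (rule rhom_minus[OF rF DF(2) rhom_comp[OF w(1) h1(1)]])
  have m0: "?m x = \<zero>\<^bsub>F\<^esub>" if x: "x \<in> carrier ?Jn" "yn x = \<zero>\<^bsub>?Yn\<^esub>" for x
  proof -
    obtain e where e: "e \<in> carrier ?In" "un e = x" using Dn(6)[OF x] by blast
    show ?thesis using h1w[OF e(1)] rhom_closed[OF s0 e(1)] unfolding e(2) by (simp add: F.minus_eq F.r_neg)
  qed
  obtain h2 where h2: "h2 \<in> rhom R ?Yn F" "\<forall>x\<in>carrier ?Jn. h2 (yn x) = ?m x"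
    using factor_through_surj[OF rJn rYn rF Dn(2,4) m m0] by blast
  have "w x = \<zero>\<^bsub>?Jk\<^esub>" and "yn x = \<zero>\<^bsub>?Yn\<^esub>" if x: "x \<in> carrier ?Jn" "\<pi> x = \<zero>\<^bsub>F\<^esub>" for x
  proof -
    obtain p where p: "p \<in> carrier P" "un (a (f p)) = x" using DF(6)[OF x] by blast
    note fp = rhom_closed[OF D(1) p(1)] and afp = rhom_closed[OF ab(1) rhom_closed[OF D(1) p(1)]]
    have "q (a (f p)) = \<zero>\<^bsub>?Q\<^esub>"
      using ba[OF fp] D(5)[OF p(1)] afp by (simp add: q_def In.minus_eq In.r_neg del: finite_mod_sum_simps)
    then show "w x = \<zero>\<^bsub>?Jk\<^esub>"
      using bspec[OF w(2) afp] rhom_zero[OF rhom_comp[OF cd(1) Dk(1)] rQ rJk] unfolding p(2) by simp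
    show "yn x = \<zero>\<^bsub>?Yn\<^esub>" using Dn(5)[OF afp] unfolding p(2) .
  qed
  note wy = this
  obtain w' where w': "w' \<in> rhom R F ?Jk" "\<forall>x\<in>carrier ?Jn. w' (\<pi> x) = w x"
    using factor_through_surj[OF rJn rF rJk DF(2,4) w(1) wy(1)] by blast
  obtain y' where y': "y' \<in> rhom R F ?Yn" "\<forall>x\<in>carrier ?Jn. y' (\<pi> x) = yn x"
    using factor_through_surj[OF rJn rF rYn DF(2,4) Dn(2) wy(2)] by blast
  have fJ: "factors R T ?Jk ?Jk (\<lambda>x. x)" using Jk in_add_iff_factors[OF T] by blast
  have fY: "factors R T ?Yn ?Yn (\<lambda>x. x)" using Yn in_add_iff_factors[OF T] by blast
  have "factors R T F F (\<lambda>z. h1 (w' z) \<oplus>\<^bsub>F\<^esub> h2 (y' z))"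
    by (rule factors_plus[OF factors_comp[OF fY rYn rYn rF y'(1) h2(1)] factors_comp[OF fJ rJk rJk rF w'(1) h1(1)] rF rF])
  then have "factors R T F F (\<lambda>z. z)"
  proof (rule factors_cong)
    fix z assume "z \<in> carrier F"
    then obtain x where x: "x \<in> carrier ?Jn" "\<pi> x = z" using DF(7) by blast
    have "h1 (w' z) \<oplus>\<^bsub>F\<^esub> h2 (y' z) = h1 (w x) \<oplus>\<^bsub>F\<^esub> ?m x"
      using w'(2) y'(2) h2(2) x by auto
    also have "\<dots> = z"
      using x rhom_closed[OF h1(1) rhom_closed[OF w(1) x(1)]] rhom_closed[OF DF(2) x(1)] by (simp add: F.add_diff_cancel)
    finally show "z = h1 (w' z) \<oplus>\<^bsub>F\<^esub> h2 (y' z)" by simp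
  qed
  then have FT: "in_add R T F" using rF in_add_iff_factors[OF T] by blast
  obtain E' :: "'r umod" where E': "fg_mod R E'" "mod_iso R ?Jn E'"
    using fg_mod_representative[OF in_addD(1)[OF Jn]] by blast
  obtain F' :: "'r umod" where F': "fg_mod R F'" "mod_iso R F F'"
    using fg_mod_representative[OF fgF] by blast
  note rE' = fg_modD(1)[OF E'(1)] and rF' = fg_modD(1)[OF F'(1)]
  show ?thesis
    using short_exact_iso[OF exF mod_iso_refl E'(2) F'(2) P rJn rF rF']
      in_add_iso[OF T Jn E'(2) rE'] in_add_iso[OF T FT F'(2) rF'] by blast
qed

text \<open>Dually, if \<open>N\<close> is a quotient of \<open>J \<in> add I\<close> by a submodule in \<open>add I\<close>, one may take \<open>J = I\<^sup>n\<close>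
  with kernel \<open>L'\<close>, a summand of \<open>I\<^sup>k\<close>.  Cover \<open>I\<^sup>n\<close> by \<open>Q\<^sub>0\<^sup>n\<close>, with kernel \<open>Q\<^sub>1\<^sup>n\<close>, and let \<open>K\<close> be the
  kernel of \<open>Q\<^sub>0\<^sup>n \<rightarrow> N\<close>.  As a submodule of \<open>Q\<^sub>0\<^sup>n\<close> it satisfies \<open>Ext\<^sup>1(K, P) = 0\<close>, so \<open>K \<rightarrow> L'\<close> factors
  through \<open>Q\<^sub>0\<^sup>k\<close>; what is missing lands in \<open>Q\<^sub>1\<^sup>n\<close>, and the identity of \<open>K\<close> factors through
  \<open>Q\<^sub>0\<^sup>k \<oplus> Q\<^sub>1\<^sup>n\<close>.\<close>

lemma resolution_exchange:
  assumes I: "fg_mod R I" and P: "fg_mod R P" and PP: "ext_zero R P P"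
    and Q0: "in_add R P Q0" and Q1: "in_add R P Q1" and exQ: "short_exact R Q1 i Q0 p I"
    and J: "in_add R I J" and L: "in_add R I L" and N: "right_module R N" and ex: "short_exact R L l J y N"
  shows "\<exists>(E :: 'r umod) (F :: 'r umod) f g. in_add R P E \<and> in_add R P F \<and> short_exact R F f E g N"
proof -
  note rI = fg_modD(1)[OF I] and rP = fg_modD(1)[OF P] and rJ = in_addD(2)[OF J] and rL = in_addD(2)[OF L]
    and rQ0 = in_addD(2)[OF Q0] and rQ1 = in_addD(2)[OF Q1]
  note D = short_exactD[OF ex]
  obtain n a b where ab: "a \<in> rhom R J (finite_mod_sum n (\<lambda>_. I))" "b \<in> rhom R (finite_mod_sum n (\<lambda>_. I)) J"
    and ba: "\<And>x. x \<in> carrier J \<Longrightarrow> b (a x) = x"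
    by (rule in_add_pow_retract[OF I J]) (rule that)
  let ?In = "finite_mod_sum n (\<lambda>_. I)"
  have In: "in_add R I ?In" by (intro in_add_pow in_add_self I)
  note rIn = in_addD(2)[OF In]
  interpret In: right_module R ?In by (rule rIn)
  interpret J: right_module R J by (rule rJ)
  define \<nu> where "\<nu> x = y (b x)" for x
  have \<nu>: "\<nu> \<in> rhom R ?In N" using rhom_comp[OF ab(2) D(2)] by (simp add: \<nu>_def[abs_def])
  have surj\<nu>: "\<exists>x\<in>carrier ?In. \<nu> x = z" if z: "z \<in> carrier N" for z
  proof -
    obtain x where x: "x \<in> carrier J" "y x = z" using D(7)[OF z] by blast
    show ?thesis by (rule bexI[OF _ rhom_closed[OF ab(1) x(1)]]) (simp add: \<nu>_def ba[OF x(1)] x(2))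
  qed
  let ?H = "{x \<in> carrier ?In. \<nu> x = \<zero>\<^bsub>N\<^esub>}"
  define L' where "L' = ?In\<lparr>carrier := ?H\<rparr>"
  have subH: "submodule ?H R ?In" by (rule submodule_kernel[OF rIn N \<nu>])
  have rL': "right_module R L'" unfolding L'_def by (rule right_module_sub[OF rIn subH])
  have L'mem: "x \<in> carrier L' \<longleftrightarrow> x \<in> carrier ?In \<and> \<nu> x = \<zero>\<^bsub>N\<^esub>" for x by (simp add: L'_def)
  have iL': "(\<lambda>x. x) \<in> rhom R L' ?In" unfolding L'_def by (rule rhom_from_sub) auto
  have L': "in_add R I L'"
  proof -
    have "b e \<in> l ` carrier L" if e: "e \<in> carrier L'" for e
    proof -
      have e': "e \<in> carrier ?In" "y (b e) = \<zero>\<^bsub>N\<^esub>"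
        using e unfolding L'mem \<nu>_def by (simp_all del: finite_mod_sum_simps)
      obtain x where "x \<in> carrier L" "l x = b e"
        using D(6)[OF rhom_closed[OF ab(2) e'(1)] e'(2)] by (rule bexE)
      then show ?thesis by (intro image_eqI[where x = x]) simp_all
    qed
    then obtain t where t: "t \<in> rhom R L' L" "\<forall>e\<in>carrier L'. l (t e) = b e"
      using factor_through_inj[OF rL rL' D(1,3) rhom_comp[OF iL' ab(2)]] by blast
    \<comment> \<open>\<open>L'\<close> is the sum of \<open>L\<close> and the complement of \<open>J\<close> in \<open>I\<^sup>n\<close>.\<close>
    let ?S = "mod_sum L ?In"
    let ?\<theta> = "\<lambda>z. a (l (fst z)) \<oplus>\<^bsub>?In\<^esub> (snd z \<ominus>\<^bsub>?In\<^esub> a (b (snd z)))"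
    have "?\<theta> \<in> rhom R ?S ?In"
      by (rule rhom_copair[OF rIn rhom_comp[OF D(1) ab(1)] rhom_minus[OF rIn rhom_id rhom_comp[OF ab(2,1)]]])
    then have \<theta>: "?\<theta> \<in> rhom R ?S L'" unfolding L'_def
    proof (rule rhom_into_sub)
      fix z assume z: "z \<in> carrier ?S"
      obtain x e where xe: "z = (x, e)" "x \<in> carrier L" "e \<in> carrier ?In" using z by (auto simp del: finite_mod_sum_simps)
      note cl = rhom_closed[OF D(1) xe(2)] rhom_closed[OF ab(2) xe(3)]
      note cla = rhom_closed[OF ab(1) cl(1)] rhom_closed[OF ab(1) cl(2)]
      have "b (?\<theta> (x, e)) = l x"
        using cl cla xe(3)
        by (simp add: rhom_add[OF ab(2)] rhom_diff[OF ab(2) rIn rJ] ba J.minus_eq J.r_neg del: finite_mod_sum_simps)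
      moreover have "?\<theta> (x, e) \<in> carrier ?In" using cla xe(3) by (simp del: finite_mod_sum_simps)
      ultimately show "?\<theta> z \<in> ?H" using D(5)[OF xe(2)] unfolding xe(1) \<nu>_def by simp
    qed
    have S: "in_add R I ?S" by (rule in_add_mod_sum[OF I L In])
    show ?thesis
    proof (rule in_add_retract[OF I S rL' rhom_pair[OF t(1) iL'] \<theta>])
      fix e assume e: "e \<in> carrier L'"
      then have eI: "e \<in> carrier ?In" by (simp add: L'mem)
      show "?\<theta> (t e, e) = e"
        using t(2) e eI rhom_closed[OF ab(1) rhom_closed[OF ab(2) eI]]
        by (simp add: In.add_diff_cancel del: finite_mod_sum_simps)
    qed
  qed
  obtain k r \<rho> where r: "r \<in> rhom R L' (finite_mod_sum k (\<lambda>_. I))" "\<rho> \<in> rhom R (finite_mod_sum k (\<lambda>_. I)) L'"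
    and \<rho>r: "\<And>x. x \<in> carrier L' \<Longrightarrow> \<rho> (r x) = x"
    by (rule in_add_pow_retract[OF I L']) (rule that)
  let ?Ik = "finite_mod_sum k (\<lambda>_. I)"
  let ?An = "finite_mod_sum n (\<lambda>_. Q0)" and ?Bn = "finite_mod_sum n (\<lambda>_. Q1)"
  let ?Ak = "finite_mod_sum k (\<lambda>_. Q0)" and ?Bk = "finite_mod_sum k (\<lambda>_. Q1)"
  have An: "in_add R P ?An" and Bn: "in_add R P ?Bn" and Ak: "in_add R P ?Ak" and Bk: "in_add R P ?Bk"
    by (intro in_add_pow P Q0 Q1)+
  note rIk = fg_modD(1)[OF fg_mod_pow[OF I, of k]]
  note rAn = in_addD(2)[OF An] and rBn = in_addD(2)[OF Bn] and rAk = in_addD(2)[OF Ak] and rBk = in_addD(2)[OF Bk]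
  define pn where "pn = (\<lambda>e. \<lambda>i\<in>{..<n}. p (e i))"
  define in' where "in' = (\<lambda>e. \<lambda>j\<in>{..<n}. i (e j))"
  define pk where "pk = (\<lambda>e. \<lambda>i\<in>{..<k}. p (e i))"
  define ik where "ik = (\<lambda>e. \<lambda>j\<in>{..<k}. i (e j))"
  have exn: "short_exact R ?Bn in' ?An pn ?In" unfolding pn_def in'_def by (rule short_exact_pow[OF exQ])
  have exk: "short_exact R ?Bk ik ?Ak pk ?Ik" unfolding pk_def ik_def by (rule short_exact_pow[OF exQ])
  note Dn = short_exactD[OF exn] and Dk = short_exactD[OF exk]
  let ?G = "{x \<in> carrier ?An. \<nu> (pn x) = \<zero>\<^bsub>N\<^esub>}"
  define K where "K = ?An\<lparr>carrier := ?G\<rparr>"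
  note \<nu>p = rhom_comp[OF Dn(2) \<nu>]
  have "(\<lambda>x. \<nu> (pn x)) ` carrier ?An = carrier N"
  proof (intro equalityI subsetI)
    fix z assume "z \<in> carrier N"
    then obtain x where x: "x \<in> carrier ?In" "\<nu> x = z" using surj\<nu> by blast
    obtain e where e: "e \<in> carrier ?An" "pn e = x" using Dn(7)[OF x(1)] by blast
    show "z \<in> (\<lambda>x. \<nu> (pn x)) ` carrier ?An" by (rule image_eqI[where x = e]) (simp_all only: e x)
  qed (use rhom_closed[OF \<nu>p] in blast)
  then have exK: "short_exact R K (\<lambda>x. x) ?An (\<lambda>x. \<nu> (pn x)) N"
    unfolding K_def by (rule short_exact_kernel[OF rAn N \<nu>p])
  have subG: "submodule ?G R ?An" by (rule submodule_kernel[OF rAn N \<nu>p])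
  have rK: "right_module R K" unfolding K_def by (rule right_module_sub[OF rAn subG])
  have Kmem: "x \<in> carrier K \<longleftrightarrow> x \<in> carrier ?An \<and> \<nu> (pn x) = \<zero>\<^bsub>N\<^esub>" for x by (simp add: K_def)
  have fgK: "fg_mod R K" unfolding K_def by (rule fg_mod_submodule[OF artin in_addD(1)[OF An] subG])
  note iK = short_exactD(1)[OF exK] and injK = short_exactD(3)[OF exK]
  have "ext_zero R ?An P" by (rule ext_zero_in_add_left[OF P An rP PP])
  then have "ext_zero R K P" by (rule ext_zero_sub[OF fgK in_addD(1)[OF An] rP iK injK])
  then have KBk: "ext_zero R K ?Bk" by (rule ext_zero_in_add_right[OF P Bk])
  have AB: "ext_zero R ?Ak ?Bn" by (rule ext_zero_in_add[OF P Ak P Bn PP])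
  have \<rho>p: "(\<lambda>z. \<rho> (pk z)) \<in> rhom R ?Ak L'" by (rule rhom_comp[OF Dk(2) r(2)])
  obtain \<sigma> where \<sigma>: "\<sigma> \<in> rhom R ?Ak ?An" "\<forall>z\<in>carrier ?Ak. pn (\<sigma> z) = \<rho> (pk z)"
    using ext_zero_lift[OF AB exn rBn rAn rIn rAk rhom_comp[OF \<rho>p iL']] by (rule bexE)
  have \<sigma>K: "\<sigma> \<in> rhom R ?Ak K" unfolding K_def
  proof (rule rhom_into_sub[OF \<sigma>(1)])
    fix z assume z: "z \<in> carrier ?Ak"
    show "\<sigma> z \<in> ?G" using rhom_closed[OF \<sigma>(1) z] rhom_closed[OF \<rho>p z] bspec[OF \<sigma>(2) z] by (simp add: L'mem)
  qed
  have "pn \<in> rhom R K ?In" by (rule rhom_comp[OF iK Dn(2)])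
  then have pK: "pn \<in> rhom R K L'" unfolding L'_def
    by (rule rhom_into_sub) (use rhom_closed[OF Dn(2)] in \<open>simp only: Kmem mem_Collect_eq\<close>)
  obtain h1 where h1: "h1 \<in> rhom R K ?Ak" "\<forall>x\<in>carrier K. pk (h1 x) = r (pn x)"
    using ext_zero_lift[OF KBk exk rBk rAk rIk rK rhom_comp[OF pK r(1)]] by (rule bexE)
  interpret An: right_module R ?An by (rule rAn)
  let ?\<delta> = "\<lambda>x. x \<ominus>\<^bsub>?An\<^esub> \<sigma> (h1 x)"
  have \<delta>: "?\<delta> \<in> rhom R K ?An" by (rule rhom_minus[OF rAn iK rhom_comp[OF h1(1) \<sigma>(1)]])
  have "?\<delta> x \<in> in' ` carrier ?Bn" if x: "x \<in> carrier K" for x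
  proof -
    have xA: "x \<in> carrier ?An" using x Kmem by blast
    note hx = rhom_closed[OF h1(1) x] and px = rhom_closed[OF Dn(2) xA]
    have "pn (\<sigma> (h1 x)) = pn x"
      using bspec[OF \<sigma>(2) hx] bspec[OF h1(2) x] \<rho>r[OF rhom_closed[OF pK x]] by simp
    then have p0: "pn (?\<delta> x) = \<zero>\<^bsub>?In\<^esub>"
      using rhom_diff[OF Dn(2) rAn rIn xA rhom_closed[OF \<sigma>(1) hx]] px
      by (simp add: In.minus_eq In.r_neg del: finite_mod_sum_simps)
    obtain z where "z \<in> carrier ?Bn" "in' z = ?\<delta> x"
      using Dn(6)[OF rhom_closed[OF \<delta> x] p0] by (rule bexE)
    then show ?thesis by (intro image_eqI[where x = z]) simp_all
  qed
  then obtain h2 where h2: "h2 \<in> rhom R K ?Bn" "\<forall>x\<in>carrier K. in' (h2 x) = ?\<delta> x"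
    using factor_through_inj[OF rBn rK Dn(1,3) \<delta>] by blast
  have inK: "in' \<in> rhom R ?Bn K" unfolding K_def
  proof (rule rhom_into_sub[OF Dn(1)])
    fix x assume x: "x \<in> carrier ?Bn"
    show "in' x \<in> ?G"
      using rhom_closed[OF Dn(1) x] Dn(5)[OF x] rhom_zero[OF \<nu> rIn N] by (simp del: finite_mod_sum_simps)
  qed
  have fA: "factors R P ?Ak ?Ak (\<lambda>x. x)" using Ak in_add_iff_factors[OF P] by blast
  have fB: "factors R P ?Bn ?Bn (\<lambda>x. x)" using Bn in_add_iff_factors[OF P] by blast
  have "factors R P K K (\<lambda>x. \<sigma> (h1 x) \<oplus>\<^bsub>K\<^esub> in' (h2 x))"
    by (rule factors_plus[OF factors_comp[OF fB rBn rBn rK h2(1) inK] factors_comp[OF fA rAk rAk rK h1(1) \<sigma>K] rK rK])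
  then have "factors R P K K (\<lambda>x. x)"
  proof (rule factors_cong)
    fix x assume x: "x \<in> carrier K"
    then have xA: "x \<in> carrier ?An" using Kmem by blast
    have "\<sigma> (h1 x) \<oplus>\<^bsub>?An\<^esub> ?\<delta> x = x"
      by (rule An.add_diff_cancel(1)[OF rhom_closed[OF \<sigma>(1) rhom_closed[OF h1(1) x]] xA])
    then show "x = \<sigma> (h1 x) \<oplus>\<^bsub>K\<^esub> in' (h2 x)"
      using bspec[OF h2(2) x] unfolding K_def by (simp del: finite_mod_sum_simps)
  qed
  then have KP: "in_add R P K" using rK in_add_iff_factors[OF P] by blast
  obtain E' :: "'r umod" where E': "fg_mod R E'" "mod_iso R ?An E'"
    using fg_mod_representative[OF in_addD(1)[OF An]] by blast
  obtain F' :: "'r umod" where F': "fg_mod R F'" "mod_iso R K F'"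
    using fg_mod_representative[OF fgK] by blast
  note rE' = fg_modD(1)[OF E'(1)] and rF' = fg_modD(1)[OF F'(1)]
  show ?thesis
    using short_exact_iso[OF exK F'(2) E'(2) mod_iso_refl rK rAn N N]
      in_add_iso[OF P An E'(2) rE'] in_add_iso[OF P KP F'(2) rF'] by blast
qed

end

section \<open>Indecomposable modules\<close>

lemma rhom_funpow:
  assumes "h \<in> rhom R X X" shows "h ^^ n \<in> rhom R X X"
proof (induction n)
  case 0
  show ?case using rhom_id by (simp add: id_def)
next
  case (Suc n)
  show ?case using rhom_comp[OF Suc assms] by (simp add: comp_def)
qed

lemma zero_mod_iso:
  assumes "zero_mod M" and iso: "mod_iso R M N" and rm: "right_module R M" "right_module R N"
  shows "zero_mod N"
proof -
  obtain h where h: "h \<in> rhom R M N" "bij_betw h (carrier M) (carrier N)" using iso by (auto simp: mod_iso_def)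
  have "carrier N = h ` {\<zero>\<^bsub>M\<^esub>}" using h(2) assms(1) by (simp add: bij_betw_def zero_mod_def)
  then show ?thesis using rhom_zero[OF h(1) rm] by (simp add: zero_mod_def)
qed

lemma indecomposableD:
  assumes X: "indecomposable R X" and A: "fg_mod R A" and B: "fg_mod R B" and iso: "mod_iso R (mod_sum A B) X"
  shows "zero_mod A \<or> zero_mod B"
proof -
  note rA = fg_modD(1)[OF A] and rB = fg_modD(1)[OF B]
  obtain A' :: "'a umod" where A': "fg_mod R A'" "mod_iso R A A'" using fg_mod_representative[OF A] by blast
  obtain B' :: "'a umod" where B': "fg_mod R B'" "mod_iso R B B'" using fg_mod_representative[OF B] by blast
  note rA' = fg_modD(1)[OF A'(1)] and rB' = fg_modD(1)[OF B'(1)]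
  have "mod_iso R (mod_sum A B) (mod_sum A' B')" by (rule mod_sum_iso[OF A'(2) B'(2) rA rB])
  then have "mod_iso R X (mod_sum A' B')"
    using mod_iso_trans[OF mod_iso_sym[OF iso right_module_mod_sum[OF rA rB]]] by blast
  then have "zero_mod A' \<or> zero_mod B'" using X A'(1) B'(1) unfolding indecomposable_def by blast
  then show ?thesis
    using zero_mod_iso[OF _ mod_iso_sym[OF A'(2) rA] rA' rA] zero_mod_iso[OF _ mod_iso_sym[OF B'(2) rB] rB' rB] by blast
qed

lemma indecomposable_iso:
  assumes X: "indecomposable R X" and iso: "mod_iso R X Y" and Y: "right_module R Y"
  shows "indecomposable R Y"
proof -
  have fgX: "fg_mod R X" and nzX: "\<not> zero_mod X" using X by (auto simp: indecomposable_def)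
  note rX = fg_modD(1)[OF fgX]
  have "fg_mod R Y" by (rule fg_mod_iso[OF fgX iso Y])
  moreover have "\<not> zero_mod Y" using nzX zero_mod_iso[OF _ mod_iso_sym[OF iso rX] Y rX] by blast
  ultimately show ?thesis using X mod_iso_trans[OF iso] unfolding indecomposable_def by blast
qed

lemma rhom_bij_inverse:
  assumes X: "right_module R X" and h: "h \<in> rhom R X Y" and bij: "bij_betw h (carrier X) (carrier Y)"
  obtains k where "k \<in> rhom R Y X" "\<And>x. x \<in> carrier X \<Longrightarrow> k (h x) = x" "\<And>y. y \<in> carrier Y \<Longrightarrow> h (k y) = y"
proof (rule that[of "inv_into (carrier X) h"])
  show "inv_into (carrier X) h \<in> rhom R Y X" by (rule rhom_inv_into[OF X h bij])
qed (use bij in \<open>auto simp: bij_betw_def f_inv_into_f\<close>)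

text \<open>Correcting \<open>b\<close> by the inverse of \<open>b a\<close> makes \<open>X\<close> a retract of \<open>N\<close>; its complement must vanish.\<close>

lemma indecomposable_retract:
  assumes N: "indecomposable R N" and X: "fg_mod R X" "\<not> zero_mod X"
    and a: "a \<in> rhom R X N" and b: "b \<in> rhom R N X" and bij: "bij_betw (\<lambda>x. b (a x)) (carrier X) (carrier X)"
  shows "bij_betw a (carrier X) (carrier N)"
proof -
  have fgN: "fg_mod R N" using N by (simp add: indecomposable_def)
  note rN = fg_modD(1)[OF fgN] and rX = fg_modD(1)[OF X(1)]
  interpret X: right_module R X by (rule rX)
  obtain k where k: "k \<in> rhom R X X" "\<And>x. x \<in> carrier X \<Longrightarrow> k (b (a x)) = x"
    by (rule rhom_bij_inverse[OF rX rhom_comp[OF a b] bij]) (rule that)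
  let ?c = "\<lambda>x. k (b x)"
  have c: "?c \<in> rhom R N X" by (rule rhom_comp[OF b k(1)])
  let ?L = "N\<lparr>carrier := {x \<in> carrier N. ?c x = \<zero>\<^bsub>X\<^esub>}\<rparr>"
  have "fg_mod R ?L" "mod_iso R (mod_sum X ?L) N"
    by (rule retract_complement[OF fgN rX a c], rule k(2), assumption)+
  then have "zero_mod ?L" using indecomposableD[OF N X(1)] X(2) by blast
  then have ker: "{x \<in> carrier N. ?c x = \<zero>\<^bsub>X\<^esub>} = {\<zero>\<^bsub>N\<^esub>}" by (simp add: zero_mod_def)
  have "inj_on ?c (carrier N)" unfolding rhom_inj_iff[OF rN rX c] using ker by blast
  have ac: "a (?c y) = y" if y: "y \<in> carrier N" for y
  proof (rule inj_onD[OF \<open>inj_on ?c (carrier N)\<close>])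
    show "k (b (a (?c y))) = k (b y)" by (rule k(2)[OF rhom_closed[OF c y]])
    show "a (?c y) \<in> carrier N" by (rule rhom_closed[OF a rhom_closed[OF c y]])
  qed (rule y)
  show ?thesis
    by (rule bij_betw_byWitness[where f' = ?c]) (use k(2) ac rhom_closed[OF a] rhom_closed[OF c] in auto)
qed

context
  fixes K :: "'k ring" and \<phi> :: "'k \<Rightarrow> 'r" and R :: "'r ring"
  assumes artin: "artin_algebra K \<phi> R"
begin

text \<open>Fitting's lemma: for large \<open>k\<close> the images and the kernels of the powers of \<open>h\<close> are stationary, so
  \<open>X\<close> is the direct sum of the image and the kernel of \<open>h\<^sup>k\<close>, and one of them is zero.\<close>

lemma fitting:
  assumes X: "indecomposable R X" and h: "h \<in> rhom R X X"
  shows "bij_betw h (carrier X) (carrier X) \<or> (\<exists>n. \<forall>x\<in>carrier X. (h ^^ n) x = \<zero>\<^bsub>X\<^esub>)"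
proof -
  have fgX: "fg_mod R X" using X by (simp add: indecomposable_def)
  note rX = fg_modD(1)[OF fgX]
  interpret X: right_module R X by (rule rX)
  note hn = rhom_funpow[OF h]
  let ?U = "\<lambda>n. (h ^^ n) ` carrier X" and ?V = "\<lambda>n. {x \<in> carrier X. (h ^^ n) x = \<zero>\<^bsub>X\<^esub>}"
  have subU: "submodule (?U n) R X" for n by (rule submodule_image[OF rX rX hn X.submodule_carrier])
  have subV: "submodule (?V n) R X" for n by (rule submodule_kernel[OF rX rX hn])
  have hadd: "(h ^^ (m + n)) x = (h ^^ m) ((h ^^ n) x)" for m n x by (simp add: funpow_add)
  have Udec: "?U (n + d) \<subseteq> ?U n" for n d
    unfolding hadd using rhom_closed[OF hn] by auto
  have Vinc: "?V n \<subseteq> ?V (d + n)" for n d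
    unfolding hadd using rhom_zero[OF hn rX rX] by auto
  have "?U 0 \<in> range ?U" by blast
  then obtain Q where Q: "Q \<in> range ?U"
    and Qmin: "\<And>U. (U, Q) \<in> {(U, V). submodule U R X \<and> submodule V R X \<and> U \<subset> V} \<Longrightarrow> U \<notin> range ?U"
    by (rule wfE_min[OF wf_submodules[OF artin fgX]]) (rule that)
  obtain n where n: "Q = ?U n" using Q by blast
  have Ustab: "?U (n + d) = ?U n" for d
    using Qmin[of "?U (n + d)"] Udec[of n d] subU n by blast
  have "\<exists>m. \<forall>d. ?V (d + m) = ?V m"
  proof -
    let ?W = "\<Union>m. ?V m"
    have subW: "submodule ?W R X"
    proof (rule X.submodI)
      show "?W \<subseteq> carrier X" by auto
      show "\<zero>\<^bsub>X\<^esub> \<in> ?W" using X.submodD(2)[OF subV[of 0]] by blast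
      fix x y assume "x \<in> ?W" "y \<in> ?W"
      then obtain m m' where "x \<in> ?V m" "y \<in> ?V m'" by blast
      then have "x \<in> ?V (m' + m)" "y \<in> ?V (m' + m)" using Vinc[of m m'] Vinc[of m' m] by (auto simp: add.commute)
      then show "x \<oplus>\<^bsub>X\<^esub> y \<in> ?W" using X.submodD(3)[OF subV] by blast
    next
      fix r x assume "r \<in> carrier R" "x \<in> ?W"
      then show "r \<odot>\<^bsub>X\<^esub> x \<in> ?W" using X.submodD(4)[OF subV] by blast
    qed
    note fgW = fg_mod_submodule[OF artin fgX subW]
    let ?XW = "X\<lparr>carrier := ?W\<rparr>"
    obtain S where S: "finite S" "S \<subseteq> carrier ?XW" "\<And>H. submodule H R ?XW \<Longrightarrow> S \<subseteq> H \<Longrightarrow> carrier ?XW \<subseteq> H"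
      by (rule right_module.fin_genE[OF fg_modD[OF fgW]]) (rule that)
    have "\<exists>m. S \<subseteq> ?V m" using S(1,2)
    proof (induction S rule: finite_induct)
      case (insert s S)
      then obtain m where m: "S \<subseteq> ?V m" by auto
      obtain m' where m': "s \<in> ?V m'" using insert.prems by auto
      have "insert s S \<subseteq> ?V (m' + m)" using m m' Vinc[of m m'] Vinc[of m' m] by (auto simp: add.commute)
      then show ?case by blast
    qed simp
    then obtain m where m: "S \<subseteq> ?V m" by blast
    have "submodule (?V m) R ?XW" unfolding submodule_sub_iff[OF rX subW] using subV by blast
    then have "?W \<subseteq> ?V m" using S(3) m by auto
    then have "?V (d + m) = ?V m" for d using Vinc[of m d] by blast
    then show ?thesis by blast
  qed
  then obtain m where Vstab: "\<And>d. ?V (d + m) = ?V m" by blast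
  \<comment> \<open>The successor makes \<open>h\<close> a factor of \<open>h\<^sup>k\<close>, so that \<open>h\<close> is bijective if \<open>h\<^sup>k\<close> is.\<close>
  define k where "k = Suc (n + m)"
  let ?g = "h ^^ k"
  have U2: "?U (k + k) = ?U k" using Ustab[of "Suc m"] Ustab[of "Suc m + k"] by (simp add: k_def add.assoc)
  have V2: "?V (k + k) = ?V k" using Vstab[of "Suc n"] Vstab[of "k + Suc n"] by (simp add: k_def add.assoc)
  let ?I = "X\<lparr>carrier := ?U k\<rparr>" and ?K = "X\<lparr>carrier := ?V k\<rparr>"
  have disj: "y = \<zero>\<^bsub>X\<^esub>" if y: "y \<in> ?U k" "y \<in> ?V k" for y
  proof -
    obtain x where x: "x \<in> carrier X" "y = ?g x" using y(1) by blast
    have "x \<in> ?V (k + k)" using x y(2) by (simp add: hadd)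
    then have "x \<in> ?V k" by (simp only: V2)
    then show ?thesis using x(2) by simp
  qed
  have span: "\<exists>z\<in>carrier X. x \<ominus>\<^bsub>X\<^esub> ?g z \<in> ?V k" if x: "x \<in> carrier X" for x
  proof -
    have "?g x \<in> ?U (k + k)" using x by (simp only: U2) blast
    then obtain z where z: "z \<in> carrier X" "?g x = ?g (?g z)" by (auto simp: hadd)
    have "?g (x \<ominus>\<^bsub>X\<^esub> ?g z) = \<zero>\<^bsub>X\<^esub>"
      using rhom_diff[OF hn rX rX x rhom_closed[OF hn z(1)], of k] z(2)[symmetric]
        X.r_neg[OF rhom_closed[OF hn x]] by (simp add: X.minus_eq)
    then show ?thesis using z(1) x rhom_closed[OF hn z(1)] by (intro bexI[OF _ z(1)]) simp
  qed
  have iI: "(\<lambda>x. x) \<in> rhom R ?I X" and iK: "(\<lambda>x. x) \<in> rhom R ?K X"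
    by (rule rhom_from_sub[OF X.submodD(1)[OF subU] rhom_id], rule rhom_from_sub[OF X.submodD(1)[OF subV] rhom_id])
  have rI: "right_module R ?I" and rK: "right_module R ?K"
    by (rule right_module_sub[OF rX subU], rule right_module_sub[OF rX subV])
  let ?s = "\<lambda>z. fst z \<oplus>\<^bsub>X\<^esub> snd z"
  have s: "?s \<in> rhom R (mod_sum ?I ?K) X" by (rule rhom_copair[OF rX iI iK])
  have "mod_iso R (mod_sum ?I ?K) X" unfolding mod_iso_def
  proof (rule bexI[OF _ s], rule bij_betw_imageI)
    show "inj_on ?s (carrier (mod_sum ?I ?K))"
      unfolding rhom_inj_iff[OF right_module_mod_sum[OF rI rK] rX s]
    proof (intro ballI impI)
      fix z assume z: "z \<in> carrier (mod_sum ?I ?K)" "?s z = \<zero>\<^bsub>X\<^esub>"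
      obtain x y where xy: "z = (x, y)" "x \<in> ?U k" "y \<in> ?V k" using z(1) by auto
      have c: "x \<in> carrier X" "y \<in> carrier X" using xy(2,3) X.submodD(1)[OF subU] by auto
      have "x = \<ominus>\<^bsub>X\<^esub> y" using z(2) c unfolding xy(1) by (simp add: X.minus_equality)
      then have "x \<in> ?V k" using X.submodD(5)[OF subV xy(3)] by simp
      then have x0: "x = \<zero>\<^bsub>X\<^esub>" using disj xy(2) by blast
      then have "y = \<zero>\<^bsub>X\<^esub>" using z(2) c unfolding xy(1) by simp
      then show "z = \<zero>\<^bsub>mod_sum ?I ?K\<^esub>" using x0 xy(1) by simp
    qed
    show "?s ` carrier (mod_sum ?I ?K) = carrier X"
    proof (intro equalityI subsetI)
      fix x assume x: "x \<in> carrier X"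
      obtain z where z: "z \<in> carrier X" "x \<ominus>\<^bsub>X\<^esub> ?g z \<in> ?V k" using span[OF x] by (rule bexE)
      have "x = ?s (?g z, x \<ominus>\<^bsub>X\<^esub> ?g z)" using x rhom_closed[OF hn z(1)] by (simp add: X.add_diff_cancel)
      moreover have "(?g z, x \<ominus>\<^bsub>X\<^esub> ?g z) \<in> carrier (mod_sum ?I ?K)" using z by simp
      ultimately show "x \<in> ?s ` carrier (mod_sum ?I ?K)" by (rule image_eqI)
    qed (use rhom_closed[OF s] in blast)
  qed
  then consider "zero_mod ?I" | "zero_mod ?K"
    using indecomposableD[OF X fg_mod_submodule[OF artin fgX subU] fg_mod_submodule[OF artin fgX subV]] by blast
  then show ?thesis
  proof cases
    case 1
    then have "?U k = {\<zero>\<^bsub>X\<^esub>}" by (simp add: zero_mod_def)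
    then have "\<forall>x\<in>carrier X. ?g x = \<zero>\<^bsub>X\<^esub>" by blast
    then show ?thesis by blast
  next
    case 2
    then have V: "?V k = {\<zero>\<^bsub>X\<^esub>}" by (simp add: zero_mod_def)
    have hk: "?g x = (h ^^ (n + m)) (h x)" "?g x = h ((h ^^ (n + m)) x)" for x
      by (simp_all add: k_def funpow_swap1)
    have "inj_on h (carrier X)" unfolding rhom_inj_iff[OF rX rX h]
    proof (intro ballI impI)
      fix x assume x: "x \<in> carrier X" "h x = \<zero>\<^bsub>X\<^esub>"
      then have "x \<in> ?V k" using hk(1)[of x] rhom_zero[OF hn rX rX] by simp
      then show "x = \<zero>\<^bsub>X\<^esub>" using V by blast
    qed
    moreover have "h ` carrier X = carrier X"
    proof (intro equalityI subsetI)
      fix x assume x: "x \<in> carrier X"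
      obtain z where z: "z \<in> carrier X" "x \<ominus>\<^bsub>X\<^esub> ?g z \<in> ?V k" using span[OF x] by (rule bexE)
      then have "x \<ominus>\<^bsub>X\<^esub> ?g z = \<zero>\<^bsub>X\<^esub>" using V by blast
      then have "x = ?g z" using x rhom_closed[OF hn z(1), of k] X.diff_eq_iff[of x "?g z" "\<zero>\<^bsub>X\<^esub>"] by simp
      then have "x = h ((h ^^ (n + m)) z)" by (simp only: hk(2)[symmetric])
      then show "x \<in> h ` carrier X" using rhom_closed[OF hn z(1)] by blast
    qed (use rhom_closed[OF h] in blast)
    ultimately show ?thesis by (simp add: bij_betw_def)
  qed
qed

lemma nilpotent_not_injective:
  assumes X: "indecomposable R X" and h: "h \<in> rhom R X X" and nil: "\<forall>x\<in>carrier X. (h ^^ n) x = \<zero>\<^bsub>X\<^esub>"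
    and inj: "inj_on h (carrier X)"
  shows False
proof -
  have rX: "right_module R X" and nz: "\<not> zero_mod X" using X by (auto simp: indecomposable_def fg_mod_def)
  interpret X: right_module R X by (rule rX)
  have "inj_on (h ^^ n) (carrier X)" for n
  proof (induction n)
    case (Suc n)
    have "(h ^^ n) ` carrier X \<subseteq> carrier X" using rhom_closed[OF rhom_funpow[OF h]] by blast
    then show ?case using comp_inj_on[OF Suc inj_on_subset[OF inj]] by (simp add: comp_def)
  qed simp
  then have "x = \<zero>\<^bsub>X\<^esub>" if "x \<in> carrier X" for x
    using nil that unfolding rhom_inj_iff[OF rX rX rhom_funpow[OF h]] by blast
  then show False using nz unfolding zero_mod_def by blast
qed

lemma zero_map_not_bij:
  assumes "indecomposable R X" "\<And>x. x \<in> carrier X \<Longrightarrow> t x = \<zero>\<^bsub>X\<^esub>"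
  shows "\<not> bij_betw t (carrier X) (carrier X)"
proof
  assume b: "bij_betw t (carrier X) (carrier X)"
  interpret right_module R X using assms(1) by (auto simp: indecomposable_def fg_mod_def)
  have "carrier X \<subseteq> {\<zero>\<^bsub>X\<^esub>}" using b assms(2) by (auto simp: bij_betw_def)
  then have "zero_mod X" unfolding zero_mod_def by auto
  then show False using assms(1) by (simp add: indecomposable_def)
qed

text \<open>The endomorphism ring of an indecomposable module is local: normalize the invertible sum to
  \<open>s + t = 1\<close>; if \<open>t\<close> is not invertible, it is nilpotent, so \<open>s = 1 - t\<close> is injective, hence not
  nilpotent, hence invertible.\<close>

lemma local_endomorphisms:
  assumes X: "indecomposable R X" and s: "s \<in> rhom R X X" and t: "t \<in> rhom R X X"
    and bij: "bij_betw r (carrier X) (carrier X)" and r: "\<And>x. x \<in> carrier X \<Longrightarrow> r x = s x \<oplus>\<^bsub>X\<^esub> t x"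
  shows "bij_betw s (carrier X) (carrier X) \<or> bij_betw t (carrier X) (carrier X)"
proof (rule disjCI)
  assume nt: "\<not> bij_betw t (carrier X) (carrier X)"
  have rX: "right_module R X" using X by (auto simp: indecomposable_def fg_mod_def)
  interpret X: right_module R X by (rule rX)
  have rh: "r \<in> rhom R X X" by (rule rhom_cong[OF rhom_plus[OF rX s t] rX r])
  obtain w where w: "w \<in> rhom R X X" "\<And>x. x \<in> carrier X \<Longrightarrow> w (r x) = x" "\<And>x. x \<in> carrier X \<Longrightarrow> r (w x) = x"
    by (rule rhom_bij_inverse[OF rX rh bij]) (rule that)
  have unwind: "bij_betw v (carrier X) (carrier X)"
    if v: "v \<in> rhom R X X" "bij_betw (\<lambda>x. w (v x)) (carrier X) (carrier X)" for v
  proof -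
    have "bij_betw (\<lambda>x. r (w (v x))) (carrier X) (carrier X)"
      using bij_betw_trans[OF v(2) bij] by (simp add: comp_def)
    then show ?thesis by (rule iffD1[OF bij_betw_cong, rotated]) (simp add: w(3) rhom_closed[OF v(1)])
  qed
  have ws: "(\<lambda>x. w (s x)) \<in> rhom R X X" and wt: "(\<lambda>x. w (t x)) \<in> rhom R X X"
    by (rule rhom_comp[OF s w(1)], rule rhom_comp[OF t w(1)])
  have sum: "x = w (s x) \<oplus>\<^bsub>X\<^esub> w (t x)" if x: "x \<in> carrier X" for x
    using w(2)[OF x] r[OF x] rhom_add[OF w(1) rhom_closed[OF s x] rhom_closed[OF t x]] by simp
  have "\<not> bij_betw (\<lambda>x. w (t x)) (carrier X) (carrier X)" using unwind[OF t] nt by blast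
  then obtain n where n: "\<forall>x\<in>carrier X. ((\<lambda>x. w (t x)) ^^ n) x = \<zero>\<^bsub>X\<^esub>"
    using fitting[OF X wt] by blast
  have inj: "inj_on (\<lambda>x. w (s x)) (carrier X)" unfolding rhom_inj_iff[OF rX rX ws]
  proof (intro ballI impI)
    fix x assume x: "x \<in> carrier X" "w (s x) = \<zero>\<^bsub>X\<^esub>"
    then have fx: "w (t x) = x" using sum[OF x(1)] rhom_closed[OF wt x(1)] by simp
    have "((\<lambda>x. w (t x)) ^^ k) x = x" for k by (induction k) (simp_all add: fx)
    then show "x = \<zero>\<^bsub>X\<^esub>" using n x(1) by metis
  qed
  have "bij_betw (\<lambda>x. w (s x)) (carrier X) (carrier X)"
    using fitting[OF X ws] nilpotent_not_injective[OF X ws _ inj] by blast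
  then show "bij_betw s (carrier X) (carrier X)" by (rule unwind[OF s])
qed

text \<open>The composite is the sum of its parts through the single coordinates.\<close>

lemma local_through_sum:
  assumes X: "indecomposable R X" and N: "\<And>i. i < n \<Longrightarrow> right_module R (N i)"
    and s: "s \<in> rhom R X (finite_mod_sum n N)" and t: "t \<in> rhom R (finite_mod_sum n N) X"
    and bij: "bij_betw (\<lambda>x. t (s x)) (carrier X) (carrier X)"
  shows "\<exists>i<n. bij_betw (\<lambda>x. t (\<lambda>j\<in>{..<n}. if j = i then s x i else \<zero>\<^bsub>N j\<^esub>)) (carrier X) (carrier X)"
proof -
  have rX: "right_module R X" using X by (auto simp: indecomposable_def fg_mod_def)
  interpret X: right_module R X by (rule rX)
  let ?W = "finite_mod_sum n N"
  have rW: "right_module R ?W" by (rule right_module_finite_mod_sum[OF X.R.ring_axioms N])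
  let ?p = "\<lambda>k w. \<lambda>j\<in>{..<n}. if j < k then w j else \<zero>\<^bsub>N j\<^esub>"
  let ?e = "\<lambda>i w. \<lambda>j\<in>{..<n}. if j = i then w i else \<zero>\<^bsub>N j\<^esub>"
  have p: "?p k \<in> rhom R ?W ?W" for k
  proof (rule rhom_tuple)
    fix j assume j: "j < n"
    show "(\<lambda>w. if j < k then w j else \<zero>\<^bsub>N j\<^esub>) \<in> rhom R ?W (N j)"
      using rhom_proj[OF j] rhom_zero_map[OF N[OF j]] by (cases "j < k") auto
  qed
  have e: "?e i \<in> rhom R ?W ?W" if i: "i < n" for i
    using rhom_comp[OF rhom_proj[OF i] rhom_inj_summand[OF i N]] .
  have ag: "x \<oplus>\<^bsub>N j\<^esub> \<zero>\<^bsub>N j\<^esub> = x" "\<zero>\<^bsub>N j\<^esub> \<oplus>\<^bsub>N j\<^esub> x = x" "\<zero>\<^bsub>N j\<^esub> \<in> carrier (N j)" if "j < n" "x \<in> carrier (N j)" for j x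
    using right_moduleD(1)[OF N[OF that(1)]] that(2)
    by (simp_all add: abelian_group.axioms(1) abelian_monoid.r_zero abelian_monoid.l_zero abelian_monoid.zero_closed)
  have z: "\<zero>\<^bsub>N j\<^esub> \<in> carrier (N j)" if "j < n" for j
    using right_moduleD(1)[OF N[OF that]] by (simp add: abelian_group.axioms(1) abelian_monoid.zero_closed)
  have step: "?p (Suc k) w = ?p k w \<oplus>\<^bsub>?W\<^esub> ?e k w" if k: "k < n" and w: "w \<in> carrier ?W" for k w
  proof (rule finite_mod_sum_ext[where n = n and N = N])
    show "?p (Suc k) w \<in> carrier ?W" by (rule rhom_closed[OF p w])
    show "?p k w \<oplus>\<^bsub>?W\<^esub> ?e k w \<in> carrier ?W"
      by (rule abelian_monoid.a_closed[OF abelian_group.axioms(1)[OF right_moduleD(1)[OF rW]] rhom_closed[OF p w] rhom_closed[OF e[OF k] w]])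
    fix i assume i: "i < n"
    note wi = finite_mod_sum_mem[OF w i]
    show "?p (Suc k) w i = (?p k w \<oplus>\<^bsub>?W\<^esub> ?e k w) i"
      using i wi z[OF i] by (cases i k rule: linorder_cases) (simp_all add: ag)
  qed
  have main: "\<exists>i<k. bij_betw (\<lambda>x. t (?e i (s x))) (carrier X) (carrier X)"
    if "k \<le> n" "bij_betw (\<lambda>x. t (?p k (s x))) (carrier X) (carrier X)" for k
    using that
  proof (induction k)
    case 0
    have "?p 0 (s x) = \<zero>\<^bsub>?W\<^esub>" for x by (simp add: restrict_def)
    then have "t (?p 0 (s x)) = \<zero>\<^bsub>X\<^esub>" for x using rhom_zero[OF t rW rX] by simp
    then show ?case using zero_map_not_bij[OF X, of "\<lambda>x. t (?p 0 (s x))"] 0(2) by blast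
  next
    case (Suc k)
    then have k: "k < n" by simp
    have "bij_betw (\<lambda>x. t (?p k (s x))) (carrier X) (carrier X) \<or>
      bij_betw (\<lambda>x. t (?e k (s x))) (carrier X) (carrier X)"
    proof (rule local_endomorphisms[OF X _ _ Suc.prems(2)])
      show "(\<lambda>x. t (?p k (s x))) \<in> rhom R X X" by (rule rhom_comp[OF rhom_comp[OF s p] t])
      show "(\<lambda>x. t (?e k (s x))) \<in> rhom R X X" by (rule rhom_comp[OF rhom_comp[OF s e[OF k]] t])
      fix x assume x: "x \<in> carrier X"
      note sx = rhom_closed[OF s x]
      show "t (?p (Suc k) (s x)) = t (?p k (s x)) \<oplus>\<^bsub>X\<^esub> t (?e k (s x))"
        unfolding step[OF k sx] by (rule rhom_add[OF t rhom_closed[OF p sx] rhom_closed[OF e[OF k] sx]])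
    qed
    then show ?case
    proof
      assume "bij_betw (\<lambda>x. t (?p k (s x))) (carrier X) (carrier X)"
      from Suc.IH[OF Suc_leD[OF Suc.prems(1)] this] show ?thesis
        by (elim exE conjE) (intro exI conjI, erule less_SucI, assumption)
    next
      assume "bij_betw (\<lambda>x. t (?e k (s x))) (carrier X) (carrier X)"
      then show ?thesis by (intro exI[of _ k] conjI lessI)
    qed
  qed
  show ?thesis
  proof (rule main[OF order_refl])
    have "?p n (s x) = s x" if x: "x \<in> carrier X" for x
      by (rule finite_mod_sum_ext[OF rhom_closed[OF p rhom_closed[OF s x]] rhom_closed[OF s x]]) simp
    then have "bij_betw (\<lambda>x. t (?p n (s x))) (carrier X) (carrier X) = bij_betw (\<lambda>x. t (s x)) (carrier X) (carrier X)"
      by (intro bij_betw_cong) simp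
    then show "bij_betw (\<lambda>x. t (?p n (s x))) (carrier X) (carrier X)" using bij by simp
  qed
qed

text \<open>The identity of \<open>X\<close> is a sum of maps through \<open>M\<close>; as the endomorphism ring is local, one of them
  is invertible.\<close>

lemma indecomposable_in_add:
  assumes X: "indecomposable R X" and M: "fg_mod R M" and XM: "in_add R M X"
  shows "\<exists>a\<in>rhom R X M. \<exists>b\<in>rhom R M X. bij_betw (\<lambda>x. b (a x)) (carrier X) (carrier X)"
proof -
  have rX: "right_module R X" using X by (auto simp: indecomposable_def fg_mod_def)
  have "bij_betw t (carrier X) (carrier X) \<Longrightarrow> ?thesis" if "factors R M X X t" for t
    using that
  proof induction
    case (zero t)
    then show ?case using zero_map_not_bij[OF X] by blast
  next
    case (step s a b t)
    have "bij_betw s (carrier X) (carrier X) \<or> bij_betw (\<lambda>x. b (a x)) (carrier X) (carrier X)"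
      by (rule local_endomorphisms[OF X factors_rhom[OF step.hyps(1) rX rX] rhom_comp[OF step.hyps(2,3)] step.prems step.hyps(4)])
    then show ?case using step.IH step.hyps(2,3) by blast
  qed
  moreover have "factors R M X X (\<lambda>x. x)" using XM in_add_iff_factors[OF M] by blast
  ultimately show ?thesis using bij_betw_id unfolding id_def by blast
qed

end

section \<open>Exchanging a summand of a basic module\<close>

context
  fixes K :: "'k ring" and \<phi> :: "'k \<Rightarrow> 'r" and R :: "'r ring"
  assumes artin: "artin_algebra K \<phi> R"
begin

text \<open>If \<open>X \<oplus> M\<close> is a direct sum of indecomposables \<open>N\<^sub>j\<close>, one of them, \<open>N\<^sub>i\<close>, is isomorphic to \<open>X\<close>
  via the \<open>i\<close>-th coordinate, so the kernel of that coordinate is a complement of \<open>X\<close> and hence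
  isomorphic to \<open>M\<close>; the map \<open>\<beta>\<close> is this isomorphism.\<close>

lemma exchange:
  assumes X: "indecomposable R X" and M: "fg_mod R M" and N: "\<And>j. j < n \<Longrightarrow> indecomposable R (N j)"
    and iso: "mod_iso R (mod_sum X M) (finite_mod_sum n N)"
  obtains i \<beta> \<gamma> where "i < n" "mod_iso R X (N i)"
    "\<beta> \<in> rhom R M (finite_mod_sum n N)" "\<gamma> \<in> rhom R (finite_mod_sum n N) M"
    "\<And>m. m \<in> carrier M \<Longrightarrow> \<beta> m i = \<zero>\<^bsub>N i\<^esub>" "\<And>m. m \<in> carrier M \<Longrightarrow> \<gamma> (\<beta> m) = m"
    "\<And>w. w \<in> carrier (finite_mod_sum n N) \<Longrightarrow> w i = \<zero>\<^bsub>N i\<^esub> \<Longrightarrow> \<beta> (\<gamma> w) = w"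
proof -
  let ?W = "finite_mod_sum n N"
  have fgX: "fg_mod R X" and nzX: "\<not> zero_mod X" using X by (auto simp: indecomposable_def)
  note rX = fg_modD(1)[OF fgX] and rM = fg_modD(1)[OF M]
  interpret X: right_module R X by (rule rX)
  interpret M: right_module R M by (rule rM)
  have rN: "right_module R (N j)" if "j < n" for j using N[OF that] by (auto simp: indecomposable_def fg_mod_def)
  have rW: "right_module R ?W" by (rule right_module_finite_mod_sum[OF right_moduleD(2)[OF rX] rN])
  interpret W: right_module R ?W by (rule rW)
  note rS = right_module_mod_sum[OF rX rM]
  obtain \<theta> \<theta>' where \<theta>: "\<theta> \<in> rhom R (mod_sum X M) ?W" "\<theta>' \<in> rhom R ?W (mod_sum X M)"
    "\<And>z. z \<in> carrier (mod_sum X M) \<Longrightarrow> \<theta>' (\<theta> z) = z" "\<And>w. w \<in> carrier ?W \<Longrightarrow> \<theta> (\<theta>' w) = w"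
    by (rule mod_isoE[OF iso rS]) (rule that)
  let ?s = "\<lambda>x. \<theta> (x, \<zero>\<^bsub>M\<^esub>)" and ?t = "\<lambda>w. fst (\<theta>' w)"
  have s: "?s \<in> rhom R X ?W" by (rule rhom_comp[OF rhom_inl[OF rM] \<theta>(1)])
  have t: "?t \<in> rhom R ?W X" by (rule rhom_comp[OF \<theta>(2) rhom_fst])
  have "bij_betw (\<lambda>x. x) (carrier X) (carrier X)" using bij_betw_id by (simp add: id_def)
  then have "bij_betw (\<lambda>x. ?t (?s x)) (carrier X) (carrier X)"
    by (rule iffD1[OF bij_betw_cong, rotated]) (simp add: \<theta>(3))
  then obtain i where i: "i < n"
    and bij: "bij_betw (\<lambda>x. ?t (\<lambda>j\<in>{..<n}. if j = i then ?s x i else \<zero>\<^bsub>N j\<^esub>)) (carrier X) (carrier X)"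
    using local_through_sum[OF artin X rN s t] by blast
  interpret Ni: right_module R "N i" by (rule rN[OF i])
  let ?a = "\<lambda>x. \<theta> (x, \<zero>\<^bsub>M\<^esub>) i"
  have a: "?a \<in> rhom R X (N i)" by (rule rhom_comp[OF s rhom_proj[OF i]])
  have "bij_betw ?a (carrier X) (carrier (N i))"
    by (rule indecomposable_retract[OF N[OF i] fgX nzX a rhom_comp[OF rhom_inj_summand[OF i rN] t] bij])
  then obtain a' where a': "a' \<in> rhom R (N i) X" "\<And>x. x \<in> carrier X \<Longrightarrow> a' (?a x) = x"
    "\<And>z. z \<in> carrier (N i) \<Longrightarrow> ?a (a' z) = z"
    by (rule rhom_bij_inverse[OF rX a]) (rule that)
  have isoXN: "mod_iso R X (N i)" by (rule mod_isoI[OF a a'(1)]) (use a' in auto)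
  let ?c = "\<lambda>m. \<theta> (\<zero>\<^bsub>X\<^esub>, m) i"
  have c: "?c \<in> rhom R M (N i)"
    by (rule rhom_comp[OF rhom_comp[OF rhom_inr[OF rX] \<theta>(1)] rhom_proj[OF i]])
  define \<beta> where "\<beta> m = \<theta> (\<ominus>\<^bsub>X\<^esub> a' (?c m), m)" for m
  define \<gamma> where "\<gamma> w = snd (\<theta>' w)" for w
  have b: "\<beta> \<in> rhom R M ?W"
    using rhom_comp[OF rhom_pair[OF rhom_uminus[OF rX rhom_comp[OF c a'(1)]] rhom_id] \<theta>(1)]
    by (simp add: \<beta>_def[abs_def])
  have g: "\<gamma> \<in> rhom R ?W M" using rhom_comp[OF \<theta>(2) rhom_snd] by (simp add: \<gamma>_def[abs_def])
  have split: "\<theta> (x, m) i = ?a x \<oplus>\<^bsub>N i\<^esub> ?c m" if "x \<in> carrier X" "m \<in> carrier M" for x m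
    using rhom_add[OF rhom_comp[OF \<theta>(1) rhom_proj[OF i]], of "(x, \<zero>\<^bsub>M\<^esub>)" "(\<zero>\<^bsub>X\<^esub>, m)"] that by simp
  have "\<beta> m i = \<zero>\<^bsub>N i\<^esub>" if m: "m \<in> carrier M" for m
  proof -
    note cm = rhom_closed[OF c m] and acm = rhom_closed[OF a'(1) rhom_closed[OF c m]]
    have "\<beta> m i = ?a (\<ominus>\<^bsub>X\<^esub> a' (?c m)) \<oplus>\<^bsub>N i\<^esub> ?c m" unfolding \<beta>_def by (rule split[OF X.a_inv_closed[OF acm] m])
    also have "\<dots> = \<zero>\<^bsub>N i\<^esub>"
      using rhom_neg[OF a rX rN[OF i] acm] a'(3)[OF cm] cm by (simp add: Ni.l_neg)
    finally show ?thesis .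
  qed
  moreover have "\<gamma> (\<beta> m) = m" if m: "m \<in> carrier M" for m
    using \<theta>(3)[of "(\<ominus>\<^bsub>X\<^esub> a' (?c m), m)"] m rhom_closed[OF a'(1) rhom_closed[OF c m]]
    by (simp add: \<beta>_def \<gamma>_def)
  moreover have "\<beta> (\<gamma> w) = w" if w: "w \<in> carrier ?W" "w i = \<zero>\<^bsub>N i\<^esub>" for w
  proof -
    obtain x m where xm: "\<theta>' w = (x, m)" "x \<in> carrier X" "m \<in> carrier M"
      using rhom_closed[OF \<theta>(2) w(1)] by (cases "\<theta>' w") auto
    have wx: "\<theta> (x, m) = w" using \<theta>(4)[OF w(1)] xm(1) by simp
    note cm = rhom_closed[OF c xm(3)] and ax = rhom_closed[OF a xm(2)]
    have "?a x \<oplus>\<^bsub>N i\<^esub> ?c m = \<zero>\<^bsub>N i\<^esub>" using split[OF xm(2,3)] wx w(2) by simp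
    then have "?c m = \<ominus>\<^bsub>N i\<^esub> ?a x" using Ni.minus_equality[of "?c m" "?a x"] cm ax by (simp add: Ni.a_comm)
    then have "a' (?c m) = \<ominus>\<^bsub>X\<^esub> x"
      using rhom_neg[OF a'(1) rN[OF i] rX ax] a'(2)[OF xm(2)] by simp
    then show ?thesis using xm wx by (simp add: \<beta>_def \<gamma>_def)
  qed
  ultimately show thesis by (intro that[OF i isoXN b g])
qed

text \<open>Were \<open>X\<close> in \<open>add M\<close>, it would be isomorphic to some \<open>N\<^sub>j\<close> with \<open>j \<noteq> i\<close> as well as to \<open>N\<^sub>i\<close>.  For \<open>Y\<close> in
  place of \<open>X\<close>, the \<open>i\<close>-th summand is replaced; the other ones are in \<open>add M\<close>, hence not isomorphic
  to \<open>Y\<close>.\<close>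

lemma basic_mod_exchange:
  assumes X: "indecomposable R X" and M: "fg_mod R M" and basic: "basic_mod R (mod_sum X M)"
  shows "\<not> in_add R M X"
    and "indecomposable R Y \<Longrightarrow> \<not> in_add R M Y \<Longrightarrow> basic_mod R (mod_sum Y M)"
proof -
  have fgX: "fg_mod R X" using X by (simp add: indecomposable_def)
  note rX = fg_modD(1)[OF fgX] and rM = fg_modD(1)[OF M]
  obtain n and N :: "nat \<Rightarrow> 'r umod" where N: "\<And>j. j < n \<Longrightarrow> indecomposable R (N j)"
    and dist: "\<And>j l. j < n \<Longrightarrow> l < n \<Longrightarrow> j \<noteq> l \<Longrightarrow> \<not> mod_iso R (N j) (N l)"
    and iso: "mod_iso R (mod_sum X M) (finite_mod_sum n N)"
    using basic unfolding basic_mod_def by blast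
  let ?W = "finite_mod_sum n N"
  obtain i \<beta> \<gamma> where i: "i < n" "mod_iso R X (N i)" and b: "\<beta> \<in> rhom R M ?W" and g: "\<gamma> \<in> rhom R ?W M"
    and bi: "\<And>m. m \<in> carrier M \<Longrightarrow> \<beta> m i = \<zero>\<^bsub>N i\<^esub>" and gb: "\<And>m. m \<in> carrier M \<Longrightarrow> \<gamma> (\<beta> m) = m"
    and bg: "\<And>w. w \<in> carrier ?W \<Longrightarrow> w i = \<zero>\<^bsub>N i\<^esub> \<Longrightarrow> \<beta> (\<gamma> w) = w"
    by (rule exchange[OF X M N iso]) (assumption, rule that)
  have fgN: "fg_mod R (N j)" if "j < n" for j using N[OF that] by (simp add: indecomposable_def)
  note rN = fg_modD(1)[OF fgN]
  interpret M: right_module R M by (rule rM)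
  interpret X: right_module R X by (rule rX)
  have rW: "right_module R ?W" by (rule right_module_finite_mod_sum[OF right_moduleD(2)[OF rX] rN])
  show "\<not> in_add R M X"
  proof
    assume "in_add R M X"
    then obtain a c where ac: "a \<in> rhom R X M" "c \<in> rhom R M X" "bij_betw (\<lambda>x. c (a x)) (carrier X) (carrier X)"
      using indecomposable_in_add[OF artin X M] by blast
    let ?s = "\<lambda>x. \<beta> (a x)" and ?t = "\<lambda>w. c (\<gamma> w)"
    have s: "?s \<in> rhom R X ?W" and t: "?t \<in> rhom R ?W X"
      by (rule rhom_comp[OF ac(1) b], rule rhom_comp[OF g ac(2)])
    have "bij_betw (\<lambda>x. ?t (?s x)) (carrier X) (carrier X)"
      using ac(3) by (rule iffD1[OF bij_betw_cong, rotated]) (simp add: gb rhom_closed[OF ac(1)])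
    then obtain l where l: "l < n"
      and bij: "bij_betw (\<lambda>x. ?t (\<lambda>j\<in>{..<n}. if j = l then ?s x l else \<zero>\<^bsub>N j\<^esub>)) (carrier X) (carrier X)"
      using local_through_sum[OF artin X rN s t] by blast
    have "l \<noteq> i"
    proof
      assume "l = i"
      have zero: "?t (\<lambda>j\<in>{..<n}. if j = l then ?s x l else \<zero>\<^bsub>N j\<^esub>) = \<zero>\<^bsub>X\<^esub>" if x: "x \<in> carrier X" for x
      proof -
        have "?s x l = \<zero>\<^bsub>N l\<^esub>" using bi[OF rhom_closed[OF ac(1) x]] \<open>l = i\<close> by simp
        then have "(\<lambda>j\<in>{..<n}. if j = l then ?s x l else \<zero>\<^bsub>N j\<^esub>) = \<zero>\<^bsub>?W\<^esub>"
          unfolding finite_mod_sum_simps(2) by (intro restrict_ext) simp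
        then show ?thesis using rhom_zero[OF t rW rX] by simp
      qed
      show False by (rule notE[OF zero_map_not_bij[OF artin X] bij]) (rule zero)
    qed
    have sl: "(\<lambda>x. ?s x l) \<in> rhom R X (N l)" by (rule rhom_comp[OF s rhom_proj[OF l]])
    have "\<not> zero_mod X" using X by (simp add: indecomposable_def)
    then have "bij_betw (\<lambda>x. ?s x l) (carrier X) (carrier (N l))"
      by (rule indecomposable_retract[OF N[OF l] fgX _ sl rhom_comp[OF rhom_inj_summand[OF l rN] t] bij])
    then have "mod_iso R X (N l)" using sl unfolding mod_iso_def by blast
    then have "mod_iso R (N i) (N l)" using mod_iso_trans[OF mod_iso_sym[OF i(2) rX]] by blast
    then show False using dist[OF i(1) l] \<open>l \<noteq> i\<close> by blast
  qed
  have NM: "in_add R M (N j)" if j: "j < n" "j \<noteq> i" for j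
  proof (rule in_add_retract[OF M in_add_self[OF M] rN[OF j(1)]])
    let ?e = "\<lambda>x. \<lambda>l\<in>{..<n}. if l = j then x else \<zero>\<^bsub>N l\<^esub>"
    have e: "?e \<in> rhom R (N j) ?W" by (rule rhom_inj_summand[OF j(1) rN])
    show "(\<lambda>x. \<gamma> (?e x)) \<in> rhom R (N j) M" by (rule rhom_comp[OF e g])
    show "(\<lambda>m. \<beta> m j) \<in> rhom R M (N j)" by (rule rhom_comp[OF b rhom_proj[OF j(1)]])
    fix x assume x: "x \<in> carrier (N j)"
    have "?e x i = \<zero>\<^bsub>N i\<^esub>" using i(1) j by simp
    then have "\<beta> (\<gamma> (?e x)) = ?e x" by (rule bg[OF rhom_closed[OF e x]])
    then show "\<beta> (\<gamma> (?e x)) j = x" using j(1) by simp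
  qed
  assume Y: "indecomposable R Y" and nY: "\<not> in_add R M Y"
  have fgY: "fg_mod R Y" using Y by (simp add: indecomposable_def)
  note rY = fg_modD(1)[OF fgY]
  obtain Y' :: "'r umod" where Y': "fg_mod R Y'" "mod_iso R Y Y'" using fg_mod_representative[OF fgY] by blast
  note rY' = fg_modD(1)[OF Y'(1)]
  obtain y y' where y: "y \<in> rhom R Y Y'" "y' \<in> rhom R Y' Y" "\<And>x. x \<in> carrier Y \<Longrightarrow> y' (y x) = x"
    "\<And>x. x \<in> carrier Y' \<Longrightarrow> y (y' x) = x"
    by (rule mod_isoE[OF Y'(2) rY]) (rule that)
  interpret Y: right_module R Y by (rule rY)
  let ?N = "N(i := Y')"
  let ?V = "finite_mod_sum n ?N"
  have "indecomposable R (?N j)" if "j < n" for j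
    using N[OF that] indecomposable_iso[OF Y Y'(2) rY'] by simp
  moreover have "\<not> mod_iso R (?N j) (?N l)" if jl: "j < n" "l < n" "j \<noteq> l" for j l
  proof
    have no: "\<not> mod_iso R (N k) Y'" if k: "k < n" "k \<noteq> i" for k
    proof
      assume "mod_iso R (N k) Y'"
      then have "mod_iso R (N k) Y" using mod_iso_trans mod_iso_sym[OF Y'(2) rY] by blast
      then show False using in_add_iso[OF M NM[OF k] _ rY] nY by blast
    qed
    assume *: "mod_iso R (?N j) (?N l)"
    consider "j = i" | "l = i" | "j \<noteq> i" "l \<noteq> i" by blast
    then show False
    proof cases
      case 1
      then have "mod_iso R Y' (N l)" using * jl(3) by simp
      then show False using no[OF jl(2)] mod_iso_sym[OF _ rY'] 1 jl(3) by blast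
    next
      case 2
      then show False using * no[OF jl(1)] jl(3) by simp
    next
      case 3
      then show False using * dist[OF jl] by simp
    qed
  qed
  moreover have "mod_iso R (mod_sum Y M) ?V"
  proof -
    \<comment> \<open>\<open>?D\<close> erases the new summand, so that \<open>\<gamma>\<close> can be applied.\<close>
    let ?D = "\<lambda>v. \<lambda>j\<in>{..<n}. if j = i then \<zero>\<^bsub>N i\<^esub> else v j"
    let ?F = "\<lambda>z. \<lambda>j\<in>{..<n}. if j = i then y (fst z) else \<beta> (snd z) j"
    let ?G = "\<lambda>v. (y' (v i), \<gamma> (?D v))"
    have D: "?D \<in> rhom R ?V ?W"
    proof (rule rhom_tuple)
      fix j assume j: "j < n"
      show "(\<lambda>v. if j = i then \<zero>\<^bsub>N i\<^esub> else v j) \<in> rhom R ?V (N j)"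
        using rhom_proj[OF j, of R ?N] rhom_zero_map[OF rN[OF j]] by (cases "j = i") auto
    qed
    have vi: "(\<lambda>v. v i) \<in> rhom R ?V Y'" using rhom_proj[OF i(1), of R ?N] by simp
    show ?thesis
    proof (rule mod_isoI)
      show "?F \<in> rhom R (mod_sum Y M) ?V"
      proof (rule rhom_tuple)
        fix j assume j: "j < n"
        show "(\<lambda>z. if j = i then y (fst z) else \<beta> (snd z) j) \<in> rhom R (mod_sum Y M) (?N j)"
          using rhom_comp[OF rhom_fst y(1)] rhom_comp[OF rhom_comp[OF rhom_snd b] rhom_proj[OF j]]
          by (cases "j = i") auto
      qed
      show "?G \<in> rhom R ?V (mod_sum Y M)"
        by (rule rhom_pair[OF rhom_comp[OF vi y(2)] rhom_comp[OF D g]])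
      show "?G (?F z) = z" if z: "z \<in> carrier (mod_sum Y M)" for z
      proof -
        obtain u m where um: "z = (u, m)" "u \<in> carrier Y" "m \<in> carrier M" using z by auto
        note bm = rhom_closed[OF b um(3)]
        have "?D (?F (u, m)) = \<beta> m"
        proof (rule finite_mod_sum_ext[OF _ bm])
          show "?D (?F (u, m)) j = \<beta> m j" if "j < n" for j using that bi[OF um(3)] by simp
          then have "?D (?F (u, m)) = (\<lambda>j\<in>{..<n}. \<beta> m j)" by (auto simp: restrict_def fun_eq_iff)
          then show "?D (?F (u, m)) \<in> carrier ?W" using finite_mod_sum_mem[OF bm] by simp
        qed
        then have "\<gamma> (?D (?F (u, m))) = m" using gb[OF um(3)] by (simp only:)
        moreover have "y' (?F (u, m) i) = u" using i(1) y(3)[OF um(2)] by simp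
        ultimately show ?thesis unfolding um(1) by blast
      qed
      show "?F (?G v) = v" if v: "v \<in> carrier ?V" for v
      proof (rule finite_mod_sum_ext[OF _ v])
        note Dv = rhom_closed[OF D v]
        have "?D v i = \<zero>\<^bsub>N i\<^esub>" using i(1) by simp
        then have bD: "\<beta> (\<gamma> (?D v)) = ?D v" by (rule bg[OF Dv])
        have vi': "v i \<in> carrier Y'" using rhom_closed[OF vi v] .
        show "?F (?G v) j = v j" if j: "j < n" for j
        proof (cases "j = i")
          case True
          then show ?thesis using j y(4)[OF vi'] by simp
        next
          case False
          have "?F (?G v) j = \<beta> (\<gamma> (?D v)) j" using j False by simp
          also have "\<dots> = v j" unfolding bD using j False by simp
          finally show ?thesis .
        qed
        then have "?F (?G v) = (\<lambda>j\<in>{..<n}. v j)" by (auto simp: restrict_def fun_eq_iff)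
        then show "?F (?G v) \<in> carrier ?V" using finite_mod_sum_mem[OF v] by simp
      qed
    qed
  qed
  ultimately show "basic_mod R (mod_sum Y M)"
    unfolding basic_mod_def using fg_mod_sum[OF fgY M] by (intro conjI exI[of _ n] exI[of _ ?N]) blast+
qed

section \<open>Cokernels of minimal left approximations\<close>

text \<open>An idempotent \<open>e\<close> of \<open>Y\<close> lifts along \<open>M' \<rightarrow> Y\<close>.  If the restriction of the lift \<open>e'\<close> to \<open>X\<close> is
  nilpotent, then \<open>1 - e'\<^sup>n\<close> fixes the approximation for some \<open>n \<ge> 1\<close>, so by minimality it is onto;
  it induces \<open>1 - e\<close> on \<open>Y\<close>, whence \<open>e = 0\<close>.\<close>

lemma idempotent_zero_if_nilpotent_restriction:
  assumes ex: "short_exact R X f M' g Y" and rm: "right_module R X" "right_module R M'" "right_module R Y"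
    and min: "\<And>h. h \<in> rhom R M' M' \<Longrightarrow> (\<And>x. x \<in> carrier X \<Longrightarrow> h (f x) = f x) \<Longrightarrow> bij_betw h (carrier M') (carrier M')"
    and e: "e \<in> rhom R Y Y" "\<And>z. z \<in> carrier Y \<Longrightarrow> e (e z) = e z"
    and e': "e' \<in> rhom R M' M'" "\<And>m. m \<in> carrier M' \<Longrightarrow> g (e' m) = e (g m)"
    and d: "d \<in> rhom R X X" "\<And>x. x \<in> carrier X \<Longrightarrow> f (d x) = e' (f x)"
    and nil: "\<And>x. x \<in> carrier X \<Longrightarrow> (d ^^ n) x = \<zero>\<^bsub>X\<^esub>" and z: "z \<in> carrier Y"
  shows "e z = \<zero>\<^bsub>Y\<^esub>"
proof -
  note D = short_exactD[OF ex]
  interpret M': right_module R M' by (rule rm)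
  interpret Y: right_module R Y by (rule rm)
  note ek = rhom_funpow[OF e'(1)] and dk = rhom_funpow[OF d(1)]
  have fd: "(e' ^^ k) (f x) = f ((d ^^ k) x)" if x: "x \<in> carrier X" for k x
    by (induction k) (simp_all add: d(2) rhom_closed[OF dk x])
  have ge: "g ((e' ^^ Suc k) m) = e (g m)" if m: "m \<in> carrier M'" for k m
  proof (induction k)
    case (Suc k)
    have "g (e' ((e' ^^ Suc k) m)) = e (g ((e' ^^ Suc k) m))" by (rule e'(2)[OF rhom_closed[OF ek m]])
    then show ?case using Suc e(2)[OF rhom_closed[OF D(2) m]] by simp
  qed (simp add: e'(2) m)
  \<comment> \<open>The exponent must be positive for \<open>e'\<^sup>k\<close> to induce \<open>e\<close>.\<close>
  let ?h = "\<lambda>m. m \<ominus>\<^bsub>M'\<^esub> (e' ^^ Suc n) m"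
  have h: "?h \<in> rhom R M' M'" by (rule rhom_minus[OF rm(2) rhom_id ek])
  have "?h (f x) = f x" if x: "x \<in> carrier X" for x
  proof -
    have "(e' ^^ Suc n) (f x) = f (d ((d ^^ n) x))" using fd[OF x, of "Suc n"] by simp
    also have "\<dots> = \<zero>\<^bsub>M'\<^esub>" using nil[OF x] rhom_zero[OF d(1) rm(1,1)] rhom_zero[OF D(1) rm(1,2)] by simp
    finally show ?thesis using rhom_closed[OF D(1) x] by simp
  qed
  then have "bij_betw ?h (carrier M') (carrier M')" by (rule min[OF h])
  then have surj: "?h ` carrier M' = carrier M'" by (simp add: bij_betw_def)
  obtain m where m: "m \<in> carrier M'" "g m = z" using D(7)[OF z] by (rule bexE)
  have "m \<in> ?h ` carrier M'" unfolding surj by (rule m(1))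
  then obtain m' where m': "m = ?h m'" "m' \<in> carrier M'" by (rule imageE)
  let ?z = "g m'"
  note zc = rhom_closed[OF D(2) m'(2)] and ezc = rhom_closed[OF e(1) rhom_closed[OF D(2) m'(2)]]
  have "z = ?z \<ominus>\<^bsub>Y\<^esub> e ?z"
    using rhom_diff[OF D(2) rm(2,3) m'(2) rhom_closed[OF ek m'(2)], of "Suc n"] ge[OF m'(2), of n] m(2)
    unfolding m'(1) by (simp del: funpow.simps)
  then have "e z = e ?z \<ominus>\<^bsub>Y\<^esub> e (e ?z)" using rhom_diff[OF e(1) rm(3,3) zc ezc] by simp
  then show ?thesis using e(2)[OF zc] ezc by (simp add: Y.minus_eq Y.r_neg)
qed

text \<open>If \<open>Y = A \<oplus> B\<close>, the projections lift to \<open>e'\<close> and \<open>1 - e'\<close>, with restrictions \<open>d\<close> and \<open>1 - d\<close> to \<open>X\<close>.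
  These are not both invertible, since \<open>d(1 - d)\<close> factors through \<open>M'\<close> and \<open>X\<close> is not a summand
  of \<open>M'\<close>; so one of them is nilpotent.\<close>

lemma indecomposable_coker:
  assumes X: "indecomposable R X" and ex: "short_exact R X f M' g Y" and M: "fg_mod R M"
    and M': "in_add R M M'" and Y: "right_module R Y" and nX: "\<not> in_add R M X" and ez: "ext_zero R M X"
    and min: "\<And>h. h \<in> rhom R M' M' \<Longrightarrow> (\<And>x. x \<in> carrier X \<Longrightarrow> h (f x) = f x) \<Longrightarrow> bij_betw h (carrier M') (carrier M')"
  shows "indecomposable R Y"
proof -
  have fgX: "fg_mod R X" using X by (simp add: indecomposable_def)
  note rX = fg_modD(1)[OF fgX] and rM' = in_addD(2)[OF M'] and D = short_exactD[OF ex]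
  interpret X: right_module R X by (rule rX)
  interpret M': right_module R M' by (rule rM')
  interpret Y: right_module R Y by (rule Y)
  have fgY: "fg_mod R Y" by (rule fg_mod_image[OF in_addD(1)[OF M'] Y D(2,4)])
  have noret: False if s: "s \<in> rhom R M' X" and bij: "bij_betw (\<lambda>x. s (f x)) (carrier X) (carrier X)" for s
  proof -
    obtain k where k: "k \<in> rhom R X X" "\<And>x. x \<in> carrier X \<Longrightarrow> k (s (f x)) = x"
      by (rule rhom_bij_inverse[OF rX rhom_comp[OF D(1) s] bij]) (rule that)
    have "in_add R M X" by (rule in_add_retract[OF M M' rX D(1) rhom_comp[OF s k(1)]]) (rule k(2))
    then show False using nX by simp
  qed
  have "\<not> zero_mod Y"
  proof
    assume "zero_mod Y"
    then have "g m = \<zero>\<^bsub>Y\<^esub>" if "m \<in> carrier M'" for m using rhom_closed[OF D(2) that] by (simp add: zero_mod_def)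
    then have "m \<in> f ` carrier X" if "m \<in> carrier M'" for m using D(6)[OF that] that by blast
    then have "\<exists>s\<in>rhom R M' X. \<forall>m\<in>carrier M'. f (s m) = m"
      by (intro factor_through_inj[OF rX rM' D(1,3) rhom_id])
    then obtain s where s: "s \<in> rhom R M' X" "\<forall>m\<in>carrier M'. f (s m) = m" by (rule bexE)
    have "s (f x) = x" if x: "x \<in> carrier X" for x
      by (rule inj_onD[OF D(3) _ rhom_closed[OF s(1) rhom_closed[OF D(1) x]] x])
        (use s(2) rhom_closed[OF D(1) x] in blast)
    then have "bij_betw (\<lambda>x. s (f x)) (carrier X) (carrier X)"
      using bij_betw_id[of "carrier X"] by (subst bij_betw_cong[where g = id]) simp_all
    then show False by (rule noret[OF s(1)])
  qed
  moreover have "zero_mod A \<or> zero_mod B" if A: "fg_mod R A" and B: "fg_mod R B" and iso: "mod_iso R Y (mod_sum A B)"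
    for A B :: "'r umod"
  proof -
    note rA = fg_modD(1)[OF A] and rB = fg_modD(1)[OF B]
    interpret A: right_module R A by (rule rA)
    interpret B: right_module R B by (rule rB)
    obtain \<theta> \<theta>' where \<theta>: "\<theta> \<in> rhom R Y (mod_sum A B)" "\<theta>' \<in> rhom R (mod_sum A B) Y"
      "\<And>z. z \<in> carrier Y \<Longrightarrow> \<theta>' (\<theta> z) = z" "\<And>w. w \<in> carrier (mod_sum A B) \<Longrightarrow> \<theta> (\<theta>' w) = w"
      by (rule mod_isoE[OF iso Y]) (rule that)
    define e where "e z = \<theta>' (fst (\<theta> z), \<zero>\<^bsub>B\<^esub>)" for z
    have e: "e \<in> rhom R Y Y"
      using rhom_comp[OF rhom_comp[OF rhom_comp[OF \<theta>(1) rhom_fst] rhom_inl[OF rB]] \<theta>(2)] by (simp add: e_def[abs_def])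
    have fA: "fst (\<theta> z) \<in> carrier A" if "z \<in> carrier Y" for z using rhom_closed[OF rhom_comp[OF \<theta>(1) rhom_fst] that] .
    have ee: "e (e z) = e z" if z: "z \<in> carrier Y" for z
      using \<theta>(4)[of "(fst (\<theta> z), \<zero>\<^bsub>B\<^esub>)"] fA[OF z] by (simp add: e_def)
    have ezM': "ext_zero R M' X" by (rule ext_zero_in_add_left[OF M M' rX ez])
    obtain e' where e': "e' \<in> rhom R M' M'" "\<forall>m\<in>carrier M'. g (e' m) = e (g m)"
      using ext_zero_lift[OF ezM' ex rX rM' Y rM' rhom_comp[OF D(2) e]] by (rule bexE)
    note ge = bspec[OF e'(2)]
    have "e' (f x) \<in> f ` carrier X" if x: "x \<in> carrier X" for x
    proof -
      note fx = rhom_closed[OF D(1) x]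
      have "g (e' (f x)) = \<zero>\<^bsub>Y\<^esub>" using ge[OF fx] D(5)[OF x] rhom_zero[OF e Y Y] by simp
      from D(6)[OF rhom_closed[OF e'(1) fx] this] obtain x' where "x' \<in> carrier X" "f x' = e' (f x)" by (rule bexE)
      then show ?thesis by (intro image_eqI[where x = x']) simp_all
    qed
    then have "\<exists>d\<in>rhom R X X. \<forall>x\<in>carrier X. f (d x) = e' (f x)"
      by (intro factor_through_inj[OF rX rX D(1,3) rhom_comp[OF D(1) e'(1)]])
    then obtain d where d: "d \<in> rhom R X X" "\<forall>x\<in>carrier X. f (d x) = e' (f x)" by (rule bexE)
    note fd = bspec[OF d(2)]
    let ?e2 = "\<lambda>z. z \<ominus>\<^bsub>Y\<^esub> e z" and ?e2' = "\<lambda>m. m \<ominus>\<^bsub>M'\<^esub> e' m" and ?d2 = "\<lambda>x. x \<ominus>\<^bsub>X\<^esub> d x"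
    have e2: "?e2 \<in> rhom R Y Y" by (rule rhom_minus[OF Y rhom_id e])
    have e2': "?e2' \<in> rhom R M' M'" by (rule rhom_minus[OF rM' rhom_id e'(1)])
    have d2: "?d2 \<in> rhom R X X" by (rule rhom_minus[OF rX rhom_id d(1)])
    have "\<not> (bij_betw d (carrier X) (carrier X) \<and> bij_betw ?d2 (carrier X) (carrier X))"
    proof
      assume *: "bij_betw d (carrier X) (carrier X) \<and> bij_betw ?d2 (carrier X) (carrier X)"
      \<comment> \<open>\<open>e'(1 - e')\<close> induces \<open>e(1 - e) = 0\<close> on \<open>Y\<close>, so it maps into \<open>X\<close>.\<close>
      let ?k = "\<lambda>m. e' (?e2' m)"
      have k: "?k \<in> rhom R M' M'" by (rule rhom_comp[OF e2' e'(1)])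
      have "?k m \<in> f ` carrier X" if m: "m \<in> carrier M'" for m
      proof -
        note gm = rhom_closed[OF D(2) m] and em = rhom_closed[OF e'(1) m]
        note egm = rhom_closed[OF e gm]
        have "g (?k m) = e (g m \<ominus>\<^bsub>Y\<^esub> e (g m))"
          using ge[OF rhom_closed[OF e2' m]] rhom_diff[OF D(2) rM' Y m em] ge[OF m] by simp
        also have "\<dots> = \<zero>\<^bsub>Y\<^esub>"
          using rhom_diff[OF e Y Y gm egm] ee[OF gm] egm by (simp add: Y.minus_eq Y.r_neg)
        finally have "g (?k m) = \<zero>\<^bsub>Y\<^esub>" .
        from D(6)[OF rhom_closed[OF k m] this] obtain x where "x \<in> carrier X" "f x = ?k m" by (rule bexE)
        then show ?thesis by (intro image_eqI[where x = x]) simp_all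
      qed
      then have "\<exists>s\<in>rhom R M' X. \<forall>m\<in>carrier M'. f (s m) = ?k m"
        by (intro factor_through_inj[OF rX rM' D(1,3) k])
      then obtain s where s: "s \<in> rhom R M' X" "\<forall>m\<in>carrier M'. f (s m) = ?k m" by (rule bexE)
      have sf: "s (f x) = d (?d2 x)" if x: "x \<in> carrier X" for x
      proof (rule inj_onD[OF D(3)])
        note fx = rhom_closed[OF D(1) x] and dx = rhom_closed[OF d(1) x] and d2x = rhom_closed[OF d2 x]
        have "f (d (?d2 x)) = e' (f (?d2 x))" by (rule fd[OF d2x])
        also have "f (?d2 x) = ?e2' (f x)" using rhom_diff[OF D(1) rX rM' x dx] fd[OF x] by simp
        finally show "f (s (f x)) = f (d (?d2 x))" using bspec[OF s(2) fx] by simp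
        show "s (f x) \<in> carrier X" by (rule rhom_closed[OF s(1) fx])
        show "d (?d2 x) \<in> carrier X" by (rule rhom_closed[OF d(1) d2x])
      qed
      have "bij_betw (\<lambda>x. d (?d2 x)) (carrier X) (carrier X)"
        using bij_betw_trans[OF conjunct2[OF *] conjunct1[OF *]] by (simp add: comp_def)
      then have "bij_betw (\<lambda>x. s (f x)) (carrier X) (carrier X)"
        by (rule iffD1[OF bij_betw_cong, rotated]) (rule sf[symmetric])
      then show False by (rule noret[OF s(1)])
    qed
    then consider n where "\<forall>x\<in>carrier X. (d ^^ n) x = \<zero>\<^bsub>X\<^esub>" | n where "\<forall>x\<in>carrier X. (?d2 ^^ n) x = \<zero>\<^bsub>X\<^esub>"
      using fitting[OF artin X d(1)] fitting[OF artin X d2] by blast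
    then show ?thesis
    proof cases
      case 1
      have e0: "e z = \<zero>\<^bsub>Y\<^esub>" if z: "z \<in> carrier Y" for z
        by (rule idempotent_zero_if_nilpotent_restriction[OF ex rX rM' Y min e ee e'(1) ge d(1) fd bspec[OF 1] z])
      have "a = \<zero>\<^bsub>A\<^esub>" if a: "a \<in> carrier A" for a
      proof -
        have az: "(a, \<zero>\<^bsub>B\<^esub>) \<in> carrier (mod_sum A B)" using a by simp
        have "e (\<theta>' (a, \<zero>\<^bsub>B\<^esub>)) = \<theta>' (a, \<zero>\<^bsub>B\<^esub>)" unfolding e_def \<theta>(4)[OF az] by simp
        then have "\<theta>' (a, \<zero>\<^bsub>B\<^esub>) = \<zero>\<^bsub>Y\<^esub>" using e0[OF rhom_closed[OF \<theta>(2) az]] by simp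
        then show ?thesis using \<theta>(4)[OF az] rhom_zero[OF \<theta>(1) Y right_module_mod_sum[OF rA rB]] by simp
      qed
      then have "zero_mod A" unfolding zero_mod_def by auto
      then show ?thesis ..
    next
      case 2
      have e20: "?e2 z = \<zero>\<^bsub>Y\<^esub>" if z: "z \<in> carrier Y" for z
      proof (rule idempotent_zero_if_nilpotent_restriction[OF ex rX rM' Y min e2 _ e2' _ d2 _ bspec[OF 2] z])
        show "?e2 (?e2 z) = ?e2 z" if z: "z \<in> carrier Y" for z
        proof -
          note ez = rhom_closed[OF e z]
          have "e (?e2 z) = \<zero>\<^bsub>Y\<^esub>" using rhom_diff[OF e Y Y z ez] ee[OF z] ez by (simp add: Y.minus_eq Y.r_neg)
          then show ?thesis using rhom_closed[OF e2 z] by simp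
        qed
        show "g (?e2' m) = ?e2 (g m)" if m: "m \<in> carrier M'" for m
          using rhom_diff[OF D(2) rM' Y m rhom_closed[OF e'(1) m]] ge[OF m] by simp
        show "f (?d2 x) = ?e2' (f x)" if x: "x \<in> carrier X" for x
          using rhom_diff[OF D(1) rX rM' x rhom_closed[OF d(1) x]] fd[OF x] by simp
      qed
      have "b = \<zero>\<^bsub>B\<^esub>" if b: "b \<in> carrier B" for b
      proof -
        have bz: "(\<zero>\<^bsub>A\<^esub>, b) \<in> carrier (mod_sum A B)" using b by simp
        have "(\<zero>\<^bsub>A\<^esub>, \<zero>\<^bsub>B\<^esub>) = \<zero>\<^bsub>mod_sum A B\<^esub>" by simp
        then have "\<theta>' (\<zero>\<^bsub>A\<^esub>, \<zero>\<^bsub>B\<^esub>) = \<zero>\<^bsub>Y\<^esub>" using rhom_zero[OF \<theta>(2) right_module_mod_sum[OF rA rB] Y] by simp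
        then have "e (\<theta>' (\<zero>\<^bsub>A\<^esub>, b)) = \<zero>\<^bsub>Y\<^esub>" unfolding e_def \<theta>(4)[OF bz] by simp
        then have "\<theta>' (\<zero>\<^bsub>A\<^esub>, b) = \<zero>\<^bsub>Y\<^esub>" using e20[OF rhom_closed[OF \<theta>(2) bz]] rhom_closed[OF \<theta>(2) bz] by simp
        then show ?thesis using \<theta>(4)[OF bz] rhom_zero[OF \<theta>(1) Y right_module_mod_sum[OF rA rB]] by simp
      qed
      then have "zero_mod B" unfolding zero_mod_def by auto
      then show ?thesis ..
    qed
  qed
  ultimately show ?thesis unfolding indecomposable_def using fgY by blast
qed

end

section \<open>Mutation of twin rigid modules\<close>

lemma rigid_iff: "rigid R M \<longleftrightarrow> fg_mod R M \<and> ext_zero R M M"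
  using trivial_Ext1_iff[of R M M] by (auto simp: rigid_def fg_mod_def dest: right_moduleD)

lemma pair_class_iso:
  assumes "mod_iso R I I'" "right_module R I"
  shows "pair_class R P I = pair_class R P I'"
  using mod_iso_trans[OF assms(1)] mod_iso_trans[OF mod_iso_sym[OF assms]] unfolding pair_class_def by blast

lemma basic_twin_rigid_iso:
  assumes b: "basic_twin_rigid R P I" and iso: "mod_iso R I I'" and I': "right_module R I'"
  shows "basic_twin_rigid R P I'"
proof -
  have fgI: "fg_mod R I" and II: "ext_zero R I I" and P: "rigid R P"
    using b by (auto simp: basic_twin_rigid_def twin_rigid_def rigid_iff)
  note rI = fg_modD(1)[OF fgI]
  have fgI': "fg_mod R I'" by (rule fg_mod_iso[OF fgI iso I'])
  have I'I: "in_add R I I'" by (rule in_add_iso[OF fgI in_add_self[OF fgI] iso I'])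
  have II': "in_add R I' I" by (rule in_add_iso[OF fgI' in_add_self[OF fgI'] mod_iso_sym[OF iso rI] rI])
  have "rigid R I'" unfolding rigid_iff using fgI' ext_zero_in_add[OF fgI I'I fgI I'I II] by blast
  moreover obtain I0 I1 :: "'a umod" and f g where 1: "in_add R I I0" "in_add R I I1" "short_exact R P f I0 g I1"
    using b unfolding basic_twin_rigid_def twin_rigid_def by blast
  moreover obtain P0 P1 :: "'a umod" and f' g' where 2: "in_add R P P0" "in_add R P P1" "short_exact R P1 f' P0 g' I"
    using b unfolding basic_twin_rigid_def twin_rigid_def by blast
  moreover have "in_add R I' I0" "in_add R I' I1" using in_add_trans[OF fgI' II'] 1 by blast+
  moreover obtain f2 g2 where "short_exact R P1 f2 P0 g2 I'"
    using short_exact_iso[OF 2(3) mod_iso_refl mod_iso_refl iso in_addD(2)[OF 2(2)] in_addD(2)[OF 2(1)] rI I']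
    by blast
  ultimately have "twin_rigid R P I'" unfolding twin_rigid_def using P by blast
  moreover have "basic_mod R I'"
    using b fgI' mod_iso_trans[OF mod_iso_sym[OF iso rI]] unfolding basic_twin_rigid_def basic_mod_def by blast
  ultimately show ?thesis using b by (simp add: basic_twin_rigid_def)
qed

theorem proposition3p11:
  fixes K :: "'k ring" and \<phi> :: "'k \<Rightarrow> 'r" and \<Lambda> :: "'r ring"
    and P :: "('r, 'p) module" and X :: "('r, 'x) module"
    and M :: "('r, 'm) module" and M' :: "('r, 'n) module" and f :: "'x \<Rightarrow> 'n"
  assumes "artin_algebra K \<phi> \<Lambda>" and "hereditary \<Lambda>"
    and "basic_mod \<Lambda> P" and "rigid \<Lambda> P"
    and "fg_mod \<Lambda> M" and "indecomposable \<Lambda> X"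
    and "basic_twin_rigid \<Lambda> P (mod_sum X M)"
    and "minimal_left_add_approx \<Lambda> M X f M'"
    and "inj_on f (carrier X)"
  shows "twin_rigid \<Lambda> P (mod_sum (coker_mod X f M') M) \<and>
    (pair_class \<Lambda> P (mod_sum X M), pair_class \<Lambda> P (mod_sum (coker_mod X f M') M))
      \<in> parcs (twin_quiver \<Lambda> P)"
proof -
  interpret hereditary_artin_algebra K \<phi> \<Lambda> using assms(1,2) by (rule hereditary_artin_algebra.intro)
  note artin = assms(1) and basicP = assms(3) and M = assms(5) and X = assms(6)
  have fgX: "fg_mod \<Lambda> X" using X by (simp add: indecomposable_def)
  have fgP: "fg_mod \<Lambda> P" and PP: "ext_zero \<Lambda> P P" using assms(4) by (simp_all add: rigid_iff)
  note rX = fg_modD(1)[OF fgX] and rM = fg_modD(1)[OF M] and rP = fg_modD(1)[OF fgP]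
  let ?I = "mod_sum X M"
  have basic: "basic_mod \<Lambda> ?I" and twin: "twin_rigid \<Lambda> P ?I"
    using assms(7) by (simp_all add: basic_twin_rigid_def)
  have fgI: "fg_mod \<Lambda> ?I" and II: "ext_zero \<Lambda> ?I ?I" using twin by (simp_all add: twin_rigid_def rigid_iff)
  note sumI = in_add_summands[OF fgX M]
  have MM: "ext_zero \<Lambda> M M" and MX: "ext_zero \<Lambda> M X"
    by (rule ext_zero_in_add[OF fgI sumI(2) fgI sumI(2) II], rule ext_zero_in_add[OF fgI sumI(2) fgI sumI(1) II])
  have M': "in_add \<Lambda> M M'" and f: "f \<in> rhom \<Lambda> X M'"
    and approx: "\<And>(N :: 'r umod) g. in_add \<Lambda> M N \<Longrightarrow> g \<in> rhom \<Lambda> X N \<Longrightarrow> \<exists>h\<in>rhom \<Lambda> M' N. \<forall>x\<in>carrier X. h (f x) = g x"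
    and min: "\<And>h. h \<in> rhom \<Lambda> M' M' \<Longrightarrow> (\<And>x. x \<in> carrier X \<Longrightarrow> h (f x) = f x) \<Longrightarrow> bij_betw h (carrier M') (carrier M')"
    using assms(8) by (auto simp: minimal_left_add_approx_def left_add_approx_def)
  note fgM' = in_addD(1)[OF M'] and rM' = in_addD(2)[OF M']
  let ?Y = "coker_mod X f M'"
  have rY: "right_module \<Lambda> ?Y" by (rule right_module_coker_mod[OF rX rM' f])
  obtain g where ex: "short_exact \<Lambda> X f M' g ?Y" using short_exact_coker_mod[OF rX rM' f assms(9)] by blast
  note D = short_exactD[OF ex]
  have fgY: "fg_mod \<Lambda> ?Y" by (rule fg_mod_image[OF fgM' rY D(2,4)])
  have MY: "ext_zero \<Lambda> M ?Y"
    by (rule ext_zero_surj[OF M fgM' fgY D(2,4) ext_zero_in_add_right[OF M M' MM]])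
  \<comment> \<open>The approximation is tested on modules with carriers in one type, hence the copy \<open>N\<close> of \<open>M\<close>.\<close>
  have YM: "ext_zero \<Lambda> ?Y M"
  proof (rule ext_zero_if_extend[OF ex ext_zero_in_add_left[OF M M' rM MM] rX rM' rY rM])
    fix h assume h: "h \<in> rhom \<Lambda> X M"
    obtain N :: "'r umod" where N: "fg_mod \<Lambda> N" "mod_iso \<Lambda> M N" using fg_mod_representative[OF M] by blast
    obtain a a' where a: "a \<in> rhom \<Lambda> M N" "a' \<in> rhom \<Lambda> N M" "\<And>x. x \<in> carrier M \<Longrightarrow> a' (a x) = x"
      by (rule mod_isoE[OF N(2) rM]) (rule that)
    have "in_add \<Lambda> M N" by (rule in_add_iso[OF M in_add_self[OF M] N(2) fg_modD(1)[OF N(1)]])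
    then obtain k where k: "k \<in> rhom \<Lambda> M' N" "\<forall>x\<in>carrier X. k (f x) = a (h x)"
      using approx[OF _ rhom_comp[OF h a(1)]] by blast
    show "\<exists>h'\<in>rhom \<Lambda> M' M. \<forall>x\<in>carrier X. h' (f x) = h x"
      by (rule bexI[OF _ rhom_comp[OF k(1) a(2)]]) (use k(2) a(3) rhom_closed[OF h] in simp)
  qed
  have YM': "ext_zero \<Lambda> ?Y M'" by (rule ext_zero_in_add_right[OF M M' YM])
  have YY: "ext_zero \<Lambda> ?Y ?Y" by (rule ext_zero_surj[OF fgY fgM' fgY D(2,4) YM'])
  let ?T = "mod_sum ?Y M" and ?J = "mod_sum M' M"
  have fgT: "fg_mod \<Lambda> ?T" by (rule fg_mod_sum[OF fgY M])
  note rT = fg_modD(1)[OF fgT]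
  have "ext_zero \<Lambda> ?T ?T"
    by (rule ext_zero_mod_sum_left[OF rY rM rT ext_zero_mod_sum_right[OF YY YM] ext_zero_mod_sum_right[OF MY MM]])
  then have rigT: "rigid \<Lambda> ?T" using fgT by (simp add: rigid_iff)
  note sumT = in_add_summands[OF fgY M]
  interpret X: right_module \<Lambda> X by (rule rX)
  interpret M: right_module \<Lambda> M by (rule rM)
  interpret M': right_module \<Lambda> M' by (rule rM')
  have exJ: "short_exact \<Lambda> ?I (\<lambda>z. (f (fst z), snd z)) ?J (\<lambda>z. g (fst z)) ?Y"
  proof (rule short_exactI)
    show "(\<lambda>z. (f (fst z), snd z)) \<in> rhom \<Lambda> ?I ?J" by (rule rhom_pair[OF rhom_comp[OF rhom_fst f] rhom_snd])
    show "(\<lambda>z. g (fst z)) \<in> rhom \<Lambda> ?J ?Y" by (rule rhom_comp[OF rhom_fst D(2)])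
    show "inj_on (\<lambda>z. (f (fst z), snd z)) (carrier ?I)" using D(3) by (auto simp: inj_on_def)
    show "\<exists>x\<in>carrier ?I. (f (fst x), snd x) = z" if z: "z \<in> carrier ?J" "g (fst z) = \<zero>\<^bsub>?Y\<^esub>" for z
    proof -
      have "fst z \<in> carrier M'" using z(1) by auto
      from D(6)[OF this z(2)] obtain x where "x \<in> carrier X" "f x = fst z" by (rule bexE)
      then show ?thesis using z(1) by (intro bexI[of _ "(x, snd z)"]) auto
    qed
    show "\<exists>z\<in>carrier ?J. g (fst z) = y" if y: "y \<in> carrier ?Y" for y
    proof -
      from D(7)[OF y] obtain z where "z \<in> carrier M'" "g z = y" by (rule bexE)
      then show ?thesis by (intro bexI[of _ "(z, \<zero>\<^bsub>M\<^esub>)"]) auto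
    qed
  qed (auto simp: D(5))
  have exT: "short_exact \<Lambda> X (\<lambda>x. (f x, \<zero>\<^bsub>M\<^esub>)) ?J (\<lambda>z. (g (fst z), snd z)) ?T"
  proof (rule short_exactI)
    show "(\<lambda>x. (f x, \<zero>\<^bsub>M\<^esub>)) \<in> rhom \<Lambda> X ?J" by (rule rhom_pair[OF f rhom_zero_map[OF rM]])
    show "(\<lambda>z. (g (fst z), snd z)) \<in> rhom \<Lambda> ?J ?T" by (rule rhom_pair[OF rhom_comp[OF rhom_fst D(2)] rhom_snd])
    show "inj_on (\<lambda>x. (f x, \<zero>\<^bsub>M\<^esub>)) (carrier X)" using D(3) by (auto simp: inj_on_def)
    show "\<exists>x\<in>carrier X. (f x, \<zero>\<^bsub>M\<^esub>) = z" if z: "z \<in> carrier ?J" "(g (fst z), snd z) = \<zero>\<^bsub>?T\<^esub>" for z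
    proof -
      have "fst z \<in> carrier M'" "g (fst z) = \<zero>\<^bsub>?Y\<^esub>" using z by auto
      from D(6)[OF this] obtain x where "x \<in> carrier X" "f x = fst z" by (rule bexE)
      then show ?thesis using z(2) by (intro bexI[of _ x]) (simp_all add: prod_eq_iff)
    qed
    show "\<exists>z\<in>carrier ?J. (g (fst z), snd z) = y" if y: "y \<in> carrier ?T" for y
    proof -
      have "fst y \<in> carrier ?Y" using y by auto
      from D(7)[OF this] obtain z where "z \<in> carrier M'" "g z = fst y" by (rule bexE)
      then show ?thesis using y by (intro bexI[of _ "(z, snd y)"]) auto
    qed
  qed (auto simp: D(5))
  obtain I0 I1 :: "'r umod" and i p where I01: "in_add \<Lambda> ?I I0" "in_add \<Lambda> ?I I1" "short_exact \<Lambda> P i I0 p I1"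
    using twin unfolding twin_rigid_def by blast
  obtain P0 P1 :: "'r umod" and i' p' where P01: "in_add \<Lambda> P P0" "in_add \<Lambda> P P1" "short_exact \<Lambda> P1 i' P0 p' ?I"
    using twin unfolding twin_rigid_def by blast
  have JT: "in_add \<Lambda> ?T ?J"
    by (rule in_add_mod_sum[OF fgT in_add_trans[OF fgT sumT(2) M'] sumT(2)])
  have JI: "in_add \<Lambda> ?I ?J"
    by (rule in_add_mod_sum[OF fgI in_add_trans[OF fgI sumI(2) M'] sumI(2)])
  have YJ: "ext_zero \<Lambda> ?Y ?J" by (rule ext_zero_mod_sum_right[OF YM' YM])
  note 1 = coresolution_exchange[OF fgI exJ fgT JT sumT(1) YJ I01(1,2) rP I01(3)]
  note 2 = resolution_exchange[OF fgI fgP PP P01 JI sumI(1) rT exT]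
  have twinT: "twin_rigid \<Lambda> P ?T"
    unfolding twin_rigid_def using assms(4) rigT 1 2 by blast
  note nX = basic_mod_exchange(1)[OF artin X M basic]
  have indY: "indecomposable \<Lambda> ?Y" by (rule indecomposable_coker[OF artin X ex M M' rY nX MX min])
  have nY: "\<not> in_add \<Lambda> M ?Y"
  proof
    assume "in_add \<Lambda> M ?Y"
    then have "ext_zero \<Lambda> ?Y X" by (rule ext_zero_in_add_left[OF M _ rX MX])
    from ext_zero_extend[OF this ex rX rM' rY rX rhom_id]
    obtain s where s: "s \<in> rhom \<Lambda> M' X" "\<forall>x\<in>carrier X. s (f x) = x" by (rule bexE)
    have "in_add \<Lambda> M X" by (rule in_add_retract[OF M M' rX f s(1)]) (use s(2) in blast)
    then show False using nX by simp
  qed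
  have btT: "basic_twin_rigid \<Lambda> P ?T"
    using twinT basicP basic_mod_exchange(2)[OF artin X M basic indY nY] by (simp add: basic_twin_rigid_def)
  \<comment> \<open>The quiver only knows modules with carriers in one type, so everything is replaced by
    isomorphic copies.\<close>
  obtain X0 :: "'r umod" where X0: "fg_mod \<Lambda> X0" "mod_iso \<Lambda> X X0" using fg_mod_representative[OF fgX] by blast
  obtain Y0 :: "'r umod" where Y0: "fg_mod \<Lambda> Y0" "mod_iso \<Lambda> ?Y Y0" using fg_mod_representative[OF fgY] by blast
  obtain M0 :: "'r umod" where M0: "fg_mod \<Lambda> M0" "mod_iso \<Lambda> M M0" using fg_mod_representative[OF M] by blast
  obtain M1 :: "'r umod" where M1: "fg_mod \<Lambda> M1" "mod_iso \<Lambda> M' M1" using fg_mod_representative[OF fgM'] by blast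
  obtain I :: "'r umod" where I: "fg_mod \<Lambda> I" "mod_iso \<Lambda> ?I I" using fg_mod_representative[OF fgI] by blast
  obtain T :: "'r umod" where T: "fg_mod \<Lambda> T" "mod_iso \<Lambda> ?T T" using fg_mod_representative[OF fgT] by blast
  note rI = fg_modD(1)[OF fgI]
  have isoI: "mod_iso \<Lambda> I (mod_sum X0 M0)"
    by (rule mod_iso_trans[OF mod_iso_sym[OF I(2) rI] mod_sum_iso[OF X0(2) M0(2) rX rM]])
  have isoT: "mod_iso \<Lambda> T (mod_sum Y0 M0)"
    by (rule mod_iso_trans[OF mod_iso_sym[OF T(2) rT] mod_sum_iso[OF Y0(2) M0(2) rY rM]])
  have M1M0: "in_add \<Lambda> M0 M1"
  proof (rule in_add_iso[OF M0(1) in_add_trans[OF M0(1) _ M'] M1(2) fg_modD(1)[OF M1(1)]])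
    show "in_add \<Lambda> M0 M" by (rule in_add_iso[OF M0(1) in_add_self[OF M0(1)] mod_iso_sym[OF M0(2) rM] rM])
  qed
  have ex0: "\<exists>f' g'. short_exact \<Lambda> X0 f' M1 g' Y0"
    by (rule short_exact_iso[OF ex X0(2) M1(2) Y0(2) rX rM' rY fg_modD(1)[OF Y0(1)]])
  have "(pair_class \<Lambda> P I, pair_class \<Lambda> P T) \<in> parcs (twin_quiver \<Lambda> P)"
  proof -
    have "basic_twin_rigid \<Lambda> P I" by (rule basic_twin_rigid_iso[OF assms(7) I(2) fg_modD(1)[OF I(1)]])
    moreover have "basic_twin_rigid \<Lambda> P T" by (rule basic_twin_rigid_iso[OF btT T(2) fg_modD(1)[OF T(1)]])
    moreover have "indecomposable \<Lambda> X0" by (rule indecomposable_iso[OF X X0(2) fg_modD(1)[OF X0(1)]])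
    moreover have "indecomposable \<Lambda> Y0" by (rule indecomposable_iso[OF indY Y0(2) fg_modD(1)[OF Y0(1)]])
    ultimately show ?thesis
      unfolding twin_quiver_def using M0(1) isoI isoT M1M0 ex0 by simp blast
  qed
  then show ?thesis using twinT pair_class_iso[OF I(2) rI, of P] pair_class_iso[OF T(2) rT, of P] by simp
qed

end
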